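(* Let $d\ge 1$ be an integer, $s\in(0,1)$, $p\ge 2$, $\alpha\in(0,d)$. Let $h:\mathbb{Z}^d\to\mathbb{R}$ satisfy: there is a constant $h_0>0$ with $h(x)\ge h_0$ for all $x\in\mathbb{Z}^d$; and there is a point $x_0\in\mathbb{Z}^d$ such that $h(x)\to\infty$ as $|x-x_0|\to\infty$. Let $f:\mathbb{R}\to\mathbb{R}$, with $F(t)=\int_0^t f(r)\,dr$, satisfy: (1) $f$ is continuous, $f(0)=0$ and $f(t)=o(t^{p-1})$ as $t\to 0^+$; (2) there exist constants $C>0$ and $\tau>\frac{(d+\alpha)p}{2d}$ such that $f(t)\le C(1+t^{\tau-1})$ for all $t>0$; (3) there exists a constant $\theta>p$ such that $0\le\theta F(t)\le 2f(t)t$ for all $t>0$. Then the equation $$(-\Delta)_p^s u+h(x)|u|^{p-2}u=\left(R_\alpha * F(u)\right)f(u),\quad x\in\mathbb{Z}^d,$$ has a strictly positive solution, i.e. a nontrivial weak solution $u\in H_{s,p}$ with $u(x)>0$ for all $x\in\mathbb{Z}^d$.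
   Context: $|x-y|$ is the graph distance on the lattice $\mathbb{Z}^d$, i.e. $|x-y|=\sum_{i=1}^d|x_i-y_i|$. $W_s(x,y)$ ($x\ne y$ in $\mathbb{Z}^d$) is a fixed symmetric positive function with $c_{s,d}|x-y|^{-d-2s}\le W_s(x,y)\le C_{s,d}|x-y|^{-d-2s}$ for $x\neq y$, with positive constants $c_{s,d},C_{s,d}$. For functions $u,v:\mathbb{Z}^d\to\mathbb{R}$, $$\nabla^s u\nabla^s v(x)=\tfrac12\sum_{y\ne x}W_s(x,y)(u(x)-u(y))(v(x)-v(y)),\qquad |\nabla^s u|(x)=\sqrt{\nabla^s u\nabla^s u(x)},$$ $$(-\Delta)_p^s u(x)=\tfrac12\sum_{y\ne x}W_s(x,y)\left(|\nabla^s u|^{p-2}(x)+|\nabla^s u|^{p-2}(y)\right)(u(x)-u(y)).$$ $\int_{\mathbb{Z}^d}u\,d\mu=\sum_{x\in\mathbb{Z}^d}u(x)$ ($\mu$ is counting measure). $R_\alpha(x,y)=\frac{K_\alpha}{(2\pi)^d}\int_{\mathbb{T}^d}e^{i(x-y)\cdot k}\mu^{-\alpha/2}(k)\,dk$, where $\mathbb{T}^d=[0,2\pi]^d$, $\mu(k)=2d-2\sum_{j=1}^d\cos(k_j)$ and $K_\alpha=\frac{1}{(2\pi)^d}\int_{\mathbb{T}^d}\mu^{\alpha/2}(k)\,dk$ (this is the Green's function of the discrete fractional Laplacian). $(R_\alpha*g)(x)=\sum_{y\in\mathbb{Z}^d}R_\alpha(x,y)g(y)$. $H_{s,p}$ is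 the completion of the space $C_c(\mathbb{Z}^d)$ of finitely supported real functions with respect to $\|u\|_{H_{s,p}}=\left(\int_{\mathbb{Z}^d}(|\nabla^s u|^p+h|u|^p)\,d\mu\right)^{1/p}$; since $h\ge h_0>0$, it is regarded as a space of functions on $\mathbb{Z}^d$ contained in $\ell^p(\mathbb{Z}^d)$. A function $u\in H_{s,p}$ is a nontrivial weak solution of the equation if $u\ne0$ and for every $\phi\in H_{s,p}$ $$\int_{\mathbb{Z}^d}\left(|\nabla^s u|^{p-2}\nabla^s u\nabla^s\phi+h|u|^{p-2}u\phi\right)d\mu=\int_{\mathbb{Z}^d}(R_\alpha*F(u))f(u)\phi\,d\mu.$$
   Formalization: It is additionally assumed that f(t) ≠ 0 for some t > 0; without this, f ≡ 0 satisfies (1)–(3), and testing the equation with u itself shows that no nontrivial solution exists. *)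

theory Defs
  imports "HOL-Analysis.Analysis" "HOL-Library.Landau_Symbols"
begin

text \<open>The lattice is \<open>int ^ 'd\<close>, with dimension \<open>CARD('d)\<close>.  Sums over the lattice are
  unordered sums (\<open>infsum\<close>, \<open>has_sum\<close>); for real-valued functions these are absolutely convergent
  sums, i.e. integrals against counting measure.\<close>

definition lattice_dist :: "int ^ 'd \<Rightarrow> int ^ 'd \<Rightarrow> real" where
  "lattice_dist x y = (\<Sum>i\<in>UNIV. \<bar>real_of_int (x $ i) - real_of_int (y $ i)\<bar>)"

text \<open>The diagonal values of the kernel are irrelevant.\<close>

definition fractional_kernel :: "real \<Rightarrow> (int ^ 'd \<Rightarrow> int ^ 'd \<Rightarrow> real) \<Rightarrow> bool" where
  "fractional_kernel s W \<longleftrightarrow>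
     (\<forall>x y. x \<noteq> y \<longrightarrow> W x y = W y x \<and> 0 < W x y) \<and>
     (\<exists>c>0. \<exists>C>0. \<forall>x y. x \<noteq> y \<longrightarrow>
        c * lattice_dist x y powr (- real CARD('d) - 2 * s) \<le> W x y \<and>
        W x y \<le> C * lattice_dist x y powr (- real CARD('d) - 2 * s))"

definition grad_prod ::
  "(int ^ 'd \<Rightarrow> int ^ 'd \<Rightarrow> real) \<Rightarrow> (int ^ 'd \<Rightarrow> real) \<Rightarrow> (int ^ 'd \<Rightarrow> real) \<Rightarrow> int ^ 'd \<Rightarrow> real" where
  "grad_prod W u v x = 1 / 2 * (\<Sum>\<^sub>\<infinity>y\<in>UNIV - {x}. W x y * (u x - u y) * (v x - v y))"

definition grad_norm ::
  "(int ^ 'd \<Rightarrow> int ^ 'd \<Rightarrow> real) \<Rightarrow> (int ^ 'd \<Rightarrow> real) \<Rightarrow> int ^ 'd \<Rightarrow> real" where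
  "grad_norm W u x = sqrt (grad_prod W u u x)"

definition H_norm ::
  "(int ^ 'd \<Rightarrow> int ^ 'd \<Rightarrow> real) \<Rightarrow> real \<Rightarrow> (int ^ 'd \<Rightarrow> real) \<Rightarrow> (int ^ 'd \<Rightarrow> real) \<Rightarrow> real" where
  "H_norm W p h u =
     (\<Sum>\<^sub>\<infinity>x. grad_norm W u x powr p + h x * \<bar>u x\<bar> powr p) powr (1 / p)"

text \<open>The completion of the finitely supported functions, realised as a space of functions: if
  \<open>h\<close> is bounded below by a positive constant, an \<open>H_norm\<close>-Cauchy sequence is Cauchy in
  \<open>\<ell>\<^sup>p\<close>, and the point of the completion it represents is identified with its limit there, which
  is also its pointwise limit.\<close>

definition H_space ::
  "(int ^ 'd \<Rightarrow> int ^ 'd \<Rightarrow> real) \<Rightarrow> real \<Rightarrow> (int ^ 'd \<Rightarrow> real) \<Rightarrow> (int ^ 'd \<Rightarrow> real) set" where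
  "H_space W p h = {u. \<exists>v :: nat \<Rightarrow> int ^ 'd \<Rightarrow> real.
     (\<forall>n. finite {x. v n x \<noteq> 0}) \<and>
     (\<forall>e>0. \<exists>N. \<forall>m\<ge>N. \<forall>n\<ge>N. H_norm W p h (\<lambda>x. v m x - v n x) < e) \<and>
     (\<forall>x. (\<lambda>n. v n x) \<longlonglongrightarrow> u x)}"

definition torus :: "(real ^ 'd) set" where
  "torus = cbox 0 (\<chi> i. 2 * pi)"

definition laplace_symbol :: "real ^ 'd \<Rightarrow> real" where
  "laplace_symbol k = 2 * real CARD('d) - 2 * (\<Sum>j\<in>UNIV. cos (k $ j))"

definition green_const :: "'d::finite itself \<Rightarrow> real \<Rightarrow> real" where
  "green_const _ \<alpha> = 1 / (2 * pi) ^ CARD('d) *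
     (LINT k : (torus :: (real ^ 'd) set) | lborel. laplace_symbol k powr (\<alpha> / 2))"

text \<open>The Fourier integral is real by the symmetry \<open>k \<mapsto> 2\<pi> - k\<close>; \<open>Re\<close> only changes its type.
  The zeros of the symbol form a null set.\<close>

definition green :: "real \<Rightarrow> int ^ 'd \<Rightarrow> int ^ 'd \<Rightarrow> real" where
  "green \<alpha> x y = green_const TYPE('d) \<alpha> / (2 * pi) ^ CARD('d) *
     Re (LINT k : (torus :: (real ^ 'd) set) | lborel.
           exp (\<i> * complex_of_real (\<Sum>j\<in>UNIV. real_of_int (x $ j - y $ j) * k $ j)) *
           complex_of_real (laplace_symbol k powr (- \<alpha> / 2)))"

definition green_conv :: "real \<Rightarrow> (int ^ 'd \<Rightarrow> real) \<Rightarrow> int ^ 'd \<Rightarrow> real" where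
  "green_conv \<alpha> g x = (\<Sum>\<^sub>\<infinity>y. green \<alpha> x y * g y)"

text \<open>Signed for negative \<open>t\<close>, as usual for \<open>\<integral>\<close> from \<open>0\<close> to \<open>t\<close>.\<close>

definition antideriv :: "(real \<Rightarrow> real) \<Rightarrow> real \<Rightarrow> real" where
  "antideriv f t = (LBINT r = 0..ereal t. f r)"

text \<open>A divergent \<open>infsum\<close> is \<open>0\<close> by convention, so convergence of the convolution and of both
  sides of the weak equation is demanded explicitly; for \<open>u\<close> in the space nothing else can
  diverge, \<open>u\<close> being bounded.  For \<open>p = 2\<close> the convention \<open>0 powr 0 = 0\<close> is harmless, as the
  factor \<open>powr (p - 2)\<close> is multiplied by a quantity that vanishes whenever its base does.\<close>

definition nontrivial_weak_solution ::
  "(int ^ 'd \<Rightarrow> int ^ 'd \<Rightarrow> real) \<Rightarrow> real \<Rightarrow> real \<Rightarrow> (int ^ 'd \<Rightarrow> real) \<Rightarrow> (real \<Rightarrow> real) \<Rightarrow>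
   (int ^ 'd \<Rightarrow> real) \<Rightarrow> bool" where
  "nontrivial_weak_solution W p \<alpha> h f u \<longleftrightarrow>
     u \<in> H_space W p h \<and> u \<noteq> (\<lambda>x. 0) \<and>
     (\<forall>x. (\<lambda>y. green \<alpha> x y * antideriv f (u y)) summable_on UNIV) \<and>
     (\<forall>\<phi>\<in>H_space W p h. \<exists>I.
        ((\<lambda>x. grad_norm W u x powr (p - 2) * grad_prod W u \<phi> x
              + h x * \<bar>u x\<bar> powr (p - 2) * u x * \<phi> x) has_sum I) UNIV \<and>
        ((\<lambda>x. green_conv \<alpha> (\<lambda>y. antideriv f (u y)) x * f (u x) * \<phi> x) has_sum I) UNIV)"

text \<open>If \<open>f\<close> vanishes on the positive half-line there is no positive solution, as testing with
  \<open>\<phi> = u\<close> shows.  The conditions \<open>f(t) = o(t\<^sup>p\<^sup>-\<^sup>1)\<close>, \<open>f(t) \<le> C(1 + t\<^sup>\<tau>\<^sup>-\<^sup>1)\<close> and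
  \<open>0 \<le> \<theta> F(t) \<le> 2 f(t) t\<close> all admit such an \<open>f\<close>, so an existence theorem has to exclude it.\<close>

lemma no_positive_solution_if_vanishing:
  fixes W :: "int ^ 'd \<Rightarrow> int ^ 'd \<Rightarrow> real"
  assumes W: "fractional_kernel s W"
    and h: "\<And>x. 0 < h x"
    and f: "\<And>t. 0 < t \<Longrightarrow> f t = 0"
    and sol: "nontrivial_weak_solution W p \<alpha> h f u"
    and pos: "\<And>x. 0 < u x"
  shows False
proof -
  let ?g = "\<lambda>x. grad_norm W u x powr (p - 2) * grad_prod W u u x
              + h x * \<bar>u x\<bar> powr (p - 2) * u x * u x"
  have "u \<in> H_space W p h"
    using sol unfolding nontrivial_weak_solution_def by blast
  then obtain I where I: "(?g has_sum I) UNIV"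
    and "((\<lambda>x. green_conv \<alpha> (\<lambda>y. antideriv f (u y)) x * f (u x) * u x) has_sum I) UNIV"
    using sol unfolding nontrivial_weak_solution_def by blast
  then have "((\<lambda>x::int ^ 'd. 0::real) has_sum I) UNIV"
    using f pos by simp
  then have "I = 0"
    by (metis has_sum_0 has_sum_unique)
  have W_nonneg: "0 \<le> W x y" if "x \<noteq> y" for x y
    using W that unfolding fractional_kernel_def by (meson less_imp_le)
  have "0 \<le> grad_prod W u u x" for x
  proof -
    have "0 \<le> W x y * (u x - u y) * (u x - u y)" if "y \<in> UNIV - {x}" for y
      using W_nonneg[of x y] that by (simp add: mult.assoc)
    then have "0 \<le> (\<Sum>\<^sub>\<infinity>y\<in>UNIV - {x}. W x y * (u x - u y) * (u x - u y))"
      by (rule infsum_nonneg)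
    then show ?thesis
      unfolding grad_prod_def by simp
  qed
  moreover have gt: "0 < h x * \<bar>u x\<bar> powr (p - 2) * u x * u x" for x
    using h[of x] pos[of x] by simp
  ultimately have g: "0 < ?g x" for x
    by (meson add_nonneg_pos mult_nonneg_nonneg powr_ge_zero)
  have "?g 0 = 0"
    by (rule nonneg_has_sum_le_0D[of ?g UNIV I])
       (use I \<open>I = 0\<close> g in \<open>auto intro: less_imp_le\<close>)
  then show False
    using g[of 0] by simp
qed

end

theory Submission
  imports Defs
begin

text \<open>
  The solution is a critical point of
  \<open>J(u) = (1/p) \<Sum> (|\<nabla>\<^sup>s u|\<^sup>p + h |u|\<^sup>p) - (1/2) \<Sum> R(x,y) F(u x) F(u y)\<close>, found by a mountain pass.
  Two features of the lattice make this elementary.  First, \<open>\<ell>\<^sup>p\<close> embeds into \<open>\<ell>\<^sup>\<infinity>\<close>, so a bound on the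
  energy confines the values of \<open>u\<close> to a bounded interval, where \<open>f(t) \<le> C t\<^sup>p\<^sup>-\<^sup>1\<close> and
  \<open>F(t) \<le> C t\<^sup>p\<close>; hence \<open>F(u)\<close> is summable, and its convolution with the bounded kernel \<open>R\<close> is
  bounded.  Second, the row sums of \<open>W\<close> are bounded, so
  \<open>\<Sum> |\<nabla>\<^sup>s u|\<^sup>p \<le> C \<Sum> |u|\<^sup>p\<close>, and the energy space is the weighted space \<open>\<Sum> h |u|\<^sup>p < \<infinity>\<close>
  (\<open>H_spaceI\<close>, \<open>H_spaceD\<close>).

  The mountain pass is carried out for the restriction of \<open>J\<close> to functions on a finite set \<open>B\<close> of
  sites, with both sums in the gradient term cut down to \<open>B\<close> (\<open>finite_dim_mountain_pass\<close>,
  \<open>finite_critical_points\<close>).  With \<open>F\<close> extended evenly, \<open>J\<close> tends to \<open>-\<infinity>\<close> in every direction, because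
  \<open>F(t)\<^sup>2\<close> grows at least like \<open>t\<^sup>\<theta>\<close> with \<open>\<theta> > p\<close> and \<open>R\<close> has a positive diagonal; and replacing \<open>u\<close> by
  \<open>|u|\<close> does not increase \<open>J\<close>, so that the critical point can be chosen nonnegative.  Its level lies
  below the maximum of \<open>J\<close> along a single ray, which does not depend on \<open>B\<close>.

  The inequality \<open>\<theta> F(t) \<le> 2 f(t) t\<close>, together with \<open>R \<ge> 0\<close>, turns the bound on the level into a
  bound on the energy that is uniform in \<open>B\<close> (\<open>fin_energy_apriori\<close>), and the smallness of \<open>f\<close> at \<open>0\<close>
  keeps the maximum of the critical point away from \<open>0\<close> (\<open>critical_point_not_small\<close>).  As \<open>B\<close> exhausts
  the lattice, a subsequence converges pointwise.  Coercivity of \<open>h\<close> makes the tails of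
  \<open>\<Sum> R F(u)\<close> uniformly small and prevents the maximum from escaping to infinity, so the limit is
  nonzero and solves the equation pointwise (\<open>limit_equation\<close>).  A zero of a nonnegative solution would
  force the solution to vanish everywhere, since \<open>W\<close> is positive off the diagonal
  (\<open>strictly_positive\<close>); and summation by parts turns the pointwise equation into the weak one
  (\<open>infinite_summation_by_parts\<close>, \<open>positive_solution\<close>).

  What remains is to verify the hypotheses on the two kernels.  For \<open>R\<close>, write the symbol as
  \<open>\<mu> = 2d(1 - P)\<close> with \<open>P\<close> the mean of the cosines.  The Fourier coefficients of all powers of \<open>P\<close> are
  nonnegative and so are the binomial coefficients of \<open>(1 - P)\<^sup>-\<^sup>\<alpha>\<^sup>/\<^sup>2\<close>, whence \<open>R \<ge> 0\<close>;
  integrability of \<open>\<mu>\<^sup>-\<^sup>\<alpha>\<^sup>/\<^sup>2\<close> for \<open>\<alpha> < d\<close> follows by bounding it by a product of one-dimensional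
  functions (\<open>green_properties\<close>).  The row sums of \<open>W\<close> are bounded by the same device
  (\<open>fractional_kernel_row_sums\<close>).
\<close>


section \<open>A mountain pass in finitely many coordinates\<close>

lemma compact_uniform_small_parameter:
  fixes S :: "'a::topological_space set" and P :: "'a \<Rightarrow> real \<Rightarrow> bool"
  assumes "compact S"
    and loc: "\<And>x. x \<in> S \<Longrightarrow> \<exists>U \<tau>. open U \<and> x \<in> U \<and> 0 < \<tau> \<and> (\<forall>y\<in>U \<inter> S. \<forall>t. 0 < t \<and> t < \<tau> \<longrightarrow> P y t)"
  shows "\<exists>\<tau>>0. \<forall>y\<in>S. \<forall>t. 0 < t \<and> t < \<tau> \<longrightarrow> P y t"
proof -
  obtain U T where UT: "\<And>x. x \<in> S \<Longrightarrow> open (U x) \<and> x \<in> U x \<and> 0 < T x \<and> (\<forall>y\<in>U x \<inter> S. \<forall>t. 0 < t \<and> t < T x \<longrightarrow> P y t)"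
    using loc by metis
  obtain C where C: "C \<subseteq> S" "finite C" "S \<subseteq> (\<Union>x\<in>C. U x)"
    using compactE_image[OF assms(1), of S U] UT by blast
  show ?thesis
  proof (cases "C = {}")
    case True
    then show ?thesis using C by (intro exI[of _ 1]) auto
  next
    case False
    have "0 < Min (T ` C)" using C False UT by (subst Min_gr_iff) auto
    moreover have "P y t" if yt: "y \<in> S" "0 < t" "t < Min (T ` C)" for y t
    proof -
      obtain x where x: "x \<in> C" "y \<in> U x" using C(3) yt(1) by blast
      have "Min (T ` C) \<le> T x" using x C(2) by simp
      then have "t < T x" using yt by simp
      then show ?thesis using UT[of x] yt x C(1) by blast
    qed
    ultimately show ?thesis by (intro exI[of _ "Min (T ` C)"]) auto
  qed
qed

lemma open_Times_slice:
  fixes x :: "'a::topological_space" and W :: "('a \<times> real) set"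
  assumes "open W" "(x, 0) \<in> W"
  shows "\<exists>U \<tau>. open U \<and> x \<in> U \<and> 0 < \<tau> \<and> (\<forall>y\<in>U. \<forall>t. 0 \<le> t \<and> t < \<tau> \<longrightarrow> (y, t) \<in> W)"
proof -
  obtain A B where AB: "open A" "open B" "(x,0) \<in> A \<times> B" "A \<times> B \<subseteq> W"
    using open_prod_elim[OF assms] by metis
  obtain \<tau> where \<tau>: "\<tau> > 0" "ball 0 \<tau> \<subseteq> B"
    using AB open_contains_ball by (metis mem_Sigma_iff)
  show ?thesis
  proof (intro exI conjI)
    show "\<forall>y\<in>A. \<forall>t. 0 \<le> t \<and> t < \<tau> \<longrightarrow> (y, t) \<in> W"
      using AB \<tau> by (auto simp: subset_iff dist_real_def)
  qed (use AB \<tau> in auto)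
qed

lemma compact_box_function_space:
  "compact {u :: 'a \<Rightarrow> real. \<forall>x. \<bar>u x\<bar> \<le> k x}"
proof -
  have "compactin (product_topology (\<lambda>i::'a. euclidean) UNIV) (PiE UNIV (\<lambda>x. {- k x .. k x}))"
    by (subst compactin_PiE) auto
  then have "compact (PiE UNIV (\<lambda>x. {- k x .. k x}))"
    by (simp add: euclidean_product_topology)
  moreover have "PiE UNIV (\<lambda>x. {- k x .. k x}) = {u :: 'a \<Rightarrow> real. \<forall>x. \<bar>u x\<bar> \<le> k x}"
    by (auto simp: PiE_iff abs_le_iff minus_le_iff; metis minus_le_iff)
  ultimately show ?thesis by simp
qed

text \<open>The minimax value \<open>c\<close> is the infimum of the levels \<open>a\<close> at which the component of \<open>0\<close> in the sublevel
set \<open>{J \<le> a}\<close> of a box reaches the boundary of the box; using components in place of paths makes every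
step a statement about compact connected sets.  If \<open>c\<close> were not a critical level, one gradient step of
uniform length would push a component of level slightly above \<open>c\<close> strictly below \<open>c\<close>.  Before the step
the component is replaced by its image under \<open>u \<mapsto> |u|\<close>, which does not raise \<open>J\<close>; therefore only
critical points in the nonnegative cone can obstruct the deformation, and the one obtained is nonnegative.\<close>

proposition finite_dim_mountain_pass:
  fixes J :: "('a \<Rightarrow> real) \<Rightarrow> real" and g :: "'a \<Rightarrow> ('a \<Rightarrow> real) \<Rightarrow> real" and K M \<rho> \<delta> :: real
  assumes B: "finite B" and x0: "x0 \<in> B"
    and J_cont: "continuous_on UNIV J" and g_cont: "\<And>x. x \<in> B \<Longrightarrow> continuous_on UNIV (g x)"
    and deriv: "\<And>u v t. (\<And>x. x \<notin> B \<Longrightarrow> v x = 0) \<Longrightarrow>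
        ((\<lambda>t. J (\<lambda>x. u x + t * v x)) has_real_derivative (\<Sum>x\<in>B. g x (\<lambda>x. u x + t * v x) * v x)) (at t)"
    and J0: "J (\<lambda>x. 0) = 0" and \<delta>: "0 < \<delta>" and \<rho>: "0 < \<rho>" "\<rho> < K"
    and ring: "\<And>u. \<lbrakk>\<And>x. x \<notin> B \<Longrightarrow> u x = 0; \<And>x. \<bar>u x\<bar> \<le> \<rho>; \<exists>x\<in>B. \<bar>u x\<bar> = \<rho>\<rbrakk> \<Longrightarrow> \<delta> \<le> J u"
    and outer: "\<And>u. \<lbrakk>\<And>x. x \<notin> B \<Longrightarrow> u x = 0; \<And>x. \<bar>u x\<bar> \<le> K; \<exists>x\<in>B. \<bar>u x\<bar> = K\<rbrakk> \<Longrightarrow> J u \<le> 0"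
    and J_abs: "\<And>u. J (\<lambda>x. \<bar>u x\<bar>) \<le> J u"
    and segment: "\<And>t. \<lbrakk>0 \<le> t; t \<le> K\<rbrakk> \<Longrightarrow> J (\<lambda>x. if x = x0 then t else 0) \<le> M"
  obtains u where "\<And>x. 0 \<le> u x" "\<And>x. x \<notin> B \<Longrightarrow> u x = 0" "\<And>x. x \<in> B \<Longrightarrow> g x u = 0"
    "0 < J u" "J u \<le> M"
proof -
  define Q where "Q = {u :: 'a \<Rightarrow> real. \<forall>x. \<bar>u x\<bar> \<le> (if x \<in> B then K else 0)}"
  define S where "S = {u \<in> Q. \<exists>x\<in>B. \<bar>u x\<bar> = K}"
  define L where "L a = {u \<in> Q. J u \<le> a}" for a
  define A where "A = {a. connected_component_set (L a) (\<lambda>x. 0) \<inter> S \<noteq> {}}"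
  have K: "0 < K" using \<rho> by simp
  have QD: "u x = 0" if "u \<in> Q" "x \<notin> B" for u x
  proof -
    have "\<bar>u x\<bar> \<le> (if x \<in> B then K else 0)" using that(1) unfolding Q_def by blast
    then show ?thesis using that(2) by simp
  qed
  have QK: "\<bar>u x\<bar> \<le> K" if "u \<in> Q" for u x
  proof -
    have "\<bar>u x\<bar> \<le> (if x \<in> B then K else 0)" using that unfolding Q_def by blast
    then show ?thesis using K by (auto split: if_splits)
  qed
  have QI: "u \<in> Q" if "\<And>x. x \<in> B \<Longrightarrow> \<bar>u x\<bar> \<le> K" "\<And>x. x \<notin> B \<Longrightarrow> u x = 0" for u
    using that unfolding Q_def by auto
  have compQ: "compact Q" unfolding Q_def by (rule compact_box_function_space)
  have coord: "continuous_on T (\<lambda>u::'a \<Rightarrow> real. u x)" for x T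
    by (rule continuous_on_subset[OF continuous_on_product_coordinates subset_UNIV])
  have closedQ: "closed Q"
    unfolding Q_def by (intro closed_Collect_all closed_Collect_le continuous_intros coord)
  have closedJ: "closed {u. J u \<le> a}" for a
    by (intro closed_Collect_le J_cont continuous_intros)
  have L_eq: "L a = Q \<inter> {u. J u \<le> a}" for a
    unfolding L_def by auto
  have closedL: "closed (L a)" and compL: "compact (L a)" for a
    unfolding L_eq using closedQ closedJ compQ by (auto intro: compact_Int_closed)
  have zeroQ: "(\<lambda>x. 0) \<in> Q" using K by (auto intro: QI)
  have A_mem: "a \<in> A" if "connected T" "T \<subseteq> L a" "(\<lambda>x. 0) \<in> T" "T \<inter> S \<noteq> {}" for a T
  proof -
    have "T \<subseteq> connected_component_set (L a) (\<lambda>x. 0)"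
      using that by (intro connected_component_maximal)
    then show ?thesis using that unfolding A_def by blast
  qed
  have MA: "M \<in> A"
  proof (rule A_mem)
    let ?\<gamma> = "\<lambda>t::real. (\<lambda>x. if x = x0 then t else 0)"
    let ?T = "?\<gamma> ` {0..K}"
    have "continuous_on {0..K} ?\<gamma>"
    proof (intro continuous_on_coordinatewise_then_product)
      fix i show "continuous_on {0..K} (\<lambda>t. if i = x0 then t else 0)"
        by (cases "i = x0") (auto intro: continuous_intros)
    qed
    then show "connected ?T" by (intro connected_continuous_image) auto
    have in_Q: "?\<gamma> t \<in> Q" if "t \<in> {0..K}" for t
      using that x0 K by (auto intro!: QI)
    then show "?T \<subseteq> L M" using segment unfolding L_def by auto
    show "(\<lambda>x. 0) \<in> ?T" using K by (intro image_eqI[of _ _ 0]) auto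
    have "?\<gamma> K \<in> S" using in_Q[of K] K x0 unfolding S_def by auto
    moreover have "?\<gamma> K \<in> ?T" using K by (intro imageI) simp
    ultimately show "?T \<inter> S \<noteq> {}" by blast
  qed
  define N where "N u = Max ((\<lambda>x. \<bar>u x\<bar>) ` B)" for u :: "'a \<Rightarrow> real"
  have contN: "continuous_on T N" for T
  proof -
    have "continuous_on T (\<lambda>u :: 'a \<Rightarrow> real. Max ((\<lambda>x. \<bar>u x\<bar>) ` C))" if "finite C" "C \<noteq> {}" for C
      using that
    proof (induction rule: finite_ne_induct)
      case (singleton x)
      then show ?case by (auto intro!: continuous_intros coord)
    next
      case (insert x F)
      have "Max ((\<lambda>x. \<bar>u x\<bar>) ` insert x F) = max \<bar>u x\<bar> (Max ((\<lambda>x. \<bar>u x\<bar>) ` F))" for u :: "'a \<Rightarrow> real"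
        using insert by simp
      then show ?case using insert by (auto intro!: continuous_intros coord)
    qed
    then show ?thesis unfolding N_def using B x0 by blast
  qed
  have N_ex: "\<exists>x\<in>B. \<bar>u x\<bar> = N u" for u
  proof -
    have "N u \<in> (\<lambda>x. \<bar>u x\<bar>) ` B" unfolding N_def using B x0 by (intro Max_in) auto
    then show ?thesis by auto
  qed
  have N_ge: "\<bar>u x\<bar> \<le> N u" if "x \<in> B" for u x
    unfolding N_def using B that by simp
  have A_ge: "\<delta> \<le> a" if aA: "a \<in> A" for a
  proof -
    let ?C = "connected_component_set (L a) (\<lambda>x. 0)"
    obtain w where w: "w \<in> ?C" "w \<in> S" using aA unfolding A_def by blast
    have z: "(\<lambda>x. 0) \<in> ?C" using w by (metis connected_component_in connected_component_refl mem_Collect_eq)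
    have "\<exists>u\<in>?C. N u = \<rho>"
    proof -
      have "connected (N ` ?C)" by (intro connected_continuous_image contN) auto
      moreover have "N (\<lambda>x. 0) \<le> \<rho>" unfolding N_def using B x0 \<rho> by (subst Max_le_iff) auto
      moreover have "\<rho> \<le> N w"
        using w N_ge[of _ w] \<rho> unfolding S_def by force
      ultimately have "\<rho> \<in> N ` ?C"
        using z w connectedD_interval[of "N ` ?C" "N (\<lambda>x. 0)" "N w" \<rho>] by blast
      then show ?thesis by blast
    qed
    then obtain u where u: "u \<in> ?C" "N u = \<rho>" by blast
    have "u \<in> L a" using u connected_component_subset by blast
    then have "u \<in> Q" "J u \<le> a" unfolding L_def by auto
    moreover have "\<delta> \<le> J u"
    proof (rule ring)
      show "u x = 0" if "x \<notin> B" for x using QD \<open>u \<in> Q\<close> that by blast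
      then show "\<bar>u x\<bar> \<le> \<rho>" for x using N_ge[of x u] u \<rho> by (cases "x \<in> B") auto
      show "\<exists>x\<in>B. \<bar>u x\<bar> = \<rho>" using N_ex[of u] u by auto
    qed
    ultimately show ?thesis by simp
  qed
  define c where "c = Inf A"
  have bddA: "bdd_below A" using A_ge by (intro bdd_belowI[of A \<delta>])
  have c\<delta>: "\<delta> \<le> c" unfolding c_def using MA A_ge by (intro cInf_greatest) auto
  have cM: "c \<le> M" unfolding c_def using MA bddA by (intro cInf_lower)
  define Qp where "Qp = {u \<in> Q. \<forall>x. 0 \<le> u x}"
  have "Qp = Q \<inter> {u. \<forall>x. 0 \<le> u x}" unfolding Qp_def by auto
  moreover have "closed {u :: 'a \<Rightarrow> real. \<forall>x. 0 \<le> u x}"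
    by (intro closed_Collect_all closed_Collect_le continuous_intros coord)
  ultimately have compQp: "compact Qp" using compQ by (simp add: compact_Int_closed)
  have "\<exists>u\<in>Qp. J u = c \<and> (\<forall>x\<in>B. g x u = 0)"
  proof (rule ccontr)
    assume no_crit: "\<not> ?thesis"
    \<comment> \<open>The cut-off \<open>m\<close> vanishes at \<open>0\<close> and on the outer boundary, where \<open>J \<le> 0\<close>, so the deformation fixes both.\<close>
    define m where "m u = max 0 (J u - c / 2)" for u
    define \<eta> where "\<eta> u t = (\<lambda>x. if x \<in> B then u x - t * m u * g x u else 0)" for u t
    have cfst: "continuous_on UNIV (\<lambda>z::('a \<Rightarrow> real) \<times> real. G (fst z))" if "continuous_on UNIV G" for G :: "('a \<Rightarrow> real) \<Rightarrow> real"
      by (rule continuous_on_compose2[OF that]) (auto intro: continuous_intros)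
    have m_cont: "continuous_on UNIV m" unfolding m_def by (intro continuous_intros J_cont)
    have \<eta>_cont: "continuous_on UNIV (\<lambda>z. \<eta> (fst z) (snd z))"
    proof (intro continuous_on_coordinatewise_then_product)
      fix x show "continuous_on UNIV (\<lambda>z. \<eta> (fst z) (snd z) x)"
        unfolding \<eta>_def
        by (cases "x \<in> B") (auto intro!: continuous_intros cfst m_cont g_cont coord)
    qed
    have \<eta>0: "\<eta> u 0 = u" if "u \<in> Q" for u
      unfolding \<eta>_def using QD that by auto
    have \<eta>_id: "\<eta> u t = u" if "u \<in> Q" "m u = 0" for u t
      unfolding \<eta>_def using QD that by auto
    have c0: "0 < c" using c\<delta> \<delta> by simp
    have m_S: "J u < c / 2" if "u \<in> S" for u
    proof -
      have "J u \<le> 0" using that QD QK unfolding S_def by (intro outer) auto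
      then show ?thesis using c0 by simp
    qed
    \<comment> \<open>Short steps stay in the box: boundary points do not move, interior points have room.\<close>
    have "\<exists>\<tau>>0. \<forall>u\<in>Qp. \<forall>t. 0 < t \<and> t < \<tau> \<longrightarrow> \<eta> u t \<in> Q"
    proof (rule compact_uniform_small_parameter[OF compQp])
      fix u assume "u \<in> Qp"
      then have uQ: "u \<in> Q" unfolding Qp_def by simp
      show "\<exists>U \<tau>. open U \<and> u \<in> U \<and> 0 < \<tau> \<and> (\<forall>y\<in>U \<inter> Qp. \<forall>t. 0 < t \<and> t < \<tau> \<longrightarrow> \<eta> y t \<in> Q)"
      proof (cases "u \<in> S")
        case True
        have "open {v. J v < c / 2}" by (intro open_Collect_less J_cont continuous_intros)
        moreover have "\<eta> y t \<in> Q" if "y \<in> {v. J v < c / 2} \<inter> Qp" for y t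
          using that \<eta>_id[of y t] unfolding m_def Qp_def by auto
        ultimately show ?thesis using m_S[OF True] by (intro exI[of _ "{v. J v < c / 2}"] exI[of _ 1]) auto
      next
        case False
        then have "N u < K" using N_ex[of u] QK[OF uQ] uQ unfolding S_def
          by (metis (mono_tags, lifting) mem_Collect_eq order_le_less)
        moreover have "open {z. N (\<eta> (fst z) (snd z)) < K}"
          by (intro open_Collect_less continuous_intros continuous_on_compose2[OF contN[of UNIV] \<eta>_cont]) auto
        ultimately obtain U \<tau> where U: "open U" "u \<in> U" "0 < \<tau>"
          "\<forall>y\<in>U. \<forall>t. 0 \<le> t \<and> t < \<tau> \<longrightarrow> N (\<eta> y t) < K"
          using open_Times_slice[of "{z. N (\<eta> (fst z) (snd z)) < K}" u] \<eta>0[OF uQ] by auto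
        have "\<eta> y t \<in> Q" if "N (\<eta> y t) < K" for y t
          using N_ge[of _ "\<eta> y t"] that by (intro QI) (force, simp add: \<eta>_def)
        then show ?thesis using U by (intro exI[of _ U] exI[of _ \<tau>]) auto
      qed
    qed
    then obtain \<tau>1 where \<tau>1: "0 < \<tau>1" "\<And>u t. u \<in> Qp \<Longrightarrow> 0 < t \<Longrightarrow> t < \<tau>1 \<Longrightarrow> \<eta> u t \<in> Q" by blast
    have compY: "compact (Qp \<inter> {u. J u \<le> c})" using compQp closedJ by (rule compact_Int_closed)
    have J\<eta>_cont: "continuous_on UNIV (\<lambda>z. J (\<eta> (fst z) (snd z)))"
      by (rule continuous_on_compose2[OF J_cont \<eta>_cont]) auto
    have "\<exists>\<tau>>0. \<forall>u\<in>Qp \<inter> {u. J u \<le> c}. \<forall>t. 0 < t \<and> t < \<tau> \<longrightarrow> J (\<eta> u t) < c"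
    proof (rule compact_uniform_small_parameter[OF compY])
      fix u assume u: "u \<in> Qp \<inter> {u. J u \<le> c}"
      then have uQ: "u \<in> Q" unfolding Qp_def by simp
      show "\<exists>U \<tau>. open U \<and> u \<in> U \<and> 0 < \<tau> \<and>
          (\<forall>y\<in>U \<inter> (Qp \<inter> {u. J u \<le> c}). \<forall>t. 0 < t \<and> t < \<tau> \<longrightarrow> J (\<eta> y t) < c)"
      proof (cases "J u < c")
        case True
        have "open {z. J (\<eta> (fst z) (snd z)) < c}"
          by (intro open_Collect_less J\<eta>_cont continuous_intros)
        then obtain U \<tau> where U: "open U" "u \<in> U" "0 < \<tau>"
          "\<forall>y\<in>U. \<forall>t. 0 \<le> t \<and> t < \<tau> \<longrightarrow> J (\<eta> y t) < c"
          using open_Times_slice[of "{z. J (\<eta> (fst z) (snd z)) < c}" u] \<eta>0[OF uQ] True by auto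
        then show ?thesis by (intro exI[of _ U] exI[of _ \<tau>]) auto
      next
        case False
        then have Juc: "J u = c" using u by simp
        then obtain x1 where x1: "x1 \<in> B" "g x1 u \<noteq> 0" using no_crit u by blast
        define G where "G z = (\<Sum>x\<in>B. g x (\<eta> (fst z) (snd z)) * g x (fst z))" for z
        have G_cont: "continuous_on UNIV G"
          unfolding G_def
          by (intro continuous_on_sum continuous_on_mult cfst g_cont continuous_on_compose2[OF g_cont \<eta>_cont]) auto
        have "0 < (g x1 u)\<^sup>2" using x1 by simp
        also have "\<dots> \<le> (\<Sum>x\<in>B. (g x u)\<^sup>2)" using x1 B by (intro member_le_sum) auto
        also have "\<dots> = G (u, 0)" unfolding G_def using \<eta>0[OF uQ] by (simp add: power2_eq_square)
        finally have Gpos: "0 < G (u, 0)" .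
        have "open {z. 0 < G z}" by (intro open_Collect_less G_cont continuous_intros)
        then obtain U \<tau> where U: "open U" "u \<in> U" "0 < \<tau>"
          "\<forall>y\<in>U. \<forall>t. 0 \<le> t \<and> t < \<tau> \<longrightarrow> 0 < G (y, t)"
          using open_Times_slice[of "{z. 0 < G z}" u] Gpos by auto
        let ?V = "U \<inter> {v. 0 < m v}"
        have oV: "open ?V" by (intro open_Int U open_Collect_less m_cont continuous_intros)
        have uV: "u \<in> ?V" using U Juc c0 unfolding m_def by auto
        have "J (\<eta> y t) < c" if y: "y \<in> ?V \<inter> (Qp \<inter> {u. J u \<le> c})" and t: "0 < t" "t < \<tau>" for y t
        proof -
          define v where "v x = (if x \<in> B then - m y * g x y else 0)" for x
          have yQ: "y \<in> Q" using y unfolding Qp_def by simp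
          have \<eta>v: "\<eta> y s = (\<lambda>x. y x + s * v x)" for s
            unfolding \<eta>_def v_def using QD[OF yQ] by auto
          have D: "((\<lambda>s. J (\<eta> y s)) has_real_derivative - m y * G (y, s)) (at s)" for s
          proof -
            have "(\<Sum>x\<in>B. g x (\<lambda>x. y x + s * v x) * v x) = - m y * G (y, s)"
              unfolding G_def \<eta>v[symmetric] sum_distrib_left fst_conv snd_conv
              by (intro sum.cong) (auto simp: v_def)
            moreover have "\<And>x. x \<notin> B \<Longrightarrow> v x = 0" unfolding v_def by simp
            ultimately show ?thesis using deriv[of v y s] unfolding \<eta>v by simp
          qed
          have "J (\<eta> y t) < J (\<eta> y 0)"
          proof (rule DERIV_neg_imp_decreasing[OF t(1)])
            fix s assume s: "0 \<le> s" "s \<le> t"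
            then have "0 < G (y, s)" using U y t by auto
            then have "- m y * G (y, s) < 0" using y by auto
            then show "\<exists>l. DERIV (\<lambda>s. J (\<eta> y s)) s :> l \<and> l < 0" using D by blast
          qed
          then show ?thesis using \<eta>0[OF yQ] y by simp
        qed
        then show ?thesis using oV uV U(3) by (intro exI[of _ ?V] exI[of _ \<tau>]) blast
      qed
    qed
    then obtain \<tau>2 where \<tau>2: "0 < \<tau>2"
      "\<And>u t. u \<in> Qp \<Longrightarrow> J u \<le> c \<Longrightarrow> 0 < t \<Longrightarrow> t < \<tau>2 \<Longrightarrow> J (\<eta> u t) < c" by blast
    define t where "t = min \<tau>1 \<tau>2 / 2"
    have t: "0 < t" "t < \<tau>1" "t < \<tau>2" unfolding t_def using \<tau>1(1) \<tau>2(1) by auto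
    have \<eta>t_cont: "continuous_on T (\<lambda>u. \<eta> u t)" for T
    proof -
      have "continuous_on T (\<lambda>u. (u, t))" by (intro continuous_intros)
      from continuous_on_compose2[OF \<eta>_cont this] show ?thesis by simp
    qed
    define Z where "Z = Qp \<inter> {u. c \<le> J (\<eta> u t)}"
    have "closed {u. c \<le> J (\<eta> u t)}"
      by (intro closed_Collect_le continuous_intros continuous_on_compose2[OF J_cont \<eta>t_cont]) auto
    then have compZ: "compact Z" unfolding Z_def using compQp by (intro compact_Int_closed)
    \<comment> \<open>\<open>Z\<close> collects the points that the step fails to push below \<open>c\<close>; on it \<open>J\<close> is bounded away from \<open>c\<close> from above.\<close>
    have "\<exists>a\<in>A. \<forall>u\<in>Z. a < J u"
    proof (cases "Z = {}")
      case True then show ?thesis using MA by auto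
    next
      case False
      obtain z where z: "z \<in> Z" "\<And>u. u \<in> Z \<Longrightarrow> J z \<le> J u"
        using continuous_attains_inf[OF compZ False continuous_on_subset[OF J_cont subset_UNIV]] by blast
      have "c < J z" using z(1) \<tau>2(2)[of z t] t unfolding Z_def by force
      then obtain a where "a \<in> A" "a < J z"
        unfolding c_def using MA cInf_lessD by blast
      then show ?thesis using z(2) by force
    qed
    then obtain a where a: "a \<in> A" "\<And>u. u \<in> Z \<Longrightarrow> a < J u" by blast
    let ?C = "connected_component_set (L a) (\<lambda>x. 0)"
    let ?abs = "\<lambda>u::'a \<Rightarrow> real. (\<lambda>x. \<bar>u x\<bar>)"
    let ?D = "(\<lambda>u. \<eta> u t) ` ?abs ` ?C"
    obtain w where w: "w \<in> ?C" "w \<in> S" using a(1) unfolding A_def by blast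
    have z: "(\<lambda>x. 0) \<in> ?C" using w by (metis connected_component_in connected_component_refl mem_Collect_eq)
    have abs_cont: "continuous_on T ?abs" for T
      by (intro continuous_on_coordinatewise_then_product continuous_intros coord)
    have CL: "?C \<subseteq> L a" by (rule connected_component_subset)
    have absC: "?abs u \<in> Qp" "J (?abs u) \<le> a" if "u \<in> ?C" for u
      using that CL J_abs[of u] unfolding L_def Qp_def Q_def by (fastforce)+
    have "?C = L a \<inter> ?C" using CL by blast
    then have "compact ?C" using compL closed_connected_component[OF closedL] by (metis compact_Int_closed)
    then have compD: "compact ?D" by (intro compact_continuous_image abs_cont \<eta>t_cont)
    have connD: "connected ?D"
      by (intro connected_continuous_image abs_cont \<eta>t_cont connected_connected_component)
    have DQ: "?D \<subseteq> Q" using \<tau>1(2) absC t by blast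
    have Dc: "J v < c" if vD: "v \<in> ?D" for v
    proof -
      obtain u where u: "u \<in> ?C" "v = \<eta> (?abs u) t" using vD by blast
      have "?abs u \<notin> Z" using a(2)[of "?abs u"] absC(2)[OF u(1)] by force
      then show ?thesis using absC(1)[OF u(1)] u(2) unfolding Z_def by auto
    qed
    have "?D \<noteq> {}" using z by blast
    then obtain b where b: "b \<in> ?D" "\<And>v. v \<in> ?D \<Longrightarrow> J v \<le> J b"
      using continuous_attains_sup[OF compD _ continuous_on_subset[OF J_cont subset_UNIV]] by blast
    have m0: "m (\<lambda>x. 0) = 0" unfolding m_def using J0 c0 by simp
    have "J b \<in> A"
    proof (rule A_mem[OF connD])
      show "?D \<subseteq> L (J b)" using DQ b unfolding L_def by blast
      have "\<bar>0 :: real\<bar> = 0" by simp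
      then have "(\<lambda>x. 0) \<in> ?abs ` ?C" using z by (intro image_eqI[where x = "\<lambda>x. 0"]) simp_all
      then show "(\<lambda>x. 0) \<in> ?D" by (rule image_eqI[where f = "\<lambda>u. \<eta> u t", OF \<eta>_id[OF zeroQ m0, symmetric]])
      have aw: "?abs w \<in> S" using w absC[OF w(1)] unfolding S_def Qp_def by auto
      then have "m (?abs w) = 0" using m_S[OF aw] unfolding m_def by simp
      moreover have "?abs w \<in> Q" using absC(1)[OF w(1)] unfolding Qp_def by simp
      ultimately have "\<eta> (?abs w) t = ?abs w" by (rule \<eta>_id[rotated])
      then have "?abs w \<in> ?D" by (rule image_eqI[where f = "\<lambda>u. \<eta> u t", OF sym imageI[OF w(1)]])
      then show "?D \<inter> S \<noteq> {}" using aw by blast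
    qed
    then have "c \<le> J b" unfolding c_def using bddA by (intro cInf_lower)
    then show False using Dc[OF b(1)] by simp
  qed
  then obtain u where u: "u \<in> Qp" "J u = c" "\<forall>x\<in>B. g x u = 0" by blast
  show ?thesis
  proof (rule that[of u])
    show "\<And>x. 0 \<le> u x" "\<And>x. x \<notin> B \<Longrightarrow> u x = 0" using u QD unfolding Qp_def by auto
    show "0 < J u" "J u \<le> M" using u c\<delta> \<delta> cM by auto
  qed (use u in auto)
qed

section \<open>Sums with uniformly small tails\<close>

lemma abs_diff_powr_le:
  fixes a b p :: real
  assumes "0 \<le> p"
  shows "\<bar>a - b\<bar> powr p \<le> 2 powr p * (\<bar>a\<bar> powr p + \<bar>b\<bar> powr p)"
proof -
  have "\<bar>a - b\<bar> powr p \<le> (2 * max \<bar>a\<bar> \<bar>b\<bar>) powr p"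
    using assms by (intro powr_mono2) auto
  also have "\<dots> = 2 powr p * max \<bar>a\<bar> \<bar>b\<bar> powr p"
    by (simp add: powr_mult)
  also have "max \<bar>a\<bar> \<bar>b\<bar> powr p \<le> \<bar>a\<bar> powr p + \<bar>b\<bar> powr p"
    by (auto simp: max_def)
  finally show ?thesis by simp
qed

lemma powr_mult_mult_le:
  fixes a b c p :: real
  assumes "0 \<le> a" "0 \<le> b" "0 \<le> c" "2 \<le> p"
  shows "a powr (p - 2) * b * c \<le> a powr p + b powr p + c powr p"
proof -
  define m where "m = max a (max b c)"
  have m: "a \<le> m" "b \<le> m" "c \<le> m" "0 \<le> m" using assms unfolding m_def by auto
  have "a powr (p - 2) * b * c \<le> m powr (p - 2) * m * m"
    using assms m by (intro mult_mono powr_mono2) auto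
  also have "\<dots> = m powr p"
  proof (cases "m = 0")
    case False
    have "m powr p = m powr ((p - 2) + 2)" by simp
    also have "\<dots> = m powr (p - 2) * m powr 2" by (rule powr_add)
    finally show ?thesis using m False by (simp add: power2_eq_square)
  qed simp
  also have "m powr p \<le> a powr p + b powr p + c powr p"
    unfolding m_def by (auto simp: max_def)
  finally show ?thesis .
qed

lemma square_powr_half: "(a\<^sup>2) powr (p / 2) = \<bar>a\<bar> powr p" for a :: real
proof -
  have "a\<^sup>2 = \<bar>a\<bar> powr 2" by simp
  then show ?thesis by (simp only: powr_powr) simp
qed

text \<open>Jensen's inequality up to a constant, for weights of bounded total mass.  The pointwise bound
\<open>q \<le> l + l\<^sup>1\<^sup>-\<^sup>r q\<^sup>r\<close> is summed and the optimal \<open>l\<close> is inserted, which also yields summability.\<close>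

lemma powr_mean_le:
  fixes w q :: "'a \<Rightarrow> real"
  assumes w: "\<And>y. 0 \<le> w y" "w summable_on Y" "infsum w Y \<le> wt"
    and q: "\<And>y. 0 \<le> q y" and r: "1 \<le> r" and s: "(\<lambda>y. w y * q y powr r) summable_on Y"
  shows "(\<lambda>y. w y * q y) summable_on Y"
    and "(\<Sum>\<^sub>\<infinity>y\<in>Y. w y * q y) powr r \<le> (wt + 1) powr r * (\<Sum>\<^sub>\<infinity>y\<in>Y. w y * q y powr r)"
proof -
  have split: "w y * q y \<le> l * w y + l powr (1 - r) * (w y * q y powr r)" if "0 < l" for l y
  proof (cases "q y \<le> l")
    case True
    then have "w y * q y \<le> l * w y" using w(1)[of y] mult_right_mono[of "q y" l "w y"] by (simp add: mult.commute)
    then show ?thesis using w(1)[of y] by (simp add: add_increasing2)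
  next
    case False
    then have qp: "0 < q y" using that by linarith
    have "q y powr (1 - r) \<le> l powr (1 - r)"
      using False r that by (intro powr_mono2') auto
    then have "q y powr (1 - r) * q y powr r \<le> l powr (1 - r) * q y powr r"
      by (intro mult_right_mono) auto
    moreover have "q y powr (1 - r) * q y powr r = q y"
      using qp by (simp add: powr_add[symmetric])
    ultimately have "w y * q y \<le> w y * (l powr (1 - r) * q y powr r)"
      using w(1) by (intro mult_left_mono) auto
    then show ?thesis using w(1)[of y] that by (simp add: algebra_simps add_increasing)
  qed
  have sum_r: "(\<lambda>y. l * w y + l powr (1 - r) * (w y * q y powr r)) summable_on Y" for l
    by (intro summable_on_add summable_on_cmult_right w s)
  show sq: "(\<lambda>y. w y * q y) summable_on Y"
    by (rule summable_on_comparison_test[OF sum_r[of 1]]) (use split[of 1] w q in auto)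
  define X where "X = (\<Sum>\<^sub>\<infinity>y\<in>Y. w y * q y powr r)"
  define I where "I = (\<Sum>\<^sub>\<infinity>y\<in>Y. w y * q y)"
  have X0: "0 \<le> X" unfolding X_def using w by (intro infsum_nonneg) auto
  have I0: "0 \<le> I" unfolding I_def using w q by (intro infsum_nonneg) auto
  have wt: "0 \<le> wt" using w infsum_nonneg[of Y w] by force
  have le: "I \<le> l * wt + l powr (1 - r) * X" if "0 < l" for l
  proof -
    have "I \<le> (\<Sum>\<^sub>\<infinity>y\<in>Y. l * w y + l powr (1 - r) * (w y * q y powr r))"
      unfolding I_def by (rule infsum_mono[OF sq sum_r]) (rule split[OF that])
    also have "\<dots> = l * infsum w Y + l powr (1 - r) * X"
      unfolding X_def by (simp add: infsum_add summable_on_cmult_right w s infsum_cmult_right')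
    also have "\<dots> \<le> l * wt + l powr (1 - r) * X"
      using w(3) that by (simp add: mult_left_mono)
    finally show ?thesis .
  qed
  have "I powr r \<le> (wt + 1) powr r * X"
  proof (cases "X = 0")
    case True
    have "I \<le> 0"
    proof (rule field_le_epsilon)
      fix e :: real assume e: "0 < e"
      have "I \<le> e / (wt + 1) * wt" using le[of "e / (wt + 1)"] True wt e by simp
      also have "\<dots> \<le> e" using wt e by (simp add: field_simps)
      finally show "I \<le> 0 + e" by simp
    qed
    then show ?thesis using I0 True by simp
  next
    case False
    then have Xp: "0 < X" using X0 by simp
    define l where "l = X powr (1 / r)"
    have "l powr (1 - r) * X = X powr (1 / r * (1 - r) + 1)"
      unfolding l_def using Xp by (simp add: powr_powr powr_add)
    also have "1 / r * (1 - r) + 1 = 1 / r" using r by (simp add: field_simps)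
    finally have "I \<le> l * (wt + 1)" using le[of l] Xp unfolding l_def by (simp add: algebra_simps)
    then have "I powr r \<le> (l * (wt + 1)) powr r" using I0 r by (intro powr_mono2) auto
    also have "\<dots> = (wt + 1) powr r * X"
      unfolding l_def using Xp r wt by (simp add: powr_mult powr_powr)
    finally show ?thesis .
  qed
  then show "(\<Sum>\<^sub>\<infinity>y\<in>Y. w y * q y) powr r \<le> (wt + 1) powr r * (\<Sum>\<^sub>\<infinity>y\<in>Y. w y * q y powr r)"
    unfolding I_def X_def .
qed

text \<open>Fatou's lemma for counting measure: bounds on all finite partial sums survive pointwise limits.\<close>

lemma fatou_summable:
  fixes a :: "nat \<Rightarrow> 'a \<Rightarrow> real"
  assumes lim: "\<And>y. (\<lambda>n. a n y) \<longlonglongrightarrow> b y" and nonneg: "\<And>y. 0 \<le> b y"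
    and bound: "\<And>n T. finite T \<Longrightarrow> N \<le> n \<Longrightarrow> (\<Sum>y\<in>T. a n y) \<le> C"
  shows "b summable_on UNIV"
proof (rule nonneg_bdd_above_summable_on)
  show "bdd_above (sum b ` {F. F \<subseteq> UNIV \<and> finite F})"
  proof (rule bdd_aboveI2)
    fix T :: "'a set" assume "T \<in> {F. F \<subseteq> UNIV \<and> finite F}"
    then have T: "finite T" by simp
    show "sum b T \<le> C"
    proof (rule tendsto_upperbound)
      show "(\<lambda>n. \<Sum>y\<in>T. a n y) \<longlonglongrightarrow> sum b T" by (intro tendsto_sum lim)
      show "eventually (\<lambda>n. (\<Sum>y\<in>T. a n y) \<le> C) sequentially"
        using bound[OF T] by (rule eventually_sequentiallyI)
    qed simp
  qed
qed (rule nonneg)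

text \<open>Vitali's convergence theorem for sums: pointwise convergence suffices when the tails are small uniformly
in \<open>n\<close>.  The range of summation is allowed to grow with \<open>n\<close>, as the finite approximations do.\<close>

lemma tight_sums_tendsto:
  fixes a :: "nat \<Rightarrow> 'a \<Rightarrow> real"
  assumes lim: "\<And>y. (\<lambda>n. a n y) \<longlonglongrightarrow> b y"
    and tight: "\<And>e. 0 < e \<Longrightarrow> \<exists>A. finite A \<and> (\<forall>n T. finite T \<and> T \<inter> A = {} \<longrightarrow> (\<Sum>y\<in>T. \<bar>a n y\<bar>) \<le> e)"
    and B: "\<And>n. finite (B n)" "\<And>y. eventually (\<lambda>n. y \<in> B n) sequentially"
  shows "b summable_on UNIV" and "(\<lambda>n. \<Sum>y\<in>B n. a n y) \<longlonglongrightarrow> infsum b UNIV"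
proof -
  have tail: "(\<Sum>y\<in>T. \<bar>b y\<bar>) \<le> e"
    if "\<And>n. (\<Sum>y\<in>T. \<bar>a n y\<bar>) \<le> e" for T e
  proof (rule tendsto_upperbound)
    show "(\<lambda>n. \<Sum>y\<in>T. \<bar>a n y\<bar>) \<longlonglongrightarrow> (\<Sum>y\<in>T. \<bar>b y\<bar>)"
      by (intro tendsto_intros lim)
  qed (use that in auto)
  show sb: "b summable_on UNIV"
  proof -
    obtain A where A: "finite A" "\<And>n T. finite T \<Longrightarrow> T \<inter> A = {} \<Longrightarrow> (\<Sum>y\<in>T. \<bar>a n y\<bar>) \<le> 1"
      using tight[of 1] by auto
    have "(\<lambda>x. norm (b x)) summable_on UNIV"
    proof (rule nonneg_bdd_above_summable_on)
      show "bdd_above (sum (\<lambda>x. norm (b x)) ` {F. F \<subseteq> UNIV \<and> finite F})"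
      proof (rule bdd_aboveI2)
        fix F :: "'a set" assume "F \<in> {F. F \<subseteq> UNIV \<and> finite F}"
        then have F: "finite F" by simp
        have "(\<Sum>x\<in>F. norm (b x)) = (\<Sum>x\<in>F \<inter> A. \<bar>b x\<bar>) + (\<Sum>x\<in>F - A. \<bar>b x\<bar>)"
          using F by (simp add: sum.Int_Diff)
        also have "(\<Sum>x\<in>F \<inter> A. \<bar>b x\<bar>) \<le> (\<Sum>x\<in>A. \<bar>b x\<bar>)" using A by (intro sum_mono2) auto
        also have "(\<Sum>x\<in>F - A. \<bar>b x\<bar>) \<le> 1" using F by (intro tail A) auto
        finally show "(\<Sum>x\<in>F. norm (b x)) \<le> (\<Sum>x\<in>A. \<bar>b x\<bar>) + 1" by simp
      qed
    qed simp
    then show ?thesis by (rule abs_summable_summable)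
  qed
  show "(\<lambda>n. \<Sum>y\<in>B n. a n y) \<longlonglongrightarrow> infsum b UNIV"
  proof (rule LIMSEQ_I)
    fix r :: real assume r: "0 < r"
    obtain A where A: "finite A" "\<And>n T. finite T \<Longrightarrow> T \<inter> A = {} \<Longrightarrow> (\<Sum>y\<in>T. \<bar>a n y\<bar>) \<le> r / 4"
      using tight[of "r / 4"] r by auto
    have sbA: "b summable_on (UNIV - A)" using sb summable_on_subset by blast
    have "(\<lambda>x. norm (b x)) summable_on (UNIV - A)" using sbA summable_on_iff_abs_summable_on_real by blast
    then have "norm (infsum b (UNIV - A)) \<le> (\<Sum>\<^sub>\<infinity>y\<in>UNIV - A. norm (b y))" by (rule norm_infsum_bound)
    also have "\<dots> \<le> r / 4"
    proof (rule infsum_le_finite_sums)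
      show "sum (\<lambda>y. norm (b y)) F \<le> r / 4" if "finite F" "F \<subseteq> UNIV - A" for F
        using tail[of F "r / 4"] A(2)[of F] that by auto
    qed fact
    finally have inf_tail: "\<bar>infsum b (UNIV - A)\<bar> \<le> r / 4" by simp
    have "infsum b UNIV = infsum b (A \<union> (UNIV - A))" by simp
    also have "\<dots> = sum b A + infsum b (UNIV - A)"
      using A sbA by (subst infsum_Un_disjoint) auto
    finally have inf_eq: "infsum b UNIV = sum b A + infsum b (UNIV - A)" .
    have "(\<lambda>n. \<Sum>y\<in>A. a n y) \<longlonglongrightarrow> sum b A" by (intro tendsto_sum lim)
    then have e1: "eventually (\<lambda>n. \<bar>(\<Sum>y\<in>A. a n y) - sum b A\<bar> < r / 4) sequentially"
      using r tendstoD[of _ "sum b A" sequentially "r / 4"] by (simp add: dist_real_def)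
    have e2: "eventually (\<lambda>n. \<forall>y\<in>A. y \<in> B n) sequentially"
      using A(1) B(2) by (simp add: eventually_ball_finite)
    have "eventually (\<lambda>n. norm ((\<Sum>y\<in>B n. a n y) - infsum b UNIV) < r) sequentially"
      using e1 e2
    proof eventually_elim
      case (elim n)
      have "(\<Sum>y\<in>B n. a n y) = (\<Sum>y\<in>A. a n y) + (\<Sum>y\<in>B n - A. a n y)"
        using elim A B by (subst sum.subset_diff[of A "B n"]) auto
      moreover have "\<bar>\<Sum>y\<in>B n - A. a n y\<bar> \<le> r / 4"
        by (rule order_trans[OF sum_abs A(2)]) (use B in auto)
      ultimately show ?case using elim(1) inf_eq inf_tail unfolding real_norm_def by linarith
    qed
    then show "\<exists>no. \<forall>n\<ge>no. norm ((\<Sum>y\<in>B n. a n y) - infsum b UNIV) < r"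
      by (simp add: eventually_sequentially)
  qed
qed

lemma dominated_sums_tendsto:
  fixes a :: "nat \<Rightarrow> 'a \<Rightarrow> real"
  assumes lim: "\<And>y. (\<lambda>n. a n y) \<longlonglongrightarrow> b y"
    and dom: "\<And>n y. \<bar>a n y\<bar> \<le> k y" "k summable_on UNIV"
    and B: "\<And>n. finite (B n)" "\<And>y. eventually (\<lambda>n. y \<in> B n) sequentially"
  shows "b summable_on UNIV" and "(\<lambda>n. \<Sum>y\<in>B n. a n y) \<longlonglongrightarrow> infsum b UNIV"
proof -
  have t: "\<exists>A. finite A \<and> (\<forall>n T. finite T \<and> T \<inter> A = {} \<longrightarrow> (\<Sum>y\<in>T. \<bar>a n y\<bar>) \<le> e)" if e: "0 < e" for e
  proof -
    have k0: "0 \<le> k y" for y using dom(1)[of 0 y] by (meson abs_ge_zero order_trans)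
    obtain A where A: "finite A" "\<bar>infsum k UNIV - sum k A\<bar> \<le> e"
      using infsum_finite_approximation[OF dom(2) e] by (auto simp: dist_real_def abs_minus_commute)
    have "(\<Sum>y\<in>T. \<bar>a n y\<bar>) \<le> e" if T: "finite T" "T \<inter> A = {}" for n T
    proof -
      have "(\<Sum>y\<in>T. \<bar>a n y\<bar>) \<le> sum k T" by (intro sum_mono dom)
      also have "\<dots> = sum k (T \<union> A) - sum k A" using T A by (subst sum.union_disjoint) auto
      also have "sum k (T \<union> A) \<le> infsum k UNIV" using k0 T A dom by (intro finite_sum_le_infsum) auto
      finally show ?thesis using A(2) by linarith
    qed
    then show ?thesis using A(1) by blast
  qed
  show "b summable_on UNIV" and "(\<lambda>n. \<Sum>y\<in>B n. a n y) \<longlonglongrightarrow> infsum b UNIV"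
    using tight_sums_tendsto[of a b B, OF lim t B] by auto
qed


section \<open>Kernels with bounded row sums\<close>

text \<open>The form in which the decay of \<open>W\<close> at infinity enters the argument.\<close>

locale summable_kernel =
  fixes w :: "'a \<Rightarrow> 'a \<Rightarrow> real" and wt :: real
  assumes w_nonneg: "0 \<le> w x y" and w_sym: "w x y = w y x"
    and w_summable: "w x summable_on UNIV" and w_le: "infsum (w x) UNIV \<le> wt"
begin

lemma wt_nonneg: "0 \<le> wt"
  using w_le[of undefined] infsum_nonneg[of UNIV "w undefined"] w_nonneg by force

definition sq_grad :: "('a \<Rightarrow> real) \<Rightarrow> 'a \<Rightarrow> real" where
  "sq_grad u x = 1 / 2 * (\<Sum>\<^sub>\<infinity>y. w x y * (u x - u y)\<^sup>2)"

lemma sq_grad_nonneg: "0 \<le> sq_grad u x"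
  unfolding sq_grad_def using w_nonneg by (simp add: infsum_nonneg)

lemma pair_summable:
  assumes v: "\<And>x. 0 \<le> v x" "v summable_on UNIV"
  shows pair_summable_fst: "(\<lambda>(x, y). w x y * v x) summable_on UNIV"
    and pair_summable_snd: "(\<lambda>(x, y). w x y * v y) summable_on UNIV"
    and pair_infsum_fst_le: "(\<Sum>\<^sub>\<infinity>(x, y). w x y * v x) \<le> wt * infsum v UNIV"
    and pair_infsum_snd_le: "(\<Sum>\<^sub>\<infinity>(x, y). w x y * v y) \<le> wt * infsum v UNIV"
proof -
  have inner: "((\<lambda>y. w x y * v x) has_sum infsum (w x) UNIV * v x) UNIV" for x
    using w_summable[of x] by (intro has_sum_cmult_left) simp
  have outer: "(\<lambda>x. infsum (w x) UNIV * v x) summable_on UNIV"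
    by (rule summable_on_comparison_test[OF summable_on_cmult_right[OF v(2), of wt]])
       (use v w_le w_nonneg in \<open>auto intro!: mult_right_mono mult_nonneg_nonneg infsum_nonneg\<close>)
  show fst: "(\<lambda>(x, y). w x y * v x) summable_on UNIV"
    using summable_on_SigmaI[where A = UNIV and B = "\<lambda>_. UNIV" and f = "\<lambda>(x,y). w x y * v x"
        and g = "\<lambda>x. infsum (w x) UNIV * v x"] inner outer v w_nonneg by simp
  have "(\<lambda>(x, y). case (y, x) of (x, y) \<Rightarrow> w x y * v x) summable_on (UNIV \<times> UNIV)"
    using fst summable_on_swap[of "\<lambda>(x, y). w x y * v x" UNIV UNIV] by simp
  moreover have "(\<lambda>(x, y). case (y, x) of (x, y) \<Rightarrow> w x y * v x) = (\<lambda>(x, y). w x y * v y)"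
    using w_sym by (auto simp: fun_eq_iff)
  ultimately show snd: "(\<lambda>(x, y). w x y * v y) summable_on UNIV" by simp
  have iter: "infsum D UNIV = (\<Sum>\<^sub>\<infinity>x. \<Sum>\<^sub>\<infinity>y. D (x, y))" if "D summable_on UNIV" for D :: "'a \<times> 'a \<Rightarrow> real"
    using infsum_Sigma_banach[of D UNIV "\<lambda>_. UNIV"] that by simp
  have "(\<Sum>\<^sub>\<infinity>x. \<Sum>\<^sub>\<infinity>y. w x y * v x) = (\<Sum>\<^sub>\<infinity>x. infsum (w x) UNIV * v x)"
    using inner by (intro infsum_cong) (simp add: infsumI)
  also have "\<dots> \<le> (\<Sum>\<^sub>\<infinity>x. wt * v x)"
    using outer v w_le by (intro infsum_mono summable_on_cmult_right mult_right_mono) auto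
  finally have le: "(\<Sum>\<^sub>\<infinity>x. \<Sum>\<^sub>\<infinity>y. w x y * v x) \<le> wt * infsum v UNIV"
    by (simp add: infsum_cmult_right')
  then show "(\<Sum>\<^sub>\<infinity>(x, y). w x y * v x) \<le> wt * infsum v UNIV"
    unfolding iter[OF fst] by simp
  have "(\<Sum>\<^sub>\<infinity>x. \<Sum>\<^sub>\<infinity>y. w x y * v y) = (\<Sum>\<^sub>\<infinity>y. \<Sum>\<^sub>\<infinity>x. w x y * v y)"
    by (rule infsum_swap_banach) (use snd in simp)
  also have "\<dots> = (\<Sum>\<^sub>\<infinity>y. \<Sum>\<^sub>\<infinity>x. w y x * v y)" using w_sym by (intro infsum_cong) auto
  finally show "(\<Sum>\<^sub>\<infinity>(x, y). w x y * v y) \<le> wt * infsum v UNIV"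
    unfolding iter[OF snd] using le by simp
qed

text \<open>The constant in \<open>\<Sum> |\<nabla>\<^sup>s u|\<^sup>p \<le> C \<Sum> |u|\<^sup>p\<close>: one factor from \<open>powr_mean_le\<close>, one from
\<open>abs_diff_powr_le\<close>, one from summing the kernel over either variable.\<close>

definition energy_const :: "real \<Rightarrow> real" where
  "energy_const p = (wt + 1) powr (p / 2) * (2 powr p * (2 * wt))"

lemma energy_const_nonneg: "0 \<le> energy_const p"
  unfolding energy_const_def using wt_nonneg by simp

context
  fixes u :: "'a \<Rightarrow> real" and p :: real
  assumes p: "2 \<le> p" and u: "(\<lambda>x. \<bar>u x\<bar> powr p) summable_on UNIV"
begin

lemma pair_diff_summable: "(\<lambda>(x, y). w x y * \<bar>u x - u y\<bar> powr p) summable_on UNIV"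
  and pair_diff_infsum_le:
    "(\<Sum>\<^sub>\<infinity>(x, y). w x y * \<bar>u x - u y\<bar> powr p) \<le> 2 powr p * (2 * wt) * (\<Sum>\<^sub>\<infinity>x. \<bar>u x\<bar> powr p)"
proof -
  define D where "D = (\<lambda>(x, y). w x y * \<bar>u x - u y\<bar> powr p)"
  define A where "A = (\<lambda>(x, y). w x y * \<bar>u x\<bar> powr p)"
  define B where "B = (\<lambda>(x, y). w x y * \<bar>u y\<bar> powr p)"
  have AB: "A summable_on UNIV" "B summable_on UNIV"
    "infsum A UNIV \<le> wt * (\<Sum>\<^sub>\<infinity>x. \<bar>u x\<bar> powr p)" "infsum B UNIV \<le> wt * (\<Sum>\<^sub>\<infinity>x. \<bar>u x\<bar> powr p)"
    unfolding A_def B_def using pair_summable[of "\<lambda>x. \<bar>u x\<bar> powr p"] u by simp_all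
  have le: "D z \<le> 2 powr p * (A z + B z)" for z
  proof -
    obtain x y where z: "z = (x, y)" by (cases z)
    have "w x y * \<bar>u x - u y\<bar> powr p \<le> w x y * (2 powr p * (\<bar>u x\<bar> powr p + \<bar>u y\<bar> powr p))"
      using p w_nonneg abs_diff_powr_le[of p "u x" "u y"] by (intro mult_left_mono) auto
    then show ?thesis unfolding z D_def A_def B_def by (simp add: algebra_simps)
  qed
  have ABs: "(\<lambda>z. 2 powr p * (A z + B z)) summable_on UNIV"
    by (intro summable_on_cmult_right summable_on_add AB)
  have Ds: "D summable_on UNIV"
    by (rule summable_on_comparison_test[OF ABs le]) (use w_nonneg in \<open>auto simp: D_def\<close>)
  then show "(\<lambda>(x, y). w x y * \<bar>u x - u y\<bar> powr p) summable_on UNIV" unfolding D_def .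
  have "infsum D UNIV \<le> 2 powr p * (infsum A UNIV + infsum B UNIV)"
    using infsum_mono[OF Ds ABs le] by (simp only: infsum_cmult_right' infsum_add[OF AB(1,2)])
  also have "\<dots> \<le> 2 powr p * (wt * (\<Sum>\<^sub>\<infinity>x. \<bar>u x\<bar> powr p) + wt * (\<Sum>\<^sub>\<infinity>x. \<bar>u x\<bar> powr p))"
    by (intro mult_left_mono add_mono AB) simp
  finally show "(\<Sum>\<^sub>\<infinity>(x, y). w x y * \<bar>u x - u y\<bar> powr p) \<le> 2 powr p * (2 * wt) * (\<Sum>\<^sub>\<infinity>x. \<bar>u x\<bar> powr p)"
    unfolding D_def by (simp add: algebra_simps)
qed

lemma sq_grad_term_summable: "(\<lambda>y. w x y * (u x - u y)\<^sup>2) summable_on UNIV"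
  and sq_grad_powr_le: "sq_grad u x powr (p / 2) \<le> (wt + 1) powr (p / 2) * (\<Sum>\<^sub>\<infinity>y. w x y * \<bar>u x - u y\<bar> powr p)"
proof -
  have "(\<lambda>y. w x y * \<bar>u x - u y\<bar> powr p) summable_on UNIV"
    using summable_on_SigmaD1[of "\<lambda>x y. w x y * \<bar>u x - u y\<bar> powr p" UNIV "\<lambda>_. UNIV"] pair_diff_summable by simp
  then have s: "(\<lambda>y. w x y * ((u x - u y)\<^sup>2) powr (p / 2)) summable_on UNIV"
    by (simp add: square_powr_half)
  note pm = powr_mean_le[of "w x" UNIV wt "\<lambda>y. (u x - u y)\<^sup>2" "p / 2", OF w_nonneg w_summable w_le _ _ s]
  show "(\<lambda>y. w x y * (u x - u y)\<^sup>2) summable_on UNIV" using pm(1) p by simp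
  have "sq_grad u x powr (p / 2) \<le> (\<Sum>\<^sub>\<infinity>y. w x y * (u x - u y)\<^sup>2) powr (p / 2)"
    unfolding sq_grad_def using p w_nonneg by (intro powr_mono2) (auto simp: infsum_nonneg)
  also have "\<dots> \<le> (wt + 1) powr (p / 2) * (\<Sum>\<^sub>\<infinity>y. w x y * \<bar>u x - u y\<bar> powr p)"
    using pm(2) p by (simp add: square_powr_half)
  finally show "sq_grad u x powr (p / 2) \<le> (wt + 1) powr (p / 2) * (\<Sum>\<^sub>\<infinity>y. w x y * \<bar>u x - u y\<bar> powr p)" .
qed

lemma sq_grad_powr_summable: "(\<lambda>x. sq_grad u x powr (p / 2)) summable_on UNIV"
  and sq_grad_powr_infsum_le: "(\<Sum>\<^sub>\<infinity>x. sq_grad u x powr (p / 2)) \<le> energy_const p * (\<Sum>\<^sub>\<infinity>x. \<bar>u x\<bar> powr p)"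
proof -
  have pd: "(\<lambda>x. \<Sum>\<^sub>\<infinity>y. w x y * \<bar>u x - u y\<bar> powr p) summable_on UNIV"
    using summable_on_Sigma_banach[of "\<lambda>x y. w x y * \<bar>u x - u y\<bar> powr p" UNIV "\<lambda>_. UNIV"] pair_diff_summable by simp
  then have pd': "(\<lambda>x. (wt + 1) powr (p / 2) * (\<Sum>\<^sub>\<infinity>y. w x y * \<bar>u x - u y\<bar> powr p)) summable_on UNIV"
    by (rule summable_on_cmult_right)
  show s: "(\<lambda>x. sq_grad u x powr (p / 2)) summable_on UNIV"
    by (rule summable_on_comparison_test[OF pd']) (use sq_grad_powr_le in auto)
  have D: "(\<Sum>\<^sub>\<infinity>x. \<Sum>\<^sub>\<infinity>y. w x y * \<bar>u x - u y\<bar> powr p) \<le> 2 powr p * (2 * wt) * (\<Sum>\<^sub>\<infinity>x. \<bar>u x\<bar> powr p)"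
    using infsum_Sigma_banach[of "\<lambda>(x, y). w x y * \<bar>u x - u y\<bar> powr p" UNIV "\<lambda>_. UNIV"]
      pair_diff_summable pair_diff_infsum_le by simp
  have "(\<Sum>\<^sub>\<infinity>x. sq_grad u x powr (p / 2)) \<le> (\<Sum>\<^sub>\<infinity>x. (wt + 1) powr (p / 2) * (\<Sum>\<^sub>\<infinity>y. w x y * \<bar>u x - u y\<bar> powr p))"
    using s pd' sq_grad_powr_le by (intro infsum_mono) auto
  also have "\<dots> = (wt + 1) powr (p / 2) * (\<Sum>\<^sub>\<infinity>x. \<Sum>\<^sub>\<infinity>y. w x y * \<bar>u x - u y\<bar> powr p)"
    by (simp add: infsum_cmult_right')
  also have "\<dots> \<le> energy_const p * (\<Sum>\<^sub>\<infinity>x. \<bar>u x\<bar> powr p)"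
    unfolding energy_const_def using mult_left_mono[OF D, of "(wt + 1) powr (p / 2)"] by (simp add: mult.assoc)
  finally show "(\<Sum>\<^sub>\<infinity>x. sq_grad u x powr (p / 2)) \<le> energy_const p * (\<Sum>\<^sub>\<infinity>x. \<bar>u x\<bar> powr p)" .
qed

end

end

section \<open>The functional on a finite set of sites\<close>

text \<open>The factor \<open>|\<nabla>\<^sup>s u|\<^sup>p\<^sup>-\<^sup>2\<close> as a function of \<open>|\<nabla>\<^sup>s u|\<^sup>2\<close>.  For \<open>p = 2\<close> it is constantly \<open>1\<close>, also
at \<open>0\<close>, because the passage to the limit needs it to be continuous; \<open>q powr 0\<close> jumps at \<open>q = 0\<close>.\<close>

definition half_powr :: "real \<Rightarrow> real \<Rightarrow> real" where
  "half_powr p q = (if p = 2 then 1 else q powr (p / 2 - 1))"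

lemma half_powr_nonneg: "0 \<le> half_powr p q"
  unfolding half_powr_def by simp

lemma half_powr_mono: "2 \<le> p \<Longrightarrow> 0 \<le> a \<Longrightarrow> a \<le> b \<Longrightarrow> half_powr p a \<le> half_powr p b"
  unfolding half_powr_def by (auto intro: powr_mono2)

lemma half_powr_pos: "0 < q \<Longrightarrow> 0 < half_powr p q"
  unfolding half_powr_def by simp

lemma half_powr_mult: 
  assumes "0 \<le> q" "2 \<le> p"
  shows "half_powr p q * q = q powr (p / 2)"
proof (cases "q = 0")
  case False
  then have q: "0 < q" using assms by simp
  have "q powr (p / 2) = q powr ((p / 2 - 1) + 1)" by simp
  also have "\<dots> = q powr (p / 2 - 1) * q powr 1" by (rule powr_add)
  finally show ?thesis using q unfolding half_powr_def by simp
qed (use assms in simp)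

lemma continuous_on_half_powr:
  assumes "2 \<le> p" "continuous_on S g" "\<And>x. x \<in> S \<Longrightarrow> 0 \<le> g x"
  shows "continuous_on S (\<lambda>x. half_powr p (g x))"
  unfolding half_powr_def using assms by (cases "p = 2") (auto intro!: continuous_intros continuous_on_powr')

lemma tendsto_half_powr:
  assumes "2 \<le> p" "(g \<longlongrightarrow> l) F" "\<And>n. 0 \<le> g n" "0 \<le> l"
  shows "((\<lambda>n. half_powr p (g n)) \<longlongrightarrow> half_powr p l) F"
proof -
  have "continuous_on {0..} (half_powr p)"
    by (rule continuous_on_half_powr[of p "{0..}" "\<lambda>x. x", simplified]) (use assms in auto)
  then show ?thesis
    using assms by (intro continuous_on_tendsto_compose[of "{0..}" "half_powr p" g l F]) auto
qed

text \<open>At a zero of \<open>Q\<close> the function \<open>Q\<close> has a minimum, so \<open>D = 0\<close>, and \<open>Q\<^sup>p\<^sup>/\<^sup>2 \<le> Q\<close> near that point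
since \<open>p / 2 \<ge> 1\<close>.\<close>

lemma DERIV_powr_half:
  fixes Q :: "real \<Rightarrow> real"
  assumes D: "(Q has_real_derivative D) (at t)" and Q: "\<And>s. 0 \<le> Q s" and p: "2 \<le> p"
  shows "((\<lambda>s. Q s powr (p / 2)) has_real_derivative p / 2 * half_powr p (Q t) * D) (at t)"
proof -
  consider "p = 2" | "p \<noteq> 2" "0 < Q t" | "p \<noteq> 2" "Q t = 0" using Q[of t] by fastforce
  then show ?thesis
  proof cases
    case 1
    then show ?thesis using D Q unfolding half_powr_def by simp
  next
    case 2
    then show ?thesis using DERIV_fun_powr[OF D, of "p / 2"] unfolding half_powr_def by simp
  next
    case 3
    have D0: "D = 0" using DERIV_local_min[OF D, of 1] 3 Q by auto
    have Q0: "(\<lambda>h. Q (t + h)) \<midarrow>0\<rightarrow> 0"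
      using DERIV_isCont[OF D] 3 unfolding isCont_def by (simp add: LIM_offset_zero_iff)
    have lim: "(\<lambda>h. (Q (t + h) - Q t) / h) \<midarrow>0\<rightarrow> 0" using D D0 unfolding DERIV_def by simp
    have "(\<lambda>h. (Q (t + h) powr (p / 2) - Q t powr (p / 2)) / h) \<midarrow>0\<rightarrow> 0"
    proof (rule Lim_null_comparison)
      have "eventually (\<lambda>h. Q (t + h) < 1) (at 0)" using order_tendstoD(2)[OF Q0] by simp
      then show "eventually (\<lambda>h. norm ((Q (t + h) powr (p / 2) - Q t powr (p / 2)) / h) \<le> \<bar>(Q (t + h) - Q t) / h\<bar>) (at 0)"
      proof eventually_elim
        case (elim h)
        have "Q (t + h) powr (p / 2) \<le> Q (t + h) powr 1"
          using Q[of "t + h"] elim p by (intro powr_mono') auto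
        then show ?case using 3 Q[of "t + h"] by (simp add: divide_right_mono)
      qed
      show "(\<lambda>h. \<bar>(Q (t + h) - Q t) / h\<bar>) \<midarrow>0\<rightarrow> 0" by (rule tendsto_rabs_zero[OF lim])
    qed
    then show ?thesis using D0 3 unfolding DERIV_def half_powr_def by simp
  qed
qed

text \<open>The equation on an abstract countable set of sites: a symmetric, bounded and nonnegative
interaction \<open>R\<close> with diagonal bounded below, a coercive potential, and a nonlinearity that is superlinear
at \<open>0\<close> and at infinity.\<close>

locale choquard = summable_kernel w wt for w :: "'a::countable \<Rightarrow> 'a \<Rightarrow> real" and wt +
  fixes R :: "'a \<Rightarrow> 'a \<Rightarrow> real" and h :: "'a \<Rightarrow> real" and f F :: "real \<Rightarrow> real" and p h0 Rm r0 \<theta> :: real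
  assumes w_pos: "x \<noteq> y \<Longrightarrow> 0 < w x y"
    and R_sym: "R x y = R y x" and R_nonneg: "0 \<le> R x y" and R_le: "R x y \<le> Rm"
    and R_diag: "r0 \<le> R x x" and r0: "0 < r0"
    and p: "2 \<le> p" and \<theta>: "p < \<theta>"
    and h_ge: "h0 \<le> h x" and h0: "0 < h0" and h_coercive: "finite {x. h x \<le> L}"
    and f_cont: "continuous_on UNIV f" and f_zero: "f 0 = 0"
    and F_deriv: "(F has_real_derivative f t) (at t)" and F_zero: "F 0 = 0"
    and f_small: "0 < e \<Longrightarrow> \<exists>d>0. \<forall>t. 0 < t \<and> t < d \<longrightarrow> f t \<le> e * t powr (p - 1)"
    and AR: "0 < t \<Longrightarrow> 0 \<le> \<theta> * F t \<and> \<theta> * F t \<le> 2 * f t * t"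
    and f_nonzero: "\<exists>t>0. f t \<noteq> 0"
begin

lemma F_nonneg: "0 \<le> t \<Longrightarrow> 0 \<le> F t"
  using AR[of t] F_zero \<theta> p by (cases "t = 0") (auto simp: zero_le_mult_iff)

lemma f_nonneg: "0 \<le> t \<Longrightarrow> 0 \<le> f t"
proof (cases "t = 0")
  case False
  assume "0 \<le> t"
  then have t: "0 < t" using False by simp
  have "0 \<le> f t * t" using AR[OF t] by linarith
  then show ?thesis using t by (simp add: zero_le_mult_iff)
qed (use f_zero in simp)

lemma F_le: 
  assumes "0 \<le> t" shows "F t \<le> t * f t"
proof (cases "t = 0")
  case False
  have "2 * F t \<le> \<theta> * F t" using F_nonneg[OF assms] \<theta> p by (intro mult_right_mono) auto
  then show ?thesis using AR[of t] False assms by (simp add: mult.commute)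
qed (use F_zero in simp)

lemma F_le_powr:
  assumes "0 \<le> t" "f t \<le> e * t powr (p - 1)" shows "F t \<le> e * t powr p"
proof (cases "t = 0")
  case False
  have "t powr p = t powr (1 + (p - 1))" by simp
  also have "\<dots> = t powr 1 * t powr (p - 1)" by (rule powr_add)
  also have "\<dots> = t * t powr (p - 1)" using assms by simp
  finally have "t powr p = t * t powr (p - 1)" .
  then show ?thesis using F_le[OF assms(1)] mult_left_mono[OF assms(2,1)] by (simp add: mult.left_commute)
qed (use F_zero in simp)

lemma f_le_powr: "\<exists>C>0. \<forall>t. 0 \<le> t \<and> t \<le> U \<longrightarrow> f t \<le> C * t powr (p - 1)"
proof -
  obtain d where d: "0 < d" "\<And>t. 0 < t \<Longrightarrow> t < d \<Longrightarrow> f t \<le> 1 * t powr (p - 1)"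
    using f_small[of 1] by auto
  have "compact (f ` {0..U})"
    by (intro compact_continuous_image continuous_on_subset[OF f_cont]) auto
  then have "bdd_above (f ` {0..U})" by (simp add: bounded_imp_bdd_above compact_imp_bounded)
  then obtain b where "\<forall>y\<in>f ` {0..U}. y \<le> b" unfolding bdd_above_def by blast
  then have b: "f t \<le> b" if "0 \<le> t" "t \<le> U" for t using that by simp
  define C where "C = 1 + \<bar>b\<bar> / d powr (p - 1)"
  have "f t \<le> C * t powr (p - 1)" if t: "0 \<le> t" "t \<le> U" for t
  proof -
    consider "t = 0" | "0 < t" "t < d" | "d \<le> t" using t by linarith
    then show ?thesis
    proof cases
      case 1 then show ?thesis using f_zero by simp
    next
      case 2
      then have "f t \<le> 1 * t powr (p - 1)" by (rule d(2))
      also have "\<dots> \<le> C * t powr (p - 1)" unfolding C_def using d(1) by (intro mult_right_mono) auto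
      finally show ?thesis .
    next
      case 3
      have "f t \<le> \<bar>b\<bar>" using b[OF t] by simp
      also have "\<dots> = \<bar>b\<bar> / d powr (p - 1) * d powr (p - 1)" using d(1) by simp
      also have "\<dots> \<le> C * t powr (p - 1)"
        unfolding C_def using 3 d(1) p by (intro mult_mono powr_mono2) auto
      finally show ?thesis .
    qed
  qed
  moreover have "0 < C" unfolding C_def by (simp add: add_pos_nonneg)
  ultimately show ?thesis by blast
qed

text \<open>The inequality \<open>\<theta> F \<le> 2 f t\<close> says that \<open>F(t) t\<^sup>-\<^sup>\<theta>\<^sup>/\<^sup>2\<close> is nondecreasing, and it is positive somewhere
because \<open>f\<close> does not vanish identically.\<close>

lemma F_superpower: "\<exists>t1>0. \<exists>k>0. \<forall>t\<ge>t1. k * t powr (\<theta> / 2) \<le> F t"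
proof -
  obtain t0 where t0: "0 < t0" "f t0 \<noteq> 0" using f_nonzero by blast
  then have "0 < f t0" using f_nonneg[of t0] by simp
  then obtain d where d: "0 < d" "\<And>h. 0 < h \<Longrightarrow> h < d \<Longrightarrow> F t0 < F (t0 + h)"
    using DERIV_pos_inc_right[OF F_deriv] by blast
  define t1 where "t1 = t0 + d / 2"
  have t1: "0 < t1" "0 < F t1"
    using t0 d(1) d(2)[of "d / 2"] F_nonneg[of t0] unfolding t1_def by auto
  define k where "k = F t1 * t1 powr (- \<theta> / 2)"
  have "k * t powr (\<theta> / 2) \<le> F t" if t: "t1 \<le> t" for t
  proof -
    have "F t1 * t1 powr (- \<theta> / 2) \<le> F t * t powr (- \<theta> / 2)"
    proof (rule DERIV_nonneg_imp_nondecreasing[OF t])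
      fix s assume s: "t1 \<le> s" "s \<le> t"
      then have s0: "0 < s" using t1 by simp
      have "((\<lambda>s. F s * s powr (- \<theta> / 2)) has_real_derivative
          f s * s powr (- \<theta> / 2) + (- \<theta> / 2 * s powr (- \<theta> / 2 - 1)) * F s) (at s)"
        using s0 by (auto intro!: derivative_eq_intros F_deriv)
      moreover have "0 \<le> f s * s powr (- \<theta> / 2) + (- \<theta> / 2 * s powr (- \<theta> / 2 - 1)) * F s"
      proof -
        have "s powr (- \<theta> / 2) = s powr ((- \<theta> / 2 - 1) + 1)" by simp
        also have "\<dots> = s powr (- \<theta> / 2 - 1) * s powr 1" by (rule powr_add)
        finally have e: "s powr (- \<theta> / 2) = s powr (- \<theta> / 2 - 1) * s" using s0 by simp
        have "0 \<le> s powr (- \<theta> / 2 - 1) * (f s * s - \<theta> / 2 * F s)"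
          using AR[OF s0] by (intro mult_nonneg_nonneg) auto
        then show ?thesis unfolding e by (simp add: algebra_simps)
      qed
      ultimately show "\<exists>y. ((\<lambda>s. F s * s powr (- \<theta> / 2)) has_real_derivative y) (at s) \<and> 0 \<le> y" by blast
    qed
    then have "k * t powr (\<theta> / 2) \<le> F t * t powr (- \<theta> / 2) * t powr (\<theta> / 2)"
      unfolding k_def by (intro mult_right_mono) auto
    also have "\<dots> = F t" using t t1 by (simp add: powr_minus)
    finally show ?thesis .
  qed
  moreover have "0 < k" unfolding k_def using t1 by simp
  ultimately show ?thesis using t1(1) by blast
qed

text \<open>This makes the functional nonpositive far out along every direction: its convex part grows like
\<open>K\<^sup>p\<close>, the interaction at least like \<open>F(K)\<^sup>2\<close>.\<close>

lemma F_square_dominates: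
  assumes "0 \<le> a" shows "\<exists>K0>0. \<forall>K\<ge>K0. a * K powr p \<le> r0 / 2 * (F K)\<^sup>2"
proof -
  obtain t1 k where tk: "0 < t1" "0 < k" "\<And>t. t1 \<le> t \<Longrightarrow> k * t powr (\<theta> / 2) \<le> F t"
    using F_superpower by blast
  define b where "b = 2 * a / (r0 * k\<^sup>2)"
  have b0: "0 \<le> b" unfolding b_def using assms r0 tk by simp
  define K0 where "K0 = max t1 (b powr (1 / (\<theta> - p)))"
  have "a * K powr p \<le> r0 / 2 * (F K)\<^sup>2" if K: "K0 \<le> K" for K
  proof -
    have K1: "t1 \<le> K" "b powr (1 / (\<theta> - p)) \<le> K" using K unfolding K0_def by auto
    have "b = (b powr (1 / (\<theta> - p))) powr (\<theta> - p)" using \<theta> b0 by (simp add: powr_powr)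
    also have "\<dots> \<le> K powr (\<theta> - p)" using K1 \<theta> by (intro powr_mono2) auto
    finally have bK: "b \<le> K powr (\<theta> - p)" .
    have "a * K powr p = r0 / 2 * k\<^sup>2 * b * K powr p" unfolding b_def using r0 tk by simp
    also have "\<dots> \<le> r0 / 2 * k\<^sup>2 * K powr (\<theta> - p) * K powr p"
      using bK r0 by (intro mult_right_mono mult_left_mono) auto
    also have "\<dots> = r0 / 2 * (k\<^sup>2 * (K powr (\<theta> - p) * K powr p))" by simp
    also have "K powr (\<theta> - p) * K powr p = K powr (\<theta> / 2) * K powr (\<theta> / 2)"
      by (simp add: powr_add[symmetric])
    also have "k\<^sup>2 * (K powr (\<theta> / 2) * K powr (\<theta> / 2)) = (k * K powr (\<theta> / 2))\<^sup>2"
      by (simp add: power2_eq_square)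
    also have "r0 / 2 * \<dots> \<le> r0 / 2 * (F K)\<^sup>2"
      using tk(3)[OF K1(1)] tk(2) r0 by (intro mult_left_mono power_mono) auto
    finally show ?thesis .
  qed
  moreover have "0 < K0" unfolding K0_def using tk by simp
  ultimately show ?thesis by blast
qed

text \<open>The derivative of \<open>t \<mapsto> F |t|\<close>: the odd extension of \<open>f\<close> from the positive half-line.\<close>

definition odd_f :: "real \<Rightarrow> real" where "odd_f t = f (max t 0) - f (max (- t) 0)"

lemma odd_f_nonneg_arg: "0 \<le> t \<Longrightarrow> odd_f t = f t"
  unfolding odd_f_def using f_zero by simp

lemma F_cont: "continuous_on S F"
  using F_deriv by (meson DERIV_continuous_on DERIV_subset subset_UNIV)

lemma F_abs_deriv: "((\<lambda>t. F \<bar>t\<bar>) has_real_derivative odd_f t) (at t)"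
proof -
  consider "0 < t" | "t < 0" | "t = 0" by linarith
  then show ?thesis
  proof cases
    case 1
    have "(F has_real_derivative odd_f t) (at t)" using F_deriv[of t] odd_f_nonneg_arg 1 by simp
    then show ?thesis
      by (rule DERIV_cong_ev[THEN iffD1, rotated 3])
         (use 1 in \<open>auto intro!: eventually_mono[OF order_tendstoD(1)[OF tendsto_ident_at, of 0 t UNIV]] simp: eventually_nhds_conv_at\<close>)
  next
    case 2
    have "((\<lambda>s. F (- s)) has_real_derivative f (- t) * (- 1)) (at t)"
      by (rule DERIV_chain2[OF F_deriv]) (auto intro!: derivative_eq_intros)
    moreover have "f (- t) * (- 1) = odd_f t" unfolding odd_f_def using 2 f_zero by simp
    ultimately have "((\<lambda>s. F (- s)) has_real_derivative odd_f t) (at t)" by simp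
    then show ?thesis
      by (rule DERIV_cong_ev[THEN iffD1, rotated 3])
         (use 2 in \<open>auto intro!: eventually_mono[OF order_tendstoD(2)[OF tendsto_ident_at, of t 0 UNIV]] simp: eventually_nhds_conv_at\<close>)
  next
    case 3
    have "(\<lambda>h. F h / h) \<midarrow>0\<rightarrow> 0" using F_deriv[of 0] F_zero f_zero unfolding DERIV_def by simp
    moreover have "filterlim (\<lambda>h::real. \<bar>h\<bar>) (at 0) (at 0)"
      by (auto simp: filterlim_at eventually_at_filter intro!: tendsto_rabs_zero)
    ultimately have "(\<lambda>h. F \<bar>h\<bar> / \<bar>h\<bar>) \<midarrow>0\<rightarrow> 0"
      by (rule filterlim_compose[where g = "\<lambda>h. F h / h"])
    then have "(\<lambda>h. norm (F \<bar>h\<bar> / h)) \<midarrow>0\<rightarrow> 0"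
      using tendsto_norm_zero by fastforce
    then have "(\<lambda>h. F \<bar>h\<bar> / h) \<midarrow>0\<rightarrow> 0" by (rule tendsto_norm_zero_cancel)
    then show ?thesis using 3 F_zero f_zero unfolding DERIV_def odd_f_def by simp
  qed
qed

text \<open>The integrand of \<open>(-\<Delta>)\<^sub>p\<^sup>s u\<close>, with \<open>q\<close> in the place of \<open>|\<nabla>\<^sup>s u|\<^sup>2\<close>, so that the finite
and the infinite problem share it.\<close>

abbreviation flux :: "('a \<Rightarrow> real) \<Rightarrow> ('a \<Rightarrow> real) \<Rightarrow> 'a \<Rightarrow> 'a \<Rightarrow> real" where
  "flux u q z y \<equiv> 1 / 2 * w z y * (half_powr p (q z) + half_powr p (q y)) * (u z - u y)"

definition fin_sq_grad :: "'a set \<Rightarrow> ('a \<Rightarrow> real) \<Rightarrow> 'a \<Rightarrow> real" where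
  "fin_sq_grad B u x = 1 / 2 * (\<Sum>y\<in>B. w x y * (u x - u y)\<^sup>2)"

definition fin_energy :: "'a set \<Rightarrow> ('a \<Rightarrow> real) \<Rightarrow> real" where
  "fin_energy B u = (\<Sum>x\<in>B. fin_sq_grad B u x powr (p / 2) + h x * (u x)\<^sup>2 powr (p / 2))"

definition fin_functional :: "'a set \<Rightarrow> ('a \<Rightarrow> real) \<Rightarrow> real" where
  "fin_functional B u = fin_energy B u / p - 1 / 2 * (\<Sum>x\<in>B. \<Sum>y\<in>B. R x y * F \<bar>u x\<bar> * F \<bar>u y\<bar>)"

definition fin_gradient :: "'a set \<Rightarrow> 'a \<Rightarrow> ('a \<Rightarrow> real) \<Rightarrow> real" where
  "fin_gradient B x u =
     (\<Sum>y\<in>B. flux u (fin_sq_grad B u) x y)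
     + h x * half_powr p ((u x)\<^sup>2) * u x - (\<Sum>y\<in>B. R x y * F \<bar>u y\<bar>) * odd_f (u x)"

lemma fin_sq_grad_nonneg: "0 \<le> fin_sq_grad B u x"
  unfolding fin_sq_grad_def using w_nonneg by (simp add: sum_nonneg)

lemma finite_summation_by_parts:
  fixes P u v :: "'a \<Rightarrow> real"
  assumes "finite B"
  shows "(\<Sum>x\<in>B. (\<Sum>y\<in>B. 1 / 2 * w x y * (P x + P y) * (u x - u y)) * v x)
       = (\<Sum>x\<in>B. 1 / 2 * P x * (\<Sum>y\<in>B. w x y * (u x - u y) * (v x - v y)))"
proof -
  have "(\<Sum>x\<in>B. \<Sum>y\<in>B. w x y * P x * (u x - u y) * v y) = (\<Sum>x\<in>B. \<Sum>y\<in>B. w y x * P y * (u y - u x) * v x)"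
    by (rule sum.swap)
  also have "\<dots> = (\<Sum>x\<in>B. \<Sum>y\<in>B. - (w x y * P y * (u x - u y) * v x))"
    by (intro sum.cong refl) (simp add: w_sym[of _ "_ :: 'a"] algebra_simps)
  finally have e: "(\<Sum>x\<in>B. \<Sum>y\<in>B. w x y * P x * (u x - u y) * v y)
      = (\<Sum>x\<in>B. \<Sum>y\<in>B. - (w x y * P y * (u x - u y) * v x))" .
  have "(\<Sum>x\<in>B. 1 / 2 * P x * (\<Sum>y\<in>B. w x y * (u x - u y) * (v x - v y)))
     = (\<Sum>x\<in>B. \<Sum>y\<in>B. 1 / 2 * (w x y * P x * (u x - u y) * v x)) - 1 / 2 * (\<Sum>x\<in>B. \<Sum>y\<in>B. w x y * P x * (u x - u y) * v y)"
    by (simp add: sum_distrib_left sum_subtractf[symmetric] algebra_simps)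
  also have "\<dots> = (\<Sum>x\<in>B. (\<Sum>y\<in>B. 1 / 2 * w x y * (P x + P y) * (u x - u y)) * v x)"
    unfolding e by (simp add: sum_distrib_left sum_distrib_right sum_subtractf[symmetric] sum.distrib[symmetric] sum_negf add_divide_distrib diff_divide_distrib algebra_simps)
  finally show ?thesis by simp
qed

lemma coord_cont: "continuous_on S (\<lambda>u::'a \<Rightarrow> real. u x)"
  by (rule continuous_on_subset[OF continuous_on_product_coordinates subset_UNIV])

lemma fin_sq_grad_cont: "continuous_on S (\<lambda>u. fin_sq_grad B u x)"
  unfolding fin_sq_grad_def by (intro continuous_intros coord_cont)

lemma F_abs_cont: "continuous_on S (\<lambda>u::'a \<Rightarrow> real. F \<bar>u x\<bar>)"
  by (rule continuous_on_compose2[OF F_cont[of UNIV]]) (auto intro!: continuous_intros coord_cont)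

lemma fin_functional_cont: "continuous_on UNIV (fin_functional B)"
proof -
  have c1: "continuous_on UNIV (\<lambda>u::'a \<Rightarrow> real. (u x)\<^sup>2 powr (p / 2))" for x
    using p by (intro continuous_on_powr' continuous_intros coord_cont) auto
  have c2: "continuous_on UNIV (\<lambda>u. fin_sq_grad B u x powr (p / 2))" for x
    using p fin_sq_grad_nonneg by (intro continuous_on_powr' continuous_intros fin_sq_grad_cont) auto
  show ?thesis
    unfolding fin_functional_def fin_energy_def
    using p by (intro continuous_on_diff continuous_on_divide continuous_on_sum continuous_on_add
        continuous_on_mult continuous_on_const F_abs_cont c1 c2) auto
qed

lemma fin_gradient_cont: "continuous_on UNIV (fin_gradient B x)"
proof -
  have c1: "continuous_on UNIV (\<lambda>u::'a \<Rightarrow> real. half_powr p ((u x)\<^sup>2))" for x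
    using p by (intro continuous_on_half_powr continuous_intros coord_cont) auto
  have c2: "continuous_on UNIV (\<lambda>u. half_powr p (fin_sq_grad B u x))" for x
    using p fin_sq_grad_nonneg by (intro continuous_on_half_powr fin_sq_grad_cont) auto
  have c3: "continuous_on UNIV (\<lambda>u::'a \<Rightarrow> real. odd_f (u x))" for x
    unfolding odd_f_def
    by (intro continuous_intros continuous_on_compose2[OF f_cont] coord_cont) auto
  show ?thesis
    unfolding fin_gradient_def by (intro continuous_on_diff continuous_on_sum continuous_on_add
        continuous_on_mult continuous_on_const F_abs_cont coord_cont c1 c2 c3) 
qed

lemma fin_functional_deriv:
  assumes B: "finite B"
  shows "((\<lambda>t. fin_functional B (\<lambda>x. u x + t * v x)) has_real_derivative
     (\<Sum>x\<in>B. fin_gradient B x (\<lambda>x. u x + t * v x) * v x)) (at t)"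
proof -
  define U where "U s x = u x + s * v x" for s x
  have dU: "((\<lambda>s. U s x) has_real_derivative v x) (at t)" for x
    unfolding U_def by (auto intro!: derivative_eq_intros)
  have dq: "((\<lambda>s. fin_sq_grad B (U s) x) has_real_derivative
      (\<Sum>y\<in>B. w x y * (U t x - U t y) * (v x - v y))) (at t)" for x
  proof -
    have "((\<lambda>s. fin_sq_grad B (U s) x) has_real_derivative
      1 / 2 * (\<Sum>y\<in>B. w x y * (2 * (U t x - U t y) * (v x - v y)))) (at t)"
      unfolding fin_sq_grad_def
      by (intro DERIV_cmult DERIV_sum) (auto intro!: derivative_eq_intros dU)
    then show ?thesis by (simp add: sum_distrib_left algebra_simps)
  qed
  have dE: "((\<lambda>s. fin_energy B (U s)) has_real_derivative
      (\<Sum>x\<in>B. p / 2 * half_powr p (fin_sq_grad B (U t) x) * (\<Sum>y\<in>B. w x y * (U t x - U t y) * (v x - v y))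
        + h x * (p / 2 * half_powr p ((U t x)\<^sup>2) * (2 * U t x * v x)))) (at t)"
    unfolding fin_energy_def
    by (intro DERIV_sum DERIV_add DERIV_cmult DERIV_powr_half dq p fin_sq_grad_nonneg)
       (auto intro!: derivative_eq_intros dU)
  have dF: "((\<lambda>s. F \<bar>U s x\<bar>) has_real_derivative odd_f (U t x) * v x) (at t)" for x
    using DERIV_chain2[OF F_abs_deriv dU] .
  have dR: "((\<lambda>s. \<Sum>x\<in>B. \<Sum>y\<in>B. R x y * F \<bar>U s x\<bar> * F \<bar>U s y\<bar>) has_real_derivative
      (\<Sum>x\<in>B. \<Sum>y\<in>B. R x y * (odd_f (U t x) * v x) * F \<bar>U t y\<bar> + odd_f (U t y) * v y * (R x y * F \<bar>U t x\<bar>))) (at t)"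
    by (intro DERIV_sum DERIV_mult DERIV_cmult dF)
  have swapR: "(\<Sum>x\<in>B. \<Sum>y\<in>B. odd_f (U t y) * v y * (R x y * F \<bar>U t x\<bar>))
      = (\<Sum>x\<in>B. \<Sum>y\<in>B. odd_f (U t x) * v x * (R x y * F \<bar>U t y\<bar>))"
    by (subst sum.swap) (simp add: R_sym)
  have e2: "(\<Sum>x\<in>B. \<Sum>y\<in>B. R x y * (odd_f (U t x) * v x) * F \<bar>U t y\<bar> + odd_f (U t y) * v y * (R x y * F \<bar>U t x\<bar>))
      = 2 * (\<Sum>x\<in>B. (\<Sum>y\<in>B. R x y * F \<bar>U t y\<bar>) * odd_f (U t x) * v x)"
    unfolding sum.distrib swapR by (simp add: sum_distrib_left sum_distrib_right sum.distrib[symmetric] algebra_simps)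
  have e1: "(\<Sum>x\<in>B. p / 2 * half_powr p (fin_sq_grad B (U t) x) * (\<Sum>y\<in>B. w x y * (U t x - U t y) * (v x - v y))
        + h x * (p / 2 * half_powr p ((U t x)\<^sup>2) * (2 * U t x * v x))) / p
     = (\<Sum>x\<in>B. (\<Sum>y\<in>B. 1 / 2 * w x y * (half_powr p (fin_sq_grad B (U t) x) + half_powr p (fin_sq_grad B (U t) y)) * (U t x - U t y)) * v x)
       + (\<Sum>x\<in>B. h x * half_powr p ((U t x)\<^sup>2) * U t x * v x)"
    unfolding finite_summation_by_parts[OF B] sum_divide_distrib sum.distrib[symmetric]
    using p by (intro sum.cong refl) (simp add: field_simps)
  have "((\<lambda>s. fin_functional B (U s)) has_real_derivative (\<Sum>x\<in>B. fin_gradient B x (U t) * v x)) (at t)"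
    unfolding fin_functional_def
    by (rule DERIV_cong[OF DERIV_diff[OF DERIV_cdivide[OF dE] DERIV_cmult[OF dR]]], unfold e1 e2)
       (simp add: fin_gradient_def sum.distrib[symmetric] sum_subtractf[symmetric] algebra_simps)
  then show ?thesis unfolding U_def .
qed

lemma fin_functional_abs: "fin_functional B (\<lambda>x. \<bar>u x\<bar>) \<le> fin_functional B u"
proof -
  have "fin_sq_grad B (\<lambda>x. \<bar>u x\<bar>) x \<le> fin_sq_grad B u x" for x
  proof -
    have "(\<bar>u x\<bar> - \<bar>u y\<bar>)\<^sup>2 \<le> (u x - u y)\<^sup>2" for y
      using abs_triangle_ineq3[of "u x" "u y"] by (simp add: abs_le_square_iff[symmetric])
    then show ?thesis unfolding fin_sq_grad_def using w_nonneg
      by (intro mult_left_mono sum_mono) auto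
  qed
  then have "fin_energy B (\<lambda>x. \<bar>u x\<bar>) \<le> fin_energy B u"
    unfolding fin_energy_def using p fin_sq_grad_nonneg
    by (intro sum_mono add_mono powr_mono2) auto
  then show ?thesis unfolding fin_functional_def using p by (simp add: divide_right_mono)
qed

lemma fin_energy_bounds:
  assumes B: "finite B" and u: "\<And>x. x \<notin> B \<Longrightarrow> u x = 0"
  shows "(\<Sum>x\<in>B. h x * \<bar>u x\<bar> powr p) \<le> fin_energy B u"
    and "fin_energy B u \<le> (\<Sum>x\<in>B. (energy_const p + h x) * \<bar>u x\<bar> powr p)"
proof -
  show "(\<Sum>x\<in>B. h x * \<bar>u x\<bar> powr p) \<le> fin_energy B u"
    unfolding fin_energy_def by (intro sum_mono) (simp add: square_powr_half)
  have up: "((\<lambda>x. \<bar>u x\<bar> powr p) has_sum (\<Sum>x\<in>B. \<bar>u x\<bar> powr p)) UNIV"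
    by (rule has_sum_finite_neutralI[OF B]) (use u in auto)
  then have us: "(\<lambda>x. \<bar>u x\<bar> powr p) summable_on UNIV" by (rule has_sum_imp_summable)
  have "fin_sq_grad B u x \<le> sq_grad u x" for x
    unfolding fin_sq_grad_def sq_grad_def using sq_grad_term_summable[OF p us] w_nonneg B
    by (intro mult_left_mono finite_sum_le_infsum) auto
  then have "(\<Sum>x\<in>B. fin_sq_grad B u x powr (p / 2)) \<le> (\<Sum>x\<in>B. sq_grad u x powr (p / 2))"
    using fin_sq_grad_nonneg p by (intro sum_mono powr_mono2) auto
  also have "\<dots> \<le> (\<Sum>\<^sub>\<infinity>x. sq_grad u x powr (p / 2))"
    using sq_grad_powr_summable[OF p us] B by (intro finite_sum_le_infsum) auto
  also have "\<dots> \<le> energy_const p * (\<Sum>\<^sub>\<infinity>x. \<bar>u x\<bar> powr p)"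
    by (rule sq_grad_powr_infsum_le[OF p us])
  also have "(\<Sum>\<^sub>\<infinity>x. \<bar>u x\<bar> powr p) = (\<Sum>x\<in>B. \<bar>u x\<bar> powr p)" using up by (rule infsumI)
  finally show "fin_energy B u \<le> (\<Sum>x\<in>B. (energy_const p + h x) * \<bar>u x\<bar> powr p)"
    unfolding fin_energy_def by (simp add: sum.distrib square_powr_half sum_distrib_left algebra_simps)
qed

text \<open>Since \<open>R\<close> and \<open>F\<close> are nonnegative, the interaction is at least its single diagonal term at \<open>z\<close>.\<close>

lemma fin_functional_upper:
  assumes B: "finite B" and u: "\<And>x. x \<notin> B \<Longrightarrow> u x = 0" and z: "z \<in> B"
  shows "fin_functional B u \<le> (\<Sum>x\<in>B. (energy_const p + h x) * \<bar>u x\<bar> powr p) / p - r0 / 2 * (F \<bar>u z\<bar>)\<^sup>2"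
proof -
  have nn: "0 \<le> R x y * F \<bar>u x\<bar> * F \<bar>u y\<bar>" for x y
    using R_nonneg F_nonneg by (intro mult_nonneg_nonneg) auto
  have "r0 * (F \<bar>u z\<bar>)\<^sup>2 \<le> R z z * F \<bar>u z\<bar> * F \<bar>u z\<bar>"
    using R_diag[of z] by (simp add: power2_eq_square mult_right_mono mult.assoc)
  also have "\<dots> \<le> (\<Sum>y\<in>B. R z y * F \<bar>u z\<bar> * F \<bar>u y\<bar>)"
    using B z nn by (intro member_le_sum[of z B "\<lambda>y. R z y * F \<bar>u z\<bar> * F \<bar>u y\<bar>"]) auto
  also have "\<dots> \<le> (\<Sum>x\<in>B. \<Sum>y\<in>B. R x y * F \<bar>u x\<bar> * F \<bar>u y\<bar>)"
    using B z nn by (intro member_le_sum[of z B "\<lambda>x. \<Sum>y\<in>B. R x y * F \<bar>u x\<bar> * F \<bar>u y\<bar>"]) (auto intro: sum_nonneg)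
  finally have "r0 / 2 * (F \<bar>u z\<bar>)\<^sup>2 \<le> 1 / 2 * (\<Sum>x\<in>B. \<Sum>y\<in>B. R x y * F \<bar>u x\<bar> * F \<bar>u y\<bar>)" by simp
  moreover have "fin_energy B u / p \<le> (\<Sum>x\<in>B. (energy_const p + h x) * \<bar>u x\<bar> powr p) / p"
    using fin_energy_bounds(2)[OF B u] p by (intro divide_right_mono) auto
  ultimately show ?thesis unfolding fin_functional_def by linarith
qed

lemma Rm_pos: "0 < Rm"
  using R_diag R_le r0 by (meson less_le_trans)

lemma double_R_sum_le:
  assumes "\<And>x. x \<in> B \<Longrightarrow> 0 \<le> a x" "\<And>x. x \<in> B \<Longrightarrow> 0 \<le> b x"
  shows "(\<Sum>x\<in>B. \<Sum>y\<in>B. R x y * a x * b y) \<le> Rm * sum a B * sum b B"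
proof -
  have "(\<Sum>x\<in>B. \<Sum>y\<in>B. R x y * a x * b y) \<le> (\<Sum>x\<in>B. \<Sum>y\<in>B. Rm * a x * b y)"
    using assms R_le by (intro sum_mono mult_right_mono) auto
  also have "\<dots> = Rm * (sum a B * sum b B)"
    unfolding sum_product by (simp add: sum_distrib_left mult.assoc)
  finally show ?thesis by simp
qed

text \<open>Near \<open>0\<close> the interaction is at most a multiple of \<open>(\<Sum> |u|\<^sup>p)\<^sup>2\<close> and the energy at least a multiple of
\<open>\<Sum> |u|\<^sup>p\<close>.  The radius depends on the size of \<open>B\<close>, which is harmless: only the upper bound on the level has
to be uniform.\<close>

lemma fin_functional_ring:
  assumes B: "finite B" and z: "z0 \<in> B" and K: "0 < K"
  obtains \<rho> \<delta> where "0 < \<rho>" "\<rho> < K" "0 < \<delta>"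
    "\<And>u. \<lbrakk>\<And>x. x \<notin> B \<Longrightarrow> u x = 0; \<And>x. \<bar>u x\<bar> \<le> \<rho>; \<exists>x\<in>B. \<bar>u x\<bar> = \<rho>\<rbrakk> \<Longrightarrow> \<delta> \<le> fin_functional B u"
proof -
  obtain d where d: "0 < d" "\<And>t. 0 < t \<Longrightarrow> t < d \<Longrightarrow> f t \<le> 1 * t powr (p - 1)"
    using f_small[of 1] by auto
  \<comment> \<open>With this \<open>c\<close>, a radius \<open>\<rho>\<close> with \<open>\<rho>\<^sup>p \<le> c\<close> makes the interaction at most half of the energy part.\<close>
  define c where "c = h0 / (p * Rm * card B)"
  have cB: "0 < real (card B)" using B z by (auto simp: card_gt_0_iff)
  have c: "0 < c" unfolding c_def using h0 p Rm_pos cB by simp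
  define \<rho> where "\<rho> = min (min (d / 2) (K / 2)) (c powr (1 / p))"
  have \<rho>: "0 < \<rho>" "\<rho> < d" "\<rho> < K" unfolding \<rho>_def using d(1) K c by auto
  have "\<rho> powr p \<le> (c powr (1 / p)) powr p" unfolding \<rho>_def using d(1) K p by (intro powr_mono2) auto
  then have \<rho>c: "\<rho> powr p \<le> c" using c p by (simp add: powr_powr)
  define \<delta> where "\<delta> = h0 / (2 * p) * \<rho> powr p"
  have \<delta>: "0 < \<delta>" unfolding \<delta>_def using h0 p \<rho> by simp
  have "\<delta> \<le> fin_functional B u"
    if u: "\<And>x. x \<notin> B \<Longrightarrow> u x = 0" "\<And>x. \<bar>u x\<bar> \<le> \<rho>" "\<exists>x\<in>B. \<bar>u x\<bar> = \<rho>" for u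
  proof -
    define S where "S = (\<Sum>x\<in>B. \<bar>u x\<bar> powr p)"
    have S1: "\<rho> powr p \<le> S"
    proof -
      obtain x where "x \<in> B" "\<bar>u x\<bar> = \<rho>" using u(3) by blast
      then show ?thesis unfolding S_def using B member_le_sum[of x B "\<lambda>x. \<bar>u x\<bar> powr p"] by auto
    qed
    have S0: "0 \<le> S" unfolding S_def by (intro sum_nonneg) auto
    have "S \<le> (\<Sum>x\<in>B. \<rho> powr p)" unfolding S_def using u(2) p by (intro sum_mono powr_mono2) auto
    then have "S \<le> real (card B) * \<rho> powr p" by simp
    also have "\<dots> \<le> real (card B) * c" using \<rho>c by (intro mult_left_mono) auto
    also have "\<dots> = h0 / (p * Rm)" unfolding c_def using cB by simp
    finally have S2: "Rm * S \<le> h0 / p" using Rm_pos p by (simp add: field_simps)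
    have Fle: "F \<bar>u x\<bar> \<le> \<bar>u x\<bar> powr p" for x
    proof -
      have "f \<bar>u x\<bar> \<le> 1 * \<bar>u x\<bar> powr (p - 1)"
        using d(2)[of "\<bar>u x\<bar>"] u(2)[of x] \<rho> f_zero by (cases "u x = 0") auto
      then show ?thesis using F_le_powr[of "\<bar>u x\<bar>" 1] by simp
    qed
    have FS: "0 \<le> (\<Sum>x\<in>B. F \<bar>u x\<bar>)" "(\<Sum>x\<in>B. F \<bar>u x\<bar>) \<le> S"
      unfolding S_def using Fle F_nonneg by (auto intro: sum_nonneg sum_mono)
    have "(\<Sum>x\<in>B. \<Sum>y\<in>B. R x y * F \<bar>u x\<bar> * F \<bar>u y\<bar>) \<le> Rm * (\<Sum>x\<in>B. F \<bar>u x\<bar>) * (\<Sum>x\<in>B. F \<bar>u x\<bar>)"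
      using F_nonneg by (intro double_R_sum_le) auto
    also have "\<dots> \<le> Rm * S * S" using FS Rm_pos by (intro mult_mono) auto
    also have "\<dots> \<le> h0 / p * S" using S2 S0 by (intro mult_right_mono)
    finally have R1: "(\<Sum>x\<in>B. \<Sum>y\<in>B. R x y * F \<bar>u x\<bar> * F \<bar>u y\<bar>) \<le> h0 / p * S" .
    have "h0 * S = (\<Sum>x\<in>B. h0 * \<bar>u x\<bar> powr p)" unfolding S_def by (simp add: sum_distrib_left)
    also have "\<dots> \<le> (\<Sum>x\<in>B. h x * \<bar>u x\<bar> powr p)" using h_ge by (intro sum_mono mult_right_mono) auto
    also have "\<dots> \<le> fin_energy B u" using fin_energy_bounds(1)[OF B u(1)] .
    finally have "h0 * S / p \<le> fin_energy B u / p" using p by (intro divide_right_mono) auto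
    then have "h0 / p * S \<le> fin_energy B u / p" by simp
    then have "h0 / p * S - 1 / 2 * (h0 / p * S) \<le> fin_functional B u"
      unfolding fin_functional_def using R1 by (intro diff_mono mult_left_mono) auto
    moreover have "h0 / (2 * p) * S = h0 / p * S - 1 / 2 * (h0 / p * S)" using p by (simp add: field_simps)
    moreover have "\<delta> \<le> h0 / (2 * p) * S" unfolding \<delta>_def using S1 h0 p by (intro mult_left_mono) auto
    ultimately show ?thesis by linarith
  qed
  then show ?thesis using that[of \<rho> \<delta>] \<rho> \<delta> by blast
qed

text \<open>The level \<open>M\<close> is independent of \<open>B\<close>: it bounds \<open>J\<close> along the ray through the indicator function of \<open>z0\<close>,
and on that ray \<open>fin_functional_upper\<close> gives a bound in which \<open>B\<close> does not occur.\<close>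

proposition finite_critical_points:
  "\<exists>M. \<forall>B. finite B \<and> z0 \<in> B \<longrightarrow> (\<exists>u. (\<forall>x. 0 \<le> u x) \<and> (\<forall>x. x \<notin> B \<longrightarrow> u x = 0) \<and>
      (\<forall>x\<in>B. fin_gradient B x u = 0) \<and> 0 < fin_functional B u \<and> fin_functional B u \<le> M)"
proof -
  define a where "a = (energy_const p + h z0) / p"
  have hpos: "0 < h x" for x using h_ge[of x] h0 by simp
  have a0: "0 \<le> a" unfolding a_def using energy_const_nonneg[of p] hpos[of z0] p by simp
  obtain K0 where K0: "0 < K0" "\<And>K. K0 \<le> K \<Longrightarrow> a * K powr p \<le> r0 / 2 * (F K)\<^sup>2"
    using F_square_dominates[OF a0] by blast
  define M where "M = a * K0 powr p"
  have bump: "fin_functional B (\<lambda>x. if x = z0 then t else 0) \<le> M"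
    if B: "finite B" "z0 \<in> B" and t: "0 \<le> t" for B t
  proof -
    let ?u = "\<lambda>x. if x = z0 then t else 0"
    have "(\<Sum>x\<in>B. (energy_const p + h x) * \<bar>?u x\<bar> powr p) = (\<Sum>x\<in>B. if x = z0 then (energy_const p + h z0) * t powr p else 0)"
      using t by (intro sum.cong) auto
    also have "\<dots> = (energy_const p + h z0) * t powr p" using B by simp
    finally have e: "(\<Sum>x\<in>B. (energy_const p + h x) * \<bar>?u x\<bar> powr p) = (energy_const p + h z0) * t powr p" .
    have "fin_functional B ?u \<le> (\<Sum>x\<in>B. (energy_const p + h x) * \<bar>?u x\<bar> powr p) / p - r0 / 2 * (F \<bar>?u z0\<bar>)\<^sup>2"
      by (rule fin_functional_upper) (use B in auto)
    then have le: "fin_functional B ?u \<le> a * t powr p - r0 / 2 * (F t)\<^sup>2" unfolding a_def e using t by simp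
    show ?thesis
    proof (cases "K0 \<le> t")
      case True
      then have "fin_functional B ?u \<le> 0" using le K0(2) by force
      then show ?thesis unfolding M_def using a0 by (meson mult_nonneg_nonneg order_trans powr_ge_zero)
    next
      case False
      then have "a * t powr p \<le> M" unfolding M_def using a0 t p by (intro mult_left_mono powr_mono2) auto
      moreover have "0 \<le> r0 / 2 * (F t)\<^sup>2" using r0 by simp
      ultimately show ?thesis using le by linarith
    qed
  qed
  have "\<exists>u. (\<forall>x. 0 \<le> u x) \<and> (\<forall>x. x \<notin> B \<longrightarrow> u x = 0) \<and>
      (\<forall>x\<in>B. fin_gradient B x u = 0) \<and> 0 < fin_functional B u \<and> fin_functional B u \<le> M"
    if B: "finite B" "z0 \<in> B" for B
  proof -
    define b where "b = (\<Sum>x\<in>B. energy_const p + h x) / p"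
    have eh: "0 \<le> energy_const p + h x" for x using energy_const_nonneg[of p] hpos[of x] by simp
    have b0: "0 \<le> b" unfolding b_def using eh p by (simp add: sum_nonneg)
    obtain K where K: "0 < K" "b * K powr p \<le> r0 / 2 * (F K)\<^sup>2"
      using F_square_dominates[OF b0] by blast
    have outer: "fin_functional B u \<le> 0"
      if u: "\<And>x. x \<notin> B \<Longrightarrow> u x = 0" "\<And>x. \<bar>u x\<bar> \<le> K" "\<exists>x\<in>B. \<bar>u x\<bar> = K" for u
    proof -
      obtain z where z: "z \<in> B" "\<bar>u z\<bar> = K" using u(3) by blast
      have "(\<Sum>x\<in>B. (energy_const p + h x) * \<bar>u x\<bar> powr p) \<le> (\<Sum>x\<in>B. (energy_const p + h x) * K powr p)"
        using u(2) eh p by (intro sum_mono mult_left_mono powr_mono2) auto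
      also have "\<dots> / p = b * K powr p" unfolding b_def by (simp add: sum_distrib_right)
      finally have "(\<Sum>x\<in>B. (energy_const p + h x) * \<bar>u x\<bar> powr p) / p \<le> b * K powr p"
        using p by (simp add: divide_right_mono)
      moreover have "fin_functional B u \<le> (\<Sum>x\<in>B. (energy_const p + h x) * \<bar>u x\<bar> powr p) / p - r0 / 2 * (F K)\<^sup>2"
        using fin_functional_upper[of B u z] u(1) B(1) z by blast
      ultimately show ?thesis using K(2) by linarith
    qed
    obtain \<rho> \<delta> where \<rho>: "0 < \<rho>" "\<rho> < K" "0 < \<delta>"
      and ring: "\<And>u. \<lbrakk>\<And>x. x \<notin> B \<Longrightarrow> u x = 0; \<And>x. \<bar>u x\<bar> \<le> \<rho>; \<exists>x\<in>B. \<bar>u x\<bar> = \<rho>\<rbrakk> \<Longrightarrow> \<delta> \<le> fin_functional B u"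
      using fin_functional_ring[OF B K(1)] by blast
    have J0: "fin_functional B (\<lambda>x. 0) = 0"
      unfolding fin_functional_def fin_energy_def fin_sq_grad_def using F_zero by simp
    obtain u where "\<And>x. 0 \<le> u x" "\<And>x. x \<notin> B \<Longrightarrow> u x = 0" "\<And>x. x \<in> B \<Longrightarrow> fin_gradient B x u = 0"
      "0 < fin_functional B u" "fin_functional B u \<le> M"
      by (rule finite_dim_mountain_pass[OF B(1) B(2) fin_functional_cont fin_gradient_cont
            fin_functional_deriv[OF B(1)] J0 \<rho>(3) \<rho>(1) \<rho>(2) ring outer fin_functional_abs bump[OF B]]) blast+
    then show ?thesis by blast
  qed
  then show ?thesis by blast
qed

end

section \<open>A priori bounds and passage to the whole lattice\<close>

context choquard
begin

text \<open>The equation for \<open>u\<close> tested with \<open>u\<close> itself.\<close>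

lemma fin_energy_test:
  assumes B: "finite B" and u: "\<And>x. 0 \<le> u x" and crit: "\<And>x. x \<in> B \<Longrightarrow> fin_gradient B x u = 0"
  shows "fin_energy B u = (\<Sum>x\<in>B. \<Sum>y\<in>B. R x y * (f (u x) * u x) * F (u y))"
proof -
  have "0 = (\<Sum>x\<in>B. fin_gradient B x u * u x)" using crit by simp
  also have "\<dots> = (\<Sum>x\<in>B. (\<Sum>y\<in>B. flux u (fin_sq_grad B u) x y) * u x)
      + (\<Sum>x\<in>B. h x * half_powr p ((u x)\<^sup>2) * u x * u x)
      - (\<Sum>x\<in>B. (\<Sum>y\<in>B. R x y * F (u y)) * f (u x) * u x)"
    unfolding fin_gradient_def using u odd_f_nonneg_arg
    by (simp add: sum.distrib sum_subtractf algebra_simps)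
  also have "(\<Sum>x\<in>B. (\<Sum>y\<in>B. flux u (fin_sq_grad B u) x y) * u x)
     = (\<Sum>x\<in>B. fin_sq_grad B u x powr (p / 2))"
    unfolding finite_summation_by_parts[OF B] half_powr_mult[OF fin_sq_grad_nonneg p, symmetric]
    by (intro sum.cong refl) (simp add: fin_sq_grad_def power2_eq_square mult.assoc)
  also have "(\<Sum>x\<in>B. h x * half_powr p ((u x)\<^sup>2) * u x * u x) = (\<Sum>x\<in>B. h x * (u x)\<^sup>2 powr (p / 2))"
  proof (intro sum.cong refl)
    fix x
    have "half_powr p ((u x)\<^sup>2) * (u x)\<^sup>2 = (u x)\<^sup>2 powr (p / 2)" by (rule half_powr_mult[OF _ p]) simp
    then show "h x * half_powr p ((u x)\<^sup>2) * u x * u x = h x * (u x)\<^sup>2 powr (p / 2)"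
      by (simp add: power2_eq_square mult.assoc)
  qed
  also have "(\<Sum>x\<in>B. (\<Sum>y\<in>B. R x y * F (u y)) * f (u x) * u x) = (\<Sum>x\<in>B. \<Sum>y\<in>B. R x y * (f (u x) * u x) * F (u y))"
    by (intro sum.cong refl) (simp add: sum_distrib_left sum_distrib_right algebra_simps)
  finally show ?thesis unfolding fin_energy_def by (simp add: sum.distrib)
qed

text \<open>Comparing \<open>J(u)\<close> with \<open>(1/\<theta>) J'(u) u = 0\<close> bounds the energy by the level: the interaction part of the
difference has a sign because \<open>\<theta> F \<le> 2 f t\<close> and \<open>R \<ge> 0\<close>.\<close>

lemma fin_energy_apriori:
  assumes B: "finite B" and u: "\<And>x. 0 \<le> u x" and crit: "\<And>x. x \<in> B \<Longrightarrow> fin_gradient B x u = 0"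
    and M: "fin_functional B u \<le> M"
  shows "fin_energy B u \<le> M / (1 / p - 1 / \<theta>)"
proof -
  define D where "D = (\<Sum>x\<in>B. \<Sum>y\<in>B. R x y * F \<bar>u x\<bar> * F \<bar>u y\<bar>)"
  have "\<theta> * D = (\<Sum>x\<in>B. \<Sum>y\<in>B. R x y * (\<theta> * F (u x)) * F (u y))"
    unfolding D_def using u by (simp add: sum_distrib_left algebra_simps)
  also have "\<dots> \<le> (\<Sum>x\<in>B. \<Sum>y\<in>B. R x y * (2 * (f (u x) * u x)) * F (u y))"
  proof (intro sum_mono mult_right_mono mult_left_mono)
    fix x y
    show "\<theta> * F (u x) \<le> 2 * (f (u x) * u x)"
      using AR[of "u x"] u[of x] F_zero by (cases "u x = 0") auto
  qed (use R_nonneg F_nonneg u in auto)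
  also have "\<dots> = 2 * (\<Sum>x\<in>B. \<Sum>y\<in>B. R x y * (f (u x) * u x) * F (u y))"
    by (simp add: sum_distrib_left algebra_simps)
  also have "(\<Sum>x\<in>B. \<Sum>y\<in>B. R x y * (f (u x) * u x) * F (u y)) = fin_energy B u"
    by (rule fin_energy_test[symmetric, OF B]) (use u crit in auto)
  finally have "D \<le> 2 * fin_energy B u / \<theta>" using \<theta> p by (simp add: field_simps)
  then have "fin_energy B u / p - fin_energy B u / \<theta> \<le> M"
    using M unfolding fin_functional_def D_def[symmetric] by simp
  then have "fin_energy B u * (1 / p - 1 / \<theta>) \<le> M" by (simp add: algebra_simps)
  moreover have "0 < 1 / p - 1 / \<theta>" using \<theta> p by (simp add: frac_less2)
  ultimately show ?thesis by (simp add: pos_le_divide_eq)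
qed

text \<open>If all values of \<open>u\<close> were small, testing the equation with \<open>u\<close> would bound the energy by a small multiple
of \<open>(\<Sum> |u|\<^sup>p)\<^sup>2\<close>.  As the energy is at least \<open>h0 \<Sum> |u|\<^sup>p\<close> and at most \<open>M\<close>, it would then be at most
half of itself.\<close>

lemma critical_point_not_small:
  assumes M: "0 < M"
  shows "\<exists>e>0. \<forall>B u. finite B \<and> (\<forall>x. 0 \<le> u x) \<and> (\<forall>x. x \<notin> B \<longrightarrow> u x = 0) \<and> (\<forall>x\<in>B. fin_gradient B x u = 0)
     \<and> fin_energy B u \<le> M \<and> 0 < fin_functional B u \<longrightarrow> (\<exists>x\<in>B. e \<le> u x)"
proof -
  define c where "c = h0\<^sup>2 / (2 * Rm * M)"
  have c: "0 < c" unfolding c_def using h0 Rm_pos M by simp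
  define e1 where "e1 = min 1 c"
  have e1: "0 < e1" "e1 * e1 \<le> c" unfolding e1_def using c by (auto simp: min_def mult_le_one intro: order_trans[OF mult_left_le])
  obtain d where d: "0 < d" "\<And>t. 0 < t \<Longrightarrow> t < d \<Longrightarrow> f t \<le> e1 * t powr (p - 1)"
    using f_small[of e1] e1 by auto
  have main: "\<exists>x\<in>B. d \<le> u x"
    if B: "finite B" and u: "\<And>x. 0 \<le> u x" "\<And>x. x \<notin> B \<Longrightarrow> u x = 0" and crit: "\<And>x. x \<in> B \<Longrightarrow> fin_gradient B x u = 0"
      and E: "fin_energy B u \<le> M" and J: "0 < fin_functional B u" for B u
  proof (rule ccontr)
    assume "\<not> ?thesis"
    then have small: "u x < d" if "x \<in> B" for x using that by auto
    define S where "S = (\<Sum>x\<in>B. u x powr p)"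
    have S0: "0 \<le> S" unfolding S_def by (intro sum_nonneg) auto
    have "h0 * S = (\<Sum>x\<in>B. h0 * \<bar>u x\<bar> powr p)" unfolding S_def using u by (simp add: sum_distrib_left)
    also have "\<dots> \<le> (\<Sum>x\<in>B. h x * \<bar>u x\<bar> powr p)" using h_ge by (intro sum_mono mult_right_mono) auto
    also have "\<dots> \<le> fin_energy B u" by (rule fin_energy_bounds(1)[of B u, OF B u(2)])
    finally have hS: "h0 * S \<le> fin_energy B u" .
    have ft: "f (u x) \<le> e1 * u x powr (p - 1)" if "x \<in> B" for x
      using d(2)[of "u x"] small[OF that] u(1)[of x] f_zero by (cases "u x = 0") auto
    have Fle: "F (u x) \<le> e1 * u x powr p" if "x \<in> B" for x
      using F_le_powr[OF u(1) ft[OF that]] .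
    have fle: "f (u x) * u x \<le> e1 * u x powr p" if "x \<in> B" for x
    proof (cases "u x = 0")
      case False
      have "u x powr p = u x powr ((p - 1) + 1)" by simp
      also have "\<dots> = u x powr (p - 1) * u x powr 1" by (rule powr_add)
      also have "\<dots> = u x powr (p - 1) * u x" using u(1)[of x] by simp
      finally show ?thesis using mult_right_mono[OF ft[OF that] u(1)[of x]] by (simp add: mult.assoc)
    qed simp
    have s1: "(\<Sum>x\<in>B. f (u x) * u x) \<le> e1 * S" "(\<Sum>x\<in>B. F (u x)) \<le> e1 * S"
      unfolding S_def sum_distrib_left using fle Fle by (auto intro: sum_mono)
    have s2: "0 \<le> (\<Sum>x\<in>B. f (u x) * u x)" "0 \<le> (\<Sum>x\<in>B. F (u x))"
      using f_nonneg F_nonneg u(1) by (auto intro: sum_nonneg)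
    have "fin_energy B u = (\<Sum>x\<in>B. \<Sum>y\<in>B. R x y * (f (u x) * u x) * F (u y))"
      by (rule fin_energy_test[OF B]) (use u crit in auto)
    also have "\<dots> \<le> Rm * (\<Sum>x\<in>B. f (u x) * u x) * (\<Sum>x\<in>B. F (u x))"
      using f_nonneg F_nonneg u(1) by (intro double_R_sum_le) auto
    also have "\<dots> \<le> Rm * (e1 * S) * (e1 * S)" using s1 s2 Rm_pos e1(1) S0 by (intro mult_mono) auto
    also have "\<dots> = (e1 * e1) * (Rm * S * S)" by simp
    also have "\<dots> \<le> c * (Rm * S * S)" using e1 Rm_pos S0 by (intro mult_right_mono) auto
    also have "\<dots> = (h0 * S) * (h0 * S) / (2 * M)" unfolding c_def using Rm_pos by (simp add: power2_eq_square)
    also have "\<dots> \<le> (h0 * S) * M / (2 * M)"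
      using hS E S0 h0 M by (intro divide_right_mono mult_left_mono) auto
    also have "\<dots> = h0 * S / 2" using M by simp
    finally have "fin_energy B u \<le> h0 * S / 2" .
    then have "fin_energy B u \<le> 0" using hS by linarith
    have D: "0 \<le> (\<Sum>x\<in>B. \<Sum>y\<in>B. R x y * F \<bar>u x\<bar> * F \<bar>u y\<bar>)"
      by (intro sum_nonneg mult_nonneg_nonneg F_nonneg R_nonneg) auto
    have "fin_energy B u / p \<le> 0" using \<open>fin_energy B u \<le> 0\<close> p by (intro divide_nonpos_pos) auto
    then have "fin_functional B u \<le> 0 - 1 / 2 * 0"
      unfolding fin_functional_def using D by (intro diff_mono mult_left_mono) auto
    then show False using J by simp
  qed
  show ?thesis
  proof (intro exI[of _ d] conjI allI impI)
    fix B u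
    assume "finite B \<and> (\<forall>x. 0 \<le> u x) \<and> (\<forall>x. x \<notin> B \<longrightarrow> u x = 0) \<and> (\<forall>x\<in>B. fin_gradient B x u = 0)
     \<and> fin_energy B u \<le> M \<and> 0 < fin_functional B u"
    then show "\<exists>x\<in>B. d \<le> u x" by (intro main) auto
  qed fact
qed

text \<open>Critical points on an exhausting sequence of finite sets are uniformly bounded, so a subsequence converges
pointwise.  In the gradient term the summable rows of \<open>w\<close> dominate.  In the convolution they do not help;
there the bound \<open>\<Sum> h u\<^sup>p \<le> M1\<close> and the growth of \<open>h\<close> give uniformly small tails.\<close>

proposition limit_equation:
  "\<exists>u. (\<forall>x. 0 \<le> u x) \<and> (\<exists>x. u x \<noteq> 0) \<and> (\<lambda>x. h x * u x powr p) summable_on UNIV \<and>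
    (\<forall>z. (\<lambda>y. R z y * F (u y)) summable_on UNIV \<and>
      (\<lambda>y. flux u (sq_grad u) z y) summable_on UNIV \<and>
      (\<Sum>\<^sub>\<infinity>y. flux u (sq_grad u) z y)
        + h z * half_powr p ((u z)\<^sup>2) * u z = (\<Sum>\<^sub>\<infinity>y. R z y * F (u y)) * f (u z))"
proof -
  define z0 :: 'a where "z0 = undefined"
  obtain M where M: "\<forall>B. finite B \<and> z0 \<in> B \<longrightarrow> (\<exists>u. (\<forall>x. 0 \<le> u x) \<and> (\<forall>x. x \<notin> B \<longrightarrow> u x = 0) \<and>
      (\<forall>x\<in>B. fin_gradient B x u = 0) \<and> 0 < fin_functional B u \<and> fin_functional B u \<le> M)"
    using finite_critical_points[of z0] ..
  define B where "B n = insert z0 (to_nat -` {..n})" for n :: nat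
  have finB: "finite (B n)" for n unfolding B_def by (simp add: finite_vimageI)
  have "\<forall>n. \<exists>u. (\<forall>x. 0 \<le> u x) \<and> (\<forall>x. x \<notin> B n \<longrightarrow> u x = 0) \<and>
      (\<forall>x\<in>B n. fin_gradient (B n) x u = 0) \<and> 0 < fin_functional (B n) u \<and> fin_functional (B n) u \<le> M"
  proof
    fix n
    have "z0 \<in> B n" unfolding B_def by simp
    then show "\<exists>u. (\<forall>x. 0 \<le> u x) \<and> (\<forall>x. x \<notin> B n \<longrightarrow> u x = 0) \<and>
      (\<forall>x\<in>B n. fin_gradient (B n) x u = 0) \<and> 0 < fin_functional (B n) u \<and> fin_functional (B n) u \<le> M"
      by (intro M[rule_format] conjI finB)
  qed
  then obtain v where "\<forall>n. (\<forall>x. 0 \<le> v n x) \<and> (\<forall>x. x \<notin> B n \<longrightarrow> v n x = 0) \<and>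
      (\<forall>x\<in>B n. fin_gradient (B n) x (v n) = 0) \<and> 0 < fin_functional (B n) (v n) \<and> fin_functional (B n) (v n) \<le> M"
    by (rule choice[THEN exE])
  then have v: "\<And>n x. 0 \<le> v n x" "\<And>n x. x \<notin> B n \<Longrightarrow> v n x = 0"
    "\<And>n x. x \<in> B n \<Longrightarrow> fin_gradient (B n) x (v n) = 0"
    "\<And>n. 0 < fin_functional (B n) (v n)" "\<And>n. fin_functional (B n) (v n) \<le> M"
    by auto
  have M0: "0 < M" using v(4,5)[of 0] by simp
  define M1 where "M1 = M / (1 / p - 1 / \<theta>)"
  have "0 < 1 / p - 1 / \<theta>" using \<theta> p by (simp add: frac_less2)
  then have M1: "0 < M1" unfolding M1_def using M0 by simp
  have E: "fin_energy (B n) (v n) \<le> M1" for n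
    unfolding M1_def using v by (intro fin_energy_apriori finB) auto
  have hnn: "0 \<le> h x" for x using h_ge[of x] h0 by simp
  have sumh: "(\<Sum>x\<in>T. h x * v n x powr p) \<le> M1" if "finite T" for T n
  proof -
    have "(\<Sum>x\<in>T. h x * v n x powr p) = (\<Sum>x\<in>T \<inter> B n. h x * v n x powr p)"
      using that v(2) by (intro sum.mono_neutral_right) auto
    also have "\<dots> \<le> (\<Sum>x\<in>B n. h x * v n x powr p)" using finB hnn by (intro sum_mono2) auto
    also have "\<dots> = (\<Sum>x\<in>B n. h x * \<bar>v n x\<bar> powr p)" using v(1) by simp
    also have "\<dots> \<le> fin_energy (B n) (v n)" by (rule fin_energy_bounds(1)[of "B n" "v n", OF finB v(2)])
    finally show ?thesis using E[of n] by simp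
  qed
  define U where "U = (M1 / h0) powr (1 / p)"
  have vU: "v n x \<le> U" for n x
  proof -
    have "h0 * v n x powr p \<le> h x * v n x powr p" using h_ge by (intro mult_right_mono) auto
    also have "\<dots> \<le> M1" using sumh[of "{x}" n] by simp
    finally have "v n x powr p \<le> M1 / h0" using h0 by (simp add: field_simps)
    then have "(v n x powr p) powr (1 / p) \<le> U" unfolding U_def using p by (intro powr_mono2) auto
    then show ?thesis using p v(1)[of n x] by (simp add: powr_powr)
  qed
  have U0: "0 \<le> U" unfolding U_def by simp
  have "seq_compact {u :: 'a \<Rightarrow> real. \<forall>x. \<bar>u x\<bar> \<le> U}"
    by (rule compact_imp_seq_compact[OF compact_box_function_space])
  moreover have "\<forall>n. v n \<in> {u. \<forall>x. \<bar>u x\<bar> \<le> U}" using v(1) vU by simp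
  ultimately obtain u r where r: "strict_mono r" "(v \<circ> r) \<longlonglongrightarrow> u"
    by (rule seq_compactE)
  define a where "a n = v (r n)" for n
  define C where "C n = B (r n)" for n
  have lim: "(\<lambda>n. a n x) \<longlonglongrightarrow> u x" for x
    using continuous_on_tendsto_compose[OF continuous_on_product_coordinates r(2), of x]
    unfolding a_def by simp
  have finC: "finite (C n)" for n unfolding C_def by (rule finB)
  have evC: "eventually (\<lambda>n. y \<in> C n) sequentially" for y
  proof -
    have "y \<in> C n" if "to_nat y \<le> n" for n
      using that seq_suble[OF r(1), of n] unfolding C_def B_def by simp
    then show ?thesis by (auto simp: eventually_sequentially)
  qed
  have a0: "0 \<le> a n x" and aU: "a n x \<le> U" for n x unfolding a_def using v(1) vU by auto
  have suma: "(\<Sum>x\<in>T. h x * a n x powr p) \<le> M1" if "finite T" for T n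
    unfolding a_def using sumh[OF that] .
  have u0: "0 \<le> u x" for x by (rule tendsto_lowerbound[OF lim]) (use a0 in auto)
  have hs: "(\<lambda>x. h x * u x powr p) summable_on UNIV"
  proof (rule fatou_summable)
    show "(\<lambda>n. h x * a n x powr p) \<longlonglongrightarrow> h x * u x powr p" for x
      by (intro tendsto_mult tendsto_const tendsto_powr' lim) (use p a0 in \<open>auto intro!: always_eventually\<close>)
  qed (use hnn suma in auto)
  have adiff: "\<bar>a n x - a n y\<bar> \<le> U" for n x y using a0[of n x] a0[of n y] aU[of n x] aU[of n y] by linarith
  have Glim: "(\<lambda>n. fin_sq_grad (C n) (a n) x) \<longlonglongrightarrow> sq_grad u x" for x
  proof -
    have "(\<lambda>n. \<Sum>y\<in>C n. w x y * (a n x - a n y)\<^sup>2) \<longlonglongrightarrow> (\<Sum>\<^sub>\<infinity>y. w x y * (u x - u y)\<^sup>2)"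
    proof (rule dominated_sums_tendsto(2)[where k = "\<lambda>y. w x y * U\<^sup>2"])
      show "(\<lambda>n. w x y * (a n x - a n y)\<^sup>2) \<longlonglongrightarrow> w x y * (u x - u y)\<^sup>2" for y
        by (intro tendsto_intros lim)
      show "\<bar>w x y * (a n x - a n y)\<^sup>2\<bar> \<le> w x y * U\<^sup>2" for n y
      proof -
        have "(a n x - a n y)\<^sup>2 \<le> U\<^sup>2" using adiff[of n x y] U0 by (simp add: abs_le_square_iff[symmetric])
        then show ?thesis using w_nonneg[of x y] by (simp add: abs_mult mult_left_mono)
      qed
      show "(\<lambda>y. w x y * U\<^sup>2) summable_on UNIV" by (intro summable_on_cmult_left w_summable)
    qed (use finC evC in auto)
    then show ?thesis unfolding fin_sq_grad_def sq_grad_def by (intro tendsto_mult tendsto_const)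
  qed
  define g where "g = 1 / 2 * (wt * U\<^sup>2)"
  have Gle: "fin_sq_grad (C n) (a n) x \<le> g" for n x
  proof -
    have "(\<Sum>y\<in>C n. w x y * (a n x - a n y)\<^sup>2) \<le> (\<Sum>y\<in>C n. w x y * U\<^sup>2)"
    proof (intro sum_mono mult_left_mono w_nonneg)
      show "(a n x - a n y)\<^sup>2 \<le> U\<^sup>2" for y using adiff[of n x y] U0 by (simp add: abs_le_square_iff[symmetric])
    qed
    also have "\<dots> = sum (w x) (C n) * U\<^sup>2" by (simp add: sum_distrib_right)
    also have "sum (w x) (C n) \<le> infsum (w x) UNIV"
      using w_summable w_nonneg finC by (intro finite_sum_le_infsum) auto
    also have "\<dots> \<le> wt" by (rule w_le)
    finally show ?thesis unfolding fin_sq_grad_def g_def by (simp add: mult_right_mono)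
  qed
  have L: "(\<lambda>y. flux u (sq_grad u) z y) summable_on UNIV"
    "(\<lambda>n. \<Sum>y\<in>C n. flux (a n) (fin_sq_grad (C n) (a n)) z y) \<longlonglongrightarrow> (\<Sum>\<^sub>\<infinity>y. flux u (sq_grad u) z y)" for z
  proof -
    have l: "(\<lambda>n. flux (a n) (fin_sq_grad (C n) (a n)) z y) \<longlonglongrightarrow> flux u (sq_grad u) z y" for y
      by (intro tendsto_intros lim tendsto_half_powr[OF p] Glim fin_sq_grad_nonneg sq_grad_nonneg)
    have d: "\<bar>flux (a n) (fin_sq_grad (C n) (a n)) z y\<bar> \<le> w z y * (half_powr p g * U)" for n y
    proof -
      have "half_powr p (fin_sq_grad (C n) (a n) x) \<le> half_powr p g" for x
        by (rule half_powr_mono[OF p fin_sq_grad_nonneg Gle])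
      from this[of z] this[of y] have "1 / 2 * (half_powr p (fin_sq_grad (C n) (a n) z) + half_powr p (fin_sq_grad (C n) (a n) y)) \<le> half_powr p g"
        by simp
      then have "w z y * ((1 / 2 * (half_powr p (fin_sq_grad (C n) (a n) z) + half_powr p (fin_sq_grad (C n) (a n) y))) * \<bar>a n z - a n y\<bar>)
           \<le> w z y * (half_powr p g * U)"
        using adiff w_nonneg half_powr_nonneg by (intro mult_left_mono mult_mono) (auto intro: add_nonneg_nonneg)
      then show ?thesis using w_nonneg[of z y] half_powr_nonneg by (simp add: abs_mult add_nonneg_nonneg mult.assoc)
    qed
    have s: "(\<lambda>y. w z y * (half_powr p g * U)) summable_on UNIV" by (intro summable_on_cmult_left w_summable)
    show "(\<lambda>y. flux u (sq_grad u) z y) summable_on UNIV"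
      by (rule dominated_sums_tendsto(1)[OF l d s finC evC])
    show "(\<lambda>n. \<Sum>y\<in>C n. flux (a n) (fin_sq_grad (C n) (a n)) z y) \<longlonglongrightarrow> (\<Sum>\<^sub>\<infinity>y. flux u (sq_grad u) z y)"
      by (rule dominated_sums_tendsto(2)[OF l d s finC evC])
  qed
  obtain c where c: "0 < c" "\<And>t. 0 \<le> t \<Longrightarrow> t \<le> U \<Longrightarrow> f t \<le> c * t powr (p - 1)"
    using f_le_powr[of U] by blast
  have Rl: "(\<lambda>y. R z y * F (u y)) summable_on UNIV"
    "(\<lambda>n. \<Sum>y\<in>C n. R z y * F \<bar>a n y\<bar>) \<longlonglongrightarrow> (\<Sum>\<^sub>\<infinity>y. R z y * F (u y))" for z
  proof -
    have l: "(\<lambda>n. R z y * F \<bar>a n y\<bar>) \<longlonglongrightarrow> R z y * F (u y)" for y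
    proof -
      have "(\<lambda>n. F \<bar>a n y\<bar>) \<longlonglongrightarrow> F \<bar>u y\<bar>"
        by (intro continuous_on_tendsto_compose[OF F_cont[of UNIV]] tendsto_rabs lim) auto
      then show ?thesis using u0[of y] by (intro tendsto_mult tendsto_const) simp
    qed
    have t: "\<exists>A. finite A \<and> (\<forall>n T. finite T \<and> T \<inter> A = {} \<longrightarrow> (\<Sum>y\<in>T. \<bar>R z y * F \<bar>a n y\<bar>\<bar>) \<le> e)" if e: "0 < e" for e
    proof -
      \<comment> \<open>Outside \<open>{h \<le> L}\<close> one has \<open>R F(u) \<le> Rm c u\<^sup>p \<le> (Rm c / L) h u\<^sup>p\<close>, which sums to at most \<open>e\<close>.\<close>
      define L where "L = Rm * c * M1 / e"
      have L0: "0 < L" unfolding L_def using Rm_pos c M1 e by simp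
      have "(\<Sum>y\<in>T. \<bar>R z y * F \<bar>a n y\<bar>\<bar>) \<le> e" if T: "finite T" "T \<inter> {x. h x \<le> L} = {}" for n T
      proof -
        have "(\<Sum>y\<in>T. \<bar>R z y * F \<bar>a n y\<bar>\<bar>) \<le> (\<Sum>y\<in>T. Rm * c / L * (h y * a n y powr p))"
        proof (intro sum_mono)
          fix y assume "y \<in> T"
          then have hL: "L \<le> h y" using T by force
          have "F (a n y) \<le> c * a n y powr p" by (intro F_le_powr a0 c aU)
          then have "R z y * F (a n y) \<le> Rm * (c * a n y powr p)"
            using R_nonneg[of z y] R_le[of z y] F_nonneg[OF a0] Rm_pos by (intro mult_mono) auto
          also have "\<dots> = Rm * c / L * (L * a n y powr p)" using L0 by simp
          also have "\<dots> \<le> Rm * c / L * (h y * a n y powr p)"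
            using hL Rm_pos c L0 by (intro mult_left_mono mult_right_mono) auto
          finally show "\<bar>R z y * F \<bar>a n y\<bar>\<bar> \<le> Rm * c / L * (h y * a n y powr p)"
            using R_nonneg[of z y] F_nonneg[OF a0[of n y]] a0[of n y] by simp
        qed
        also have "\<dots> = Rm * c / L * (\<Sum>y\<in>T. h y * a n y powr p)" by (simp add: sum_distrib_left)
        also have "\<dots> \<le> Rm * c / L * M1" using suma[OF T(1)] Rm_pos c L0 by (intro mult_left_mono) auto
        also have "\<dots> = e" unfolding L_def using Rm_pos c M1 e by simp
        finally show ?thesis .
      qed
      then show ?thesis using h_coercive[of L] by blast
    qed
    show "(\<lambda>y. R z y * F (u y)) summable_on UNIV" by (rule tight_sums_tendsto(1)[OF l t finC evC])
    show "(\<lambda>n. \<Sum>y\<in>C n. R z y * F \<bar>a n y\<bar>) \<longlonglongrightarrow> (\<Sum>\<^sub>\<infinity>y. R z y * F (u y))"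
      by (rule tight_sums_tendsto(2)[OF l t finC evC])
  qed
  have eq: "(\<Sum>\<^sub>\<infinity>y. flux u (sq_grad u) z y) + h z * half_powr p ((u z)\<^sup>2) * u z = (\<Sum>\<^sub>\<infinity>y. R z y * F (u y)) * f (u z)" for z
  proof -
    have "(\<lambda>n. odd_f (a n z)) \<longlonglongrightarrow> odd_f (u z)"
      unfolding odd_f_def
      by (intro tendsto_diff continuous_on_tendsto_compose[OF f_cont] tendsto_max tendsto_minus tendsto_const lim) auto
    then have o: "(\<lambda>n. odd_f (a n z)) \<longlonglongrightarrow> f (u z)" using odd_f_nonneg_arg[OF u0] by simp
    have "(\<lambda>n. fin_gradient (C n) z (a n)) \<longlonglongrightarrow>
      (\<Sum>\<^sub>\<infinity>y. flux u (sq_grad u) z y) + h z * half_powr p ((u z)\<^sup>2) * u z - (\<Sum>\<^sub>\<infinity>y. R z y * F (u y)) * f (u z)"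
      unfolding fin_gradient_def
      by (intro tendsto_diff tendsto_add tendsto_mult tendsto_const L Rl o lim tendsto_half_powr[OF p] tendsto_power) auto
    moreover have "(\<lambda>n. fin_gradient (C n) z (a n)) \<longlonglongrightarrow> 0"
    proof (rule tendsto_eventually)
      show "eventually (\<lambda>n. fin_gradient (C n) z (a n) = 0) sequentially"
        using evC[of z] by eventually_elim (use v(3) in \<open>simp add: C_def a_def\<close>)
    qed
    ultimately have "(\<Sum>\<^sub>\<infinity>y. flux u (sq_grad u) z y) + h z * half_powr p ((u z)\<^sup>2) * u z - (\<Sum>\<^sub>\<infinity>y. R z y * F (u y)) * f (u z) = 0"
      by (rule LIMSEQ_unique)
    then show ?thesis by simp
  qed
  have nz: "\<exists>x. u x \<noteq> 0"
  proof (rule ccontr)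
    assume "\<not> ?thesis"
    then have uz: "u x = 0" for x by simp
    obtain e where e: "0 < e" and ex: "\<forall>B u. finite B \<and> (\<forall>x. 0 \<le> u x) \<and> (\<forall>x. x \<notin> B \<longrightarrow> u x = 0) \<and> (\<forall>x\<in>B. fin_gradient B x u = 0)
     \<and> fin_energy B u \<le> M1 \<and> 0 < fin_functional B u \<longrightarrow> (\<exists>x\<in>B. e \<le> u x)"
      using critical_point_not_small[OF M1] by blast
    have "\<exists>x\<in>B (r n). e \<le> v (r n) x" for n
      by (rule ex[rule_format]) (use finB v E in auto)
    then have big: "\<exists>x. e \<le> a n x" for n unfolding a_def by blast
    \<comment> \<open>A site where the value is at least \<open>e\<close> lies in this finite set, on which convergence to \<open>0\<close> is uniform.\<close>
    define A where "A = {x. h x \<le> M1 / e powr p}"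
    have "finite A" unfolding A_def by (rule h_coercive)
    moreover have "eventually (\<lambda>n. a n x < e) sequentially" for x
      using order_tendstoD(2)[OF lim, of x e] uz e by simp
    ultimately have "eventually (\<lambda>n. \<forall>x\<in>A. a n x < e) sequentially" by (simp add: eventually_ball_finite)
    then obtain n where n: "\<forall>x\<in>A. a n x < e" by (auto simp: eventually_sequentially)
    obtain x where x: "e \<le> a n x" using big by blast
    have "h x * e powr p \<le> h x * a n x powr p" using x e p hnn by (intro mult_left_mono powr_mono2) auto
    also have "\<dots> \<le> M1" using suma[of "{x}" n] by simp
    finally have "h x \<le> M1 / e powr p" using e by (simp add: field_simps)
    then show False using n x unfolding A_def by force
  qed
  show ?thesis by (intro exI[of _ u] conjI allI u0 nz hs Rl(1) L(1) eq)
qed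

end

section \<open>Summation by parts\<close>

context summable_kernel
begin

definition grad_weight :: "real \<Rightarrow> ('a \<Rightarrow> real) \<Rightarrow> 'a \<Rightarrow> real" where
  "grad_weight p u x = sqrt (sq_grad u x) powr (p - 2)"

lemma grad_weight_nonneg: "0 \<le> grad_weight p u x"
  unfolding grad_weight_def by simp

lemma half_powr_eq_grad_weight:
  assumes "2 \<le> p" "0 < sq_grad u x"
  shows "half_powr p (sq_grad u x) = grad_weight p u x"
proof -
  have "sqrt (sq_grad u x) powr (p - 2) = (sq_grad u x powr (1 / 2)) powr (p - 2)"
    using assms by (simp only: powr_half_sqrt less_imp_le)
  also have "\<dots> = sq_grad u x powr (p / 2 - 1)" by (simp add: powr_powr diff_divide_distrib)
  finally show ?thesis using assms unfolding half_powr_def grad_weight_def by auto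
qed

context
  fixes u :: "'a \<Rightarrow> real" and p :: real
  assumes p: "2 \<le> p" and u: "(\<lambda>x. \<bar>u x\<bar> powr p) summable_on UNIV"
begin

lemma sq_grad_zeroD:
  assumes "sq_grad u x = 0" shows "w x y * (u x - u y) = 0"
proof -
  have "w x y * (u x - u y)\<^sup>2 = 0"
  proof (rule nonneg_infsum_le_0D[of "\<lambda>y. w x y * (u x - u y)\<^sup>2" UNIV])
    show "(\<Sum>\<^sub>\<infinity>y. w x y * (u x - u y)\<^sup>2) \<le> 0" using assms unfolding sq_grad_def by simp
  qed (use sq_grad_term_summable[OF p u] w_nonneg in auto)
  then show ?thesis by simp
qed

text \<open>The two readings of \<open>|\<nabla>\<^sup>s u|\<^sup>p\<^sup>-\<^sup>2\<close> can differ only where the gradient vanishes, and there every difference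
\<open>u x - u y\<close> with \<open>w x y \<noteq> 0\<close> vanishes as well.\<close>

lemma half_powr_weighted:
  "w x y * half_powr p (sq_grad u x) * (u x - u y) = w x y * grad_weight p u x * (u x - u y)"
proof (cases "sq_grad u x = 0")
  case True
  then have "w x y * (u x - u y) = 0" by (rule sq_grad_zeroD)
  then show ?thesis by auto
next
  case False
  then have "0 < sq_grad u x" using sq_grad_nonneg[of u x] by simp
  then show ?thesis using half_powr_eq_grad_weight[OF p] by simp
qed

lemma sqrt_sq_grad_powr: "sqrt (sq_grad u x) powr p = sq_grad u x powr (p / 2)"
proof -
  have "sqrt (sq_grad u x) powr p = (sq_grad u x powr (1 / 2)) powr p"
    using sq_grad_nonneg[of u x] by (simp only: powr_half_sqrt)
  then show ?thesis by (simp add: powr_powr)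
qed

context
  fixes \<phi> :: "'a \<Rightarrow> real"
  assumes \<phi>: "(\<lambda>x. \<bar>\<phi> x\<bar> powr p) summable_on UNIV"
begin

text \<open>Young's inequality in the form \<open>a\<^sup>p\<^sup>-\<^sup>2 b c \<le> a\<^sup>p + b\<^sup>p + c\<^sup>p\<close> reduces the claim to summability of
\<open>w x y * a x\<close> and \<open>w x y * a y\<close> for a summable function \<open>a\<close>.\<close>

lemma grad_weight_pair_summable:
  shows "(\<lambda>(x, y). w x y * grad_weight p u x * (u x - u y) * \<phi> x) summable_on UNIV" (is "?A summable_on _")
    and "(\<lambda>(x, y). w x y * grad_weight p u x * (u x - u y) * \<phi> y) summable_on UNIV" (is "?B summable_on _")
proof -
  define G where "G x = sqrt (sq_grad u x)" for x
  have G0: "0 \<le> G x" for x unfolding G_def using sq_grad_nonneg by simp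
  define a where "a x = G x powr p + \<bar>u x\<bar> powr p + \<bar>\<phi> x\<bar> powr p" for x
  have sa: "a summable_on UNIV"
    unfolding a_def G_def sqrt_sq_grad_powr
    by (intro summable_on_add sq_grad_powr_summable[OF p u] u \<phi>)
  have a0: "0 \<le> a x" for x unfolding a_def by simp
  have "(\<lambda>z. (case z of (x, y) \<Rightarrow> w x y * a x) + (case z of (x, y) \<Rightarrow> w x y * a y)) summable_on UNIV"
    using pair_summable[of a] sa a0 by (intro summable_on_add) auto
  then have D: "(\<lambda>z. 2 * ((case z of (x, y) \<Rightarrow> w x y * a x) + (case z of (x, y) \<Rightarrow> w x y * a y))) summable_on UNIV"
    by (rule summable_on_cmult_right)
  have b: "\<bar>w x y * grad_weight p u x * (u x - u y) * c\<bar> \<le> 2 * (w x y * a x + w x y * a y)"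
    if c: "\<bar>c\<bar> powr p \<le> \<bar>\<phi> x\<bar> powr p \<or> \<bar>c\<bar> powr p \<le> \<bar>\<phi> y\<bar> powr p" for x y c
  proof -
    have w1: "grad_weight p u x * \<bar>d\<bar> * \<bar>c\<bar> \<le> G x powr p + \<bar>d\<bar> powr p + \<bar>c\<bar> powr p" for d
      unfolding grad_weight_def G_def[symmetric] by (rule powr_mult_mult_le) (use G0 p in auto)
    have "grad_weight p u x * \<bar>u x - u y\<bar> * \<bar>c\<bar> \<le> grad_weight p u x * (\<bar>u x\<bar> + \<bar>u y\<bar>) * \<bar>c\<bar>"
      using grad_weight_nonneg[of p u x] by (intro mult_right_mono mult_left_mono) auto
    also have "\<dots> = grad_weight p u x * \<bar>u x\<bar> * \<bar>c\<bar> + grad_weight p u x * \<bar>u y\<bar> * \<bar>c\<bar>"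
      by (simp add: algebra_simps)
    also have "\<dots> \<le> (G x powr p + \<bar>u x\<bar> powr p + \<bar>c\<bar> powr p) + (G x powr p + \<bar>u y\<bar> powr p + \<bar>c\<bar> powr p)"
      by (intro add_mono w1)
    also have "\<dots> \<le> 2 * (a x + a y)"
    proof -
      have "(g + i + e) + (g + j + e) \<le> 2 * ((g + i + k) + (g' + j + l))"
        if "0 \<le> g'" "0 \<le> i" "0 \<le> j" "0 \<le> k" "0 \<le> l" "e \<le> k \<or> e \<le> l" for g g' i j k l e :: real
        using that by auto
      then show ?thesis unfolding a_def using c by simp
    qed
    finally have "w x y * (grad_weight p u x * \<bar>u x - u y\<bar> * \<bar>c\<bar>) \<le> w x y * (2 * (a x + a y))"
      using w_nonneg by (rule mult_left_mono)
    moreover have "\<bar>w x y * grad_weight p u x * (u x - u y) * c\<bar> = w x y * (grad_weight p u x * \<bar>u x - u y\<bar> * \<bar>c\<bar>)"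
      using w_nonneg[of x y] grad_weight_nonneg[of p u x] by (simp add: abs_mult mult.assoc)
    moreover have "w x y * (2 * (a x + a y)) = 2 * (w x y * a x + w x y * a y)"
      by (simp add: algebra_simps)
    ultimately show ?thesis by (simp only:)
  qed
  have "(\<lambda>z. norm (?A z)) summable_on UNIV"
  proof (rule summable_on_comparison_test[OF D])
    fix z :: "'a \<times> 'a"
    show "norm (?A z) \<le> 2 * ((case z of (x, y) \<Rightarrow> w x y * a x) + (case z of (x, y) \<Rightarrow> w x y * a y))"
      by (cases z) (simp only: prod.case real_norm_def, rule b, simp)
  qed simp
  then show "?A summable_on UNIV" by (rule abs_summable_summable)
  have "(\<lambda>z. norm (?B z)) summable_on UNIV"
  proof (rule summable_on_comparison_test[OF D])
    fix z :: "'a \<times> 'a"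
    show "norm (?B z) \<le> 2 * ((case z of (x, y) \<Rightarrow> w x y * a x) + (case z of (x, y) \<Rightarrow> w x y * a y))"
      by (cases z) (simp only: prod.case real_norm_def, rule b, simp)
  qed simp
  then show "?B summable_on UNIV" by (rule abs_summable_summable)
qed

text \<open>Both sums are iterated forms of absolutely convergent sums over pairs; they agree after exchanging the
roles of \<open>x\<close> and \<open>y\<close> in the part that contains \<open>\<phi> y\<close>.\<close>

proposition infinite_summation_by_parts:
  "\<exists>S. ((\<lambda>x. grad_weight p u x * (1 / 2 * (\<Sum>\<^sub>\<infinity>y. w x y * (u x - u y) * (\<phi> x - \<phi> y)))) has_sum S) UNIV \<and>
       ((\<lambda>x. (\<Sum>\<^sub>\<infinity>y. 1 / 2 * w x y * (grad_weight p u x + grad_weight p u y) * (u x - u y)) * \<phi> x) has_sum S) UNIV"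
proof -
  let ?P = "grad_weight p u"
  define A where "A = (\<lambda>z. case z of (x, y) \<Rightarrow> w x y * ?P x * (u x - u y) * \<phi> x)"
  define B where "B = (\<lambda>z. case z of (x, y) \<Rightarrow> w x y * ?P x * (u x - u y) * \<phi> y)"
  define C where "C = (\<lambda>z. case z of (x, y) \<Rightarrow> w x y * ?P y * (u x - u y) * \<phi> x)"
  have sA: "A summable_on UNIV" and sB: "B summable_on UNIV"
    unfolding A_def B_def using grad_weight_pair_summable by auto
  obtain a b where ab: "(A has_sum a) UNIV" "(B has_sum b) UNIV"
    using sA sB unfolding summable_on_def by blast
  have "((\<lambda>(x, y). B (y, x)) has_sum b) (UNIV \<times> UNIV)"
    using ab(2) has_sum_swap[where f = B and S = b and A = UNIV and B = UNIV] by simp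
  then have "((\<lambda>z. - (case z of (x, y) \<Rightarrow> B (y, x))) has_sum - b) UNIV"
    by (simp add: has_sum_uminus)
  moreover have "(\<lambda>z. - (case z of (x, y) \<Rightarrow> B (y, x))) = C"
    unfolding B_def C_def by (auto simp: fun_eq_iff w_sym[of _ "_ :: 'a"] algebra_simps)
  ultimately have c: "(C has_sum - b) UNIV" by simp
  define S where "S = 1 / 2 * (a - b)"
  have row: "(\<lambda>y. D (x, y)) summable_on UNIV" if "D summable_on UNIV" for D :: "'a \<times> 'a \<Rightarrow> real" and x
    using summable_on_SigmaD1[where f = "\<lambda>x y. D (x, y)" and A = UNIV and B = "\<lambda>_. UNIV" and x = x] that by simp
  have l: "((\<lambda>z. 1 / 2 * (A z - B z)) has_sum S) UNIV"
  proof -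
    have "((\<lambda>z. - B z) has_sum - b) UNIV" using ab(2) by (simp add: has_sum_uminus)
    from has_sum_add[OF ab(1) this] show ?thesis unfolding S_def by (intro has_sum_cmult_right) simp
  qed
  have r: "((\<lambda>z. 1 / 2 * (A z + C z)) has_sum S) UNIV"
    unfolding S_def using has_sum_add[OF ab(1) c] by (intro has_sum_cmult_right) simp
  have fub: "((\<lambda>x. \<Sum>\<^sub>\<infinity>y. D (x, y)) has_sum S) UNIV" if "(D has_sum S) UNIV" for D :: "'a \<times> 'a \<Rightarrow> real"
  proof (rule has_sum_SigmaD[where f = D and A = UNIV and B = "\<lambda>_. UNIV"])
    show "(D has_sum S) (UNIV \<times> UNIV)" using that by simp
    show "((\<lambda>y. D (x, y)) has_sum (\<Sum>\<^sub>\<infinity>y. D (x, y))) UNIV" for x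
      using row[OF has_sum_imp_summable[OF that]] by simp
  qed
  have e1: "(\<Sum>\<^sub>\<infinity>y. 1 / 2 * (A (x, y) - B (x, y))) = ?P x * (1 / 2 * (\<Sum>\<^sub>\<infinity>y. w x y * (u x - u y) * (\<phi> x - \<phi> y)))" for x
  proof -
    have "(\<Sum>\<^sub>\<infinity>y. 1 / 2 * (A (x, y) - B (x, y))) = (\<Sum>\<^sub>\<infinity>y. (?P x * (1 / 2)) * (w x y * (u x - u y) * (\<phi> x - \<phi> y)))"
      unfolding A_def B_def by (intro infsum_cong) (simp add: algebra_simps)
    then show ?thesis by (simp only: infsum_cmult_right' mult.assoc)
  qed
  have e2: "(\<Sum>\<^sub>\<infinity>y. 1 / 2 * (A (x, y) + C (x, y))) = (\<Sum>\<^sub>\<infinity>y. 1 / 2 * w x y * (?P x + ?P y) * (u x - u y)) * \<phi> x" for x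
  proof -
    have "(\<Sum>\<^sub>\<infinity>y. 1 / 2 * (A (x, y) + C (x, y))) = (\<Sum>\<^sub>\<infinity>y. (1 / 2 * w x y * (?P x + ?P y) * (u x - u y)) * \<phi> x)"
      unfolding A_def C_def by (intro infsum_cong) (simp add: field_simps)
    then show ?thesis by (simp only: infsum_cmult_left')
  qed
  show ?thesis using fub[OF l, unfolded e1] fub[OF r, unfolded e2] by blast
qed

end

end

end

section \<open>Strict positivity and the weak equation\<close>

lemma weighted_summable:
  fixes h v :: "'a \<Rightarrow> real"
  assumes h0: "0 < h0" and h_ge: "\<And>x. h0 \<le> h x" and s: "(\<lambda>x. h x * \<bar>v x\<bar> powr p) summable_on UNIV"
  shows "(\<lambda>x. \<bar>v x\<bar> powr p) summable_on UNIV"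
    and "(\<Sum>\<^sub>\<infinity>x. \<bar>v x\<bar> powr p) \<le> 1 / h0 * (\<Sum>\<^sub>\<infinity>x. h x * \<bar>v x\<bar> powr p)"
proof -
  have le: "\<bar>v x\<bar> powr p \<le> 1 / h0 * (h x * \<bar>v x\<bar> powr p)" for x
  proof -
    have "h0 * \<bar>v x\<bar> powr p \<le> h x * \<bar>v x\<bar> powr p" using h_ge by (intro mult_right_mono) auto
    then show ?thesis using h0 by (simp add: field_simps)
  qed
  have s': "(\<lambda>x. 1 / h0 * (h x * \<bar>v x\<bar> powr p)) summable_on UNIV" using s by (rule summable_on_cmult_right)
  show vs: "(\<lambda>x. \<bar>v x\<bar> powr p) summable_on UNIV"
    by (rule summable_on_comparison_test[OF s']) (use le in auto)
  show "(\<Sum>\<^sub>\<infinity>x. \<bar>v x\<bar> powr p) \<le> 1 / h0 * (\<Sum>\<^sub>\<infinity>x. h x * \<bar>v x\<bar> powr p)"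
    using infsum_mono[OF vs s' le] by (simp only: infsum_cmult_right')
qed

context choquard
begin

lemma pth_power_summable:
  "(\<lambda>x. h x * \<bar>v x\<bar> powr p) summable_on UNIV \<Longrightarrow> (\<lambda>x. \<bar>v x\<bar> powr p) summable_on UNIV"
  by (rule weighted_summable(1)[OF h0 h_ge])

text \<open>At a zero \<open>z\<close> of \<open>u\<close> the right-hand side is \<open>0\<close>, while the left-hand side is a sum of terms
\<open>-w z y (\<dots>) u y \<le> 0\<close>.  So all of them vanish, although a single \<open>y\<close> with \<open>u y > 0\<close> makes the
gradient at \<open>z\<close> positive.\<close>

lemma strictly_positive:
  assumes u0: "\<And>x. 0 \<le> u x" and nz: "\<exists>x. u x \<noteq> 0" and hs: "(\<lambda>x. h x * u x powr p) summable_on UNIV"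
    and s: "\<And>z. (\<lambda>y. flux u (sq_grad u) z y) summable_on UNIV"
    and eq: "\<And>z. (\<Sum>\<^sub>\<infinity>y. flux u (sq_grad u) z y)
        + h z * half_powr p ((u z)\<^sup>2) * u z = (\<Sum>\<^sub>\<infinity>y. R z y * F (u y)) * f (u z)"
  shows "0 < u z"
proof (rule ccontr)
  assume "\<not> 0 < u z"
  then have z: "u z = 0" using u0[of z] by simp
  obtain y where y: "0 < u y" using nz u0 by (metis order_le_less)
  have us: "(\<lambda>x. \<bar>u x\<bar> powr p) summable_on UNIV"
    by (rule pth_power_summable) (use hs u0 in simp)
  let ?t = "\<lambda>y. flux u (sq_grad u) z y"
  have "(\<Sum>\<^sub>\<infinity>y. - ?t y) = 0" using eq[of z] z f_zero by (simp add: infsum_uminus)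
  moreover have "(\<lambda>y. - ?t y) summable_on UNIV" using s[of z] by (simp add: summable_on_uminus)
  moreover have "0 \<le> - ?t y" for y
    unfolding z using w_nonneg[of z y] half_powr_nonneg u0[of y] by (simp add: mult_nonneg_nonneg add_nonneg_nonneg)
  ultimately have "- ?t y = 0" by (intro nonneg_infsum_le_0D[of "\<lambda>y. - ?t y" UNIV y]) auto
  moreover have "z \<noteq> y" using z y by auto
  then have "w z y > 0" by (rule w_pos)
  moreover have "0 < half_powr p (sq_grad u z)"
  proof (rule half_powr_pos)
    have "w z y * (u z - u y) = 0" if "sq_grad u z = 0" by (rule sq_grad_zeroD[OF p us that])
    then show "0 < sq_grad u z" using sq_grad_nonneg[of u z] \<open>w z y > 0\<close> y z by fastforce
  qed
  ultimately show False using y z half_powr_nonneg[of p "sq_grad u y"] by auto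
qed

proposition positive_solution:
  obtains u where "\<And>x. 0 < u x" "(\<lambda>x. h x * \<bar>u x\<bar> powr p) summable_on UNIV"
    "\<And>z. (\<lambda>y. R z y * F (u y)) summable_on UNIV"
    "\<And>\<phi>. (\<lambda>x. h x * \<bar>\<phi> x\<bar> powr p) summable_on UNIV \<Longrightarrow>
      \<exists>I. ((\<lambda>x. grad_weight p u x * (1 / 2 * (\<Sum>\<^sub>\<infinity>y. w x y * (u x - u y) * (\<phi> x - \<phi> y)))
             + h x * \<bar>u x\<bar> powr (p - 2) * u x * \<phi> x) has_sum I) UNIV \<and>
          ((\<lambda>x. (\<Sum>\<^sub>\<infinity>y. R x y * F (u y)) * f (u x) * \<phi> x) has_sum I) UNIV"
proof -
  obtain u where u0: "\<And>x. 0 \<le> u x" and nz: "\<exists>x. u x \<noteq> 0" and hs: "(\<lambda>x. h x * u x powr p) summable_on UNIV"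
    and Rs: "\<And>z. (\<lambda>y. R z y * F (u y)) summable_on UNIV"
    and s: "\<And>z. (\<lambda>y. flux u (sq_grad u) z y) summable_on UNIV"
    and eq: "\<And>z. (\<Sum>\<^sub>\<infinity>y. flux u (sq_grad u) z y)
        + h z * half_powr p ((u z)\<^sup>2) * u z = (\<Sum>\<^sub>\<infinity>y. R z y * F (u y)) * f (u z)"
    using limit_equation by (elim exE conjE) blast
  have pos: "0 < u x" for x by (rule strictly_positive[OF u0 nz hs s eq])
  have hs': "(\<lambda>x. h x * \<bar>u x\<bar> powr p) summable_on UNIV" using hs u0 by simp
  have us: "(\<lambda>x. \<bar>u x\<bar> powr p) summable_on UNIV" by (rule pth_power_summable[OF hs'])
  let ?g = "grad_weight p u"
  have integrand: "flux u (sq_grad u) z y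
      = 1 / 2 * w z y * (?g z + ?g y) * (u z - u y)" for z y
  proof -
    have e1: "w z y * half_powr p (sq_grad u z) * (u z - u y) = w z y * ?g z * (u z - u y)"
      by (rule half_powr_weighted[OF p us])
    have "w y z * half_powr p (sq_grad u y) * (u y - u z) = w y z * ?g y * (u y - u z)"
      by (rule half_powr_weighted[OF p us])
    then have e2: "w z y * half_powr p (sq_grad u y) * (u z - u y) = w z y * ?g y * (u z - u y)"
      using w_sym[of z y] by (simp add: algebra_simps)
    have "w z y * (half_powr p (sq_grad u z) + half_powr p (sq_grad u y)) * (u z - u y) = w z y * (?g z + ?g y) * (u z - u y)"
      by (simp only: distrib_left distrib_right e1 e2)
    then show ?thesis by (simp add: mult.assoc)
  qed
  have hp: "half_powr p ((u z)\<^sup>2) = \<bar>u z\<bar> powr (p - 2)" for z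
  proof -
    have "(u z)\<^sup>2 powr (p / 2 - 1) = \<bar>u z\<bar> powr (p - 2)"
      using square_powr_half[of "u z" "p - 2"] by (simp add: diff_divide_distrib)
    then show ?thesis using pos[of z] unfolding half_powr_def by simp
  qed
  note eq' = eq[unfolded integrand hp]
  have "\<exists>I. ((\<lambda>x. ?g x * (1 / 2 * (\<Sum>\<^sub>\<infinity>y. w x y * (u x - u y) * (\<phi> x - \<phi> y)))
             + h x * \<bar>u x\<bar> powr (p - 2) * u x * \<phi> x) has_sum I) UNIV \<and>
          ((\<lambda>x. (\<Sum>\<^sub>\<infinity>y. R x y * F (u y)) * f (u x) * \<phi> x) has_sum I) UNIV"
    if hphi: "(\<lambda>x. h x * \<bar>\<phi> x\<bar> powr p) summable_on UNIV" for \<phi>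
  proof -
    have ps: "(\<lambda>x. \<bar>\<phi> x\<bar> powr p) summable_on UNIV" by (rule pth_power_summable[OF hphi])
    obtain S where S: "((\<lambda>x. ?g x * (1 / 2 * (\<Sum>\<^sub>\<infinity>y. w x y * (u x - u y) * (\<phi> x - \<phi> y)))) has_sum S) UNIV"
      "((\<lambda>x. (\<Sum>\<^sub>\<infinity>y. 1 / 2 * w x y * (?g x + ?g y) * (u x - u y)) * \<phi> x) has_sum S) UNIV"
      using infinite_summation_by_parts[OF p us ps] by blast
    have "(\<lambda>x. norm (h x * \<bar>u x\<bar> powr (p - 2) * u x * \<phi> x)) summable_on UNIV"
    proof (rule summable_on_comparison_test)
      show "(\<lambda>x. 2 * (h x * \<bar>u x\<bar> powr p) + h x * \<bar>\<phi> x\<bar> powr p) summable_on UNIV"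
        by (intro summable_on_add summable_on_cmult_right hs' hphi)
      fix x
      have hx: "0 \<le> h x" using h_ge[of x] h0 by simp
      have "\<bar>u x\<bar> powr (p - 2) * \<bar>u x\<bar> * \<bar>\<phi> x\<bar> \<le> \<bar>u x\<bar> powr p + \<bar>u x\<bar> powr p + \<bar>\<phi> x\<bar> powr p"
        by (rule powr_mult_mult_le) (use p in auto)
      then have "h x * (\<bar>u x\<bar> powr (p - 2) * \<bar>u x\<bar> * \<bar>\<phi> x\<bar>) \<le> h x * (\<bar>u x\<bar> powr p + \<bar>u x\<bar> powr p + \<bar>\<phi> x\<bar> powr p)"
        using hx by (rule mult_left_mono)
      then show "norm (h x * \<bar>u x\<bar> powr (p - 2) * u x * \<phi> x) \<le> 2 * (h x * \<bar>u x\<bar> powr p) + h x * \<bar>\<phi> x\<bar> powr p"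
        using hx by (simp add: abs_mult algebra_simps)
    qed simp
    then have "(\<lambda>x. h x * \<bar>u x\<bar> powr (p - 2) * u x * \<phi> x) summable_on UNIV"
      by (rule abs_summable_summable)
    then obtain H where H: "((\<lambda>x. h x * \<bar>u x\<bar> powr (p - 2) * u x * \<phi> x) has_sum H) UNIV"
      unfolding summable_on_def ..
    have "((\<lambda>x. (\<Sum>\<^sub>\<infinity>y. 1 / 2 * w x y * (?g x + ?g y) * (u x - u y)) * \<phi> x
        + h x * \<bar>u x\<bar> powr (p - 2) * u x * \<phi> x) has_sum S + H) UNIV"
      by (rule has_sum_add[OF S(2) H])
    moreover have "(\<Sum>\<^sub>\<infinity>y. 1 / 2 * w x y * (?g x + ?g y) * (u x - u y)) * \<phi> x
        + h x * \<bar>u x\<bar> powr (p - 2) * u x * \<phi> x = (\<Sum>\<^sub>\<infinity>y. R x y * F (u y)) * f (u x) * \<phi> x" for x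
      unfolding eq'[symmetric] by (simp add: distrib_right)
    ultimately show ?thesis using has_sum_add[OF S(1) H] by (intro exI[of _ "S + H"]) simp
  qed
  then show ?thesis using that pos hs' Rs by blast
qed

end


section \<open>The energy space\<close>

text \<open>Turns the sums over \<open>UNIV - {x}\<close> that define the gradient into sums over \<open>UNIV\<close>.\<close>

definition off_diagonal :: "('a \<Rightarrow> 'a \<Rightarrow> real) \<Rightarrow> 'a \<Rightarrow> 'a \<Rightarrow> real" where
  "off_diagonal W x y = (if x = y then 0 else W x y)"

lemma grad_prod_off_diagonal:
  "grad_prod W u v x = 1 / 2 * (\<Sum>\<^sub>\<infinity>y. off_diagonal W x y * (u x - u y) * (v x - v y))"
proof -
  have "(\<Sum>\<^sub>\<infinity>y\<in>UNIV - {x}. W x y * (u x - u y) * (v x - v y)) = (\<Sum>\<^sub>\<infinity>y. off_diagonal W x y * (u x - u y) * (v x - v y))"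
    by (rule infsum_cong_neutral) (auto simp: off_diagonal_def)
  then show ?thesis unfolding grad_prod_def by simp
qed

locale lattice_energy = summable_kernel "off_diagonal W" wt for W :: "int ^ 'd \<Rightarrow> int ^ 'd \<Rightarrow> real" and wt +
  fixes h :: "int ^ 'd \<Rightarrow> real" and p h0 :: real
  assumes p: "2 \<le> p" and h_ge: "h0 \<le> h x" and h0: "0 < h0"
begin

lemma grad_norm_eq: "grad_norm W u x = sqrt (sq_grad u x)"
  unfolding grad_norm_def grad_prod_off_diagonal sq_grad_def by (simp add: power2_eq_square mult.assoc)

lemma h_nonneg: "0 \<le> h x"
  using h_ge[of x] h0 by simp

lemma h_mono: "\<bar>a\<bar> \<le> \<bar>b\<bar> \<Longrightarrow> h x * \<bar>a\<bar> powr p \<le> h x * \<bar>b\<bar> powr p"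
  using h_nonneg p by (intro mult_left_mono powr_mono2) auto

text \<open>The gradient part of the norm is controlled by the potential part.  In particular the sum defining
\<open>H_norm\<close> converges whenever \<open>\<Sum> h |v|\<^sup>p\<close> does, so its value never comes from the convention for
divergent sums.\<close>

lemma energy_summable:
  assumes v: "(\<lambda>x. h x * \<bar>v x\<bar> powr p) summable_on UNIV"
  shows "(\<lambda>x. grad_norm W v x powr p + h x * \<bar>v x\<bar> powr p) summable_on UNIV"
    and "(\<Sum>\<^sub>\<infinity>x. grad_norm W v x powr p + h x * \<bar>v x\<bar> powr p) \<le> (energy_const p / h0 + 1) * (\<Sum>\<^sub>\<infinity>x. h x * \<bar>v x\<bar> powr p)"
proof -
  note vs = weighted_summable(1)[OF h0 h_ge v]
  have gn: "grad_norm W v x powr p = sq_grad v x powr (p / 2)" for x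
    unfolding grad_norm_eq by (rule sqrt_sq_grad_powr[OF p vs])
  have gs: "(\<lambda>x. grad_norm W v x powr p) summable_on UNIV" unfolding gn by (rule sq_grad_powr_summable[OF p vs])
  show "(\<lambda>x. grad_norm W v x powr p + h x * \<bar>v x\<bar> powr p) summable_on UNIV"
    by (intro summable_on_add gs v)
  have "(\<Sum>\<^sub>\<infinity>x. grad_norm W v x powr p) \<le> energy_const p * (\<Sum>\<^sub>\<infinity>x. \<bar>v x\<bar> powr p)"
    unfolding gn by (rule sq_grad_powr_infsum_le[OF p vs])
  also have "(\<Sum>\<^sub>\<infinity>x. \<bar>v x\<bar> powr p) \<le> 1 / h0 * (\<Sum>\<^sub>\<infinity>x. h x * \<bar>v x\<bar> powr p)"
    by (rule weighted_summable(2)[OF h0 h_ge v])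
  finally have "(\<Sum>\<^sub>\<infinity>x. grad_norm W v x powr p) \<le> energy_const p / h0 * (\<Sum>\<^sub>\<infinity>x. h x * \<bar>v x\<bar> powr p)"
    using energy_const_nonneg[of p] by (simp add: mult_left_mono)
  then show "(\<Sum>\<^sub>\<infinity>x. grad_norm W v x powr p + h x * \<bar>v x\<bar> powr p) \<le> (energy_const p / h0 + 1) * (\<Sum>\<^sub>\<infinity>x. h x * \<bar>v x\<bar> powr p)"
    by (simp add: infsum_add gs v algebra_simps)
qed

lemma finite_support_summable:
  assumes "finite {x. v x \<noteq> 0}"
  shows "(\<lambda>x. h x * \<bar>v x\<bar> powr p) summable_on UNIV"
  by (rule finite_nonzero_values_imp_summable_on, rule finite_subset[OF _ assms]) auto

text \<open>Truncations to an exhausting sequence of finite sets form a Cauchy sequence, since the tails of \<open>\<Sum> h |u|\<^sup>p\<close> tend to \<open>0\<close>.\<close>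

lemma H_spaceI:
  assumes u: "(\<lambda>x. h x * \<bar>u x\<bar> powr p) summable_on UNIV"
  shows "u \<in> H_space W p h"
proof -
  let ?k = "\<lambda>x. h x * \<bar>u x\<bar> powr p"
  define B :: "nat \<Rightarrow> (int ^ 'd) set" where "B n = to_nat -` {..n}" for n
  define v where "v n x = (if x \<in> B n then u x else 0)" for n x
  have finB: "finite (B n)" for n unfolding B_def by (simp add: finite_vimageI)
  have fin: "finite {x. v n x \<noteq> 0}" for n by (rule finite_subset[OF _ finB[of n]]) (auto simp: v_def)
  have lim: "(\<lambda>n. v n x) \<longlonglongrightarrow> u x" for x
    by (rule tendsto_eventually, rule eventually_sequentiallyI[of "to_nat x"]) (simp add: v_def B_def)
  define c where "c = energy_const p / h0 + 1"
  have c: "0 < c" unfolding c_def using energy_const_nonneg[of p] h0 by (simp add: add_nonneg_pos)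
  have "\<exists>N. \<forall>m\<ge>N. \<forall>n\<ge>N. H_norm W p h (\<lambda>x. v m x - v n x) < e" if e: "0 < e" for e
  proof -
    define e' where "e' = e powr p / (2 * c)"
    have e': "0 < e'" unfolding e'_def using e c by simp
    obtain A where A: "finite A" "\<bar>infsum ?k UNIV - sum ?k A\<bar> \<le> e'"
      using infsum_finite_approximation[OF u e'] by (auto simp: dist_real_def abs_minus_commute)
    define N where "N = Max (insert 0 (to_nat ` A))"
    have AN: "A \<subseteq> B n" if "N \<le> n" for n
    proof
      fix x assume "x \<in> A"
      then have "to_nat x \<le> N" unfolding N_def using A by (intro Max_ge) auto
      then show "x \<in> B n" unfolding B_def using that by simp
    qed
    have "H_norm W p h (\<lambda>x. v m x - v n x) < e" if mn: "N \<le> m" "N \<le> n" for m n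
    proof -
      let ?d = "\<lambda>x. v m x - v n x"
      have fd: "finite {x. ?d x \<noteq> 0}" by (rule finite_subset[OF _ finite_UnI[OF fin[of m] fin[of n]]]) auto
      note ds = finite_support_summable[OF fd]
      have kA: "?k summable_on (UNIV - A)" using u summable_on_subset by blast
      have "(\<Sum>\<^sub>\<infinity>x. h x * \<bar>?d x\<bar> powr p) \<le> infsum ?k (UNIV - A)"
      proof (rule infsum_mono_neutral[OF ds kA])
        show "h x * \<bar>?d x\<bar> powr p \<le> ?k x" for x
          by (rule h_mono) (auto simp: v_def)
        show "h x * \<bar>?d x\<bar> powr p \<le> 0" if "x \<in> UNIV - (UNIV - A)" for x
          using that AN mn by (auto simp: v_def subset_iff)
        show "0 \<le> ?k x" for x using h_nonneg by simp
      qed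
      also have "infsum ?k (UNIV - A) = infsum ?k UNIV - sum ?k A"
      proof -
        have "infsum ?k (A \<union> (UNIV - A)) = infsum ?k A + infsum ?k (UNIV - A)"
          by (rule infsum_Un_disjoint) (use A kA in auto)
        then show ?thesis using A by simp
      qed
      also have "\<dots> \<le> e'" using A(2) by simp
      finally have "(\<Sum>\<^sub>\<infinity>x. grad_norm W ?d x powr p + h x * \<bar>?d x\<bar> powr p) \<le> c * e'"
        using energy_summable(2)[OF ds] c unfolding c_def[symmetric] by (meson less_imp_le mult_left_mono order_trans)
      also have "\<dots> = e powr p / 2" unfolding e'_def using c by simp
      also have "\<dots> < e powr p" using e by simp
      finally have "(\<Sum>\<^sub>\<infinity>x. grad_norm W ?d x powr p + h x * \<bar>?d x\<bar> powr p) < e powr p" .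
      moreover have "0 \<le> (\<Sum>\<^sub>\<infinity>x. grad_norm W ?d x powr p + h x * \<bar>?d x\<bar> powr p)"
        using h_nonneg by (intro infsum_nonneg) auto
      ultimately have "H_norm W p h ?d < (e powr p) powr (1 / p)"
        unfolding H_norm_def using p by (intro powr_less_mono2) auto
      also have "\<dots> = e" using e p by (simp add: powr_powr)
      finally show ?thesis .
    qed
    then show ?thesis by blast
  qed
  then show ?thesis unfolding H_space_def using fin lim by blast
qed

text \<open>A Fatou argument: finite partial sums of \<open>h |v m - v N|\<^sup>p\<close> are at most \<open>1\<close> for all \<open>m \<ge> N\<close>, and this survives the limit in \<open>m\<close>.\<close>

lemma H_spaceD:
  assumes "\<phi> \<in> H_space W p h"
  shows "(\<lambda>x. h x * \<bar>\<phi> x\<bar> powr p) summable_on UNIV"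
proof -
  obtain v where fin: "\<And>n. finite {x. v n x \<noteq> 0}"
    and cauchy: "\<And>e. 0 < e \<Longrightarrow> \<exists>N. \<forall>m\<ge>N. \<forall>n\<ge>N. H_norm W p h (\<lambda>x. v m x - v n x) < e"
    and lim: "\<And>x. (\<lambda>n. v n x) \<longlonglongrightarrow> \<phi> x"
    using assms unfolding H_space_def by blast
  obtain N where N: "\<forall>m\<ge>N. \<forall>n\<ge>N. H_norm W p h (\<lambda>x. v m x - v n x) < 1" using cauchy[of 1] by auto
  have bound: "(\<Sum>x\<in>T. h x * \<bar>v m x - v N x\<bar> powr p) \<le> 1" if T: "finite T" and m: "N \<le> m" for T m
  proof -
    let ?d = "\<lambda>x. v m x - v N x"
    have fd: "finite {x. ?d x \<noteq> 0}" by (rule finite_subset[OF _ finite_UnI[OF fin[of m] fin[of N]]]) auto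
    note ds = finite_support_summable[OF fd]
    let ?E = "\<Sum>\<^sub>\<infinity>x. grad_norm W ?d x powr p + h x * \<bar>?d x\<bar> powr p"
    have E0: "0 \<le> ?E" using h_nonneg by (intro infsum_nonneg) auto
    have "(\<Sum>x\<in>T. h x * \<bar>?d x\<bar> powr p) \<le> (\<Sum>x\<in>T. grad_norm W ?d x powr p + h x * \<bar>?d x\<bar> powr p)"
      by (intro sum_mono) simp
    also have "\<dots> \<le> ?E" using T energy_summable(1)[OF ds] h_nonneg by (intro finite_sum_le_infsum) auto
    also have "?E = (?E powr (1 / p)) powr p" using E0 p by (simp add: powr_powr)
    also have "\<dots> \<le> 1 powr p"
      using N m p unfolding H_norm_def by (intro powr_mono2) (auto intro: less_imp_le)
    finally show ?thesis by simp
  qed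
  have ds: "(\<lambda>x. h x * \<bar>\<phi> x - v N x\<bar> powr p) summable_on UNIV"
  proof (rule fatou_summable)
    show "(\<lambda>m. h x * \<bar>v m x - v N x\<bar> powr p) \<longlonglongrightarrow> h x * \<bar>\<phi> x - v N x\<bar> powr p" for x
      by (intro tendsto_mult tendsto_const tendsto_powr' tendsto_rabs tendsto_diff lim) (use p in auto)
  qed (use h_nonneg bound in auto)
  have "(\<lambda>x. 2 powr p * (h x * \<bar>\<phi> x - v N x\<bar> powr p + h x * \<bar>v N x\<bar> powr p)) summable_on UNIV"
    by (intro summable_on_cmult_right summable_on_add ds finite_support_summable fin)
  then show ?thesis
  proof (rule summable_on_comparison_test)
    fix x
    have "\<bar>\<phi> x\<bar> powr p \<le> 2 powr p * (\<bar>\<phi> x - v N x\<bar> powr p + \<bar>v N x\<bar> powr p)"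
      using abs_diff_powr_le[of p "\<phi> x - v N x" "- v N x"] p by simp
    then have "h x * \<bar>\<phi> x\<bar> powr p \<le> h x * (2 powr p * (\<bar>\<phi> x - v N x\<bar> powr p + \<bar>v N x\<bar> powr p))"
      using h_nonneg by (rule mult_left_mono)
    then show "h x * \<bar>\<phi> x\<bar> powr p \<le> 2 powr p * (h x * \<bar>\<phi> x - v N x\<bar> powr p + h x * \<bar>v N x\<bar> powr p)"
      by (simp add: algebra_simps)
    show "0 \<le> h x * \<bar>\<phi> x\<bar> powr p" using h_nonneg by simp
  qed
qed

end


section \<open>The Green function\<close>

lemma integral_lborel_prod:
  fixes f :: "'a::euclidean_space \<Rightarrow> real \<Rightarrow> complex"
  assumes "\<And>b. b \<in> Basis \<Longrightarrow> integrable lborel (f b)"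
  shows "(LINT x|lborel. (\<Prod>b\<in>Basis. f b (x \<bullet> b))) = (\<Prod>b\<in>Basis. LINT x|lborel. f b x)"
proof -
  interpret product_sigma_finite "\<lambda>_::'a. lborel :: real measure" ..
  have [measurable]: "b \<in> Basis \<Longrightarrow> f b \<in> borel_measurable borel" for b
    using assms[of b] by (simp add: borel_measurable_integrable)
  have "(LINT x|lborel. (\<Prod>b\<in>Basis. f b (x \<bullet> b)))
      = (LINT x|(\<Pi>\<^sub>M b\<in>(Basis::'a set). lborel). (\<Prod>b\<in>Basis. f b ((\<Sum>b\<in>Basis. x b *\<^sub>R b) \<bullet> b)))"
    by (subst lborel_eq, subst integral_distr) auto
  also have "\<dots> = (LINT x|(\<Pi>\<^sub>M b\<in>(Basis::'a set). lborel). (\<Prod>b\<in>Basis. f b (x b)))"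
    by simp
  also have "\<dots> = (\<Prod>b\<in>Basis. LINT x|lborel. f b x)"
    by (rule product_integral_prod) (use assms in auto)
  finally show ?thesis .
qed

lemma integral_exp_int_period:
  fixes m :: int
  shows "(LINT t|lborel. indicator {0..2 * pi} t *\<^sub>R exp (\<i> * of_real (of_int m * t))) = (if m = 0 then 2 * pi else 0)"
proof (cases "m = 0")
  case False
  define F where "F t = exp (\<i> * of_real (of_int m * t)) / (\<i> * of_int m)" for t :: real
  have "(LINT t|lborel. indicator {0..2 * pi} t *\<^sub>R exp (\<i> * of_real (of_int m * t))) = F (2 * pi) - F 0"
  proof (rule integral_FTC_Icc)
    show "(F has_vector_derivative exp (\<i> * of_real (of_int m * t))) (at t within {0..2 * pi})" for t
    proof -
      have ii: "\<i> * (x * \<i>) = - x" for x by (simp add: complex_eq_iff)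
      have "((\<lambda>z. exp (\<i> * (of_int m * z)) / (\<i> * of_int m)) has_field_derivative
          exp (\<i> * (of_int m * of_real t))) (at (of_real t))"
        using False by (auto intro!: derivative_eq_intros simp: ii)
      then show ?thesis unfolding F_def using has_vector_derivative_real_field by fastforce
    qed
    show "continuous_on {0..2 * pi} (\<lambda>t. exp (\<i> * of_real (of_int m * t)))"
      by (intro continuous_intros)
  qed simp
  also have "exp (\<i> * of_real (of_int m * (2 * pi))) = (1::complex)"
    using exp_eq_1[of "\<i> * of_real (of_int m * (2 * pi))"] by auto
  then have "F (2 * pi) = F 0" unfolding F_def by simp
  finally show ?thesis using False by simp
qed (simp add: scaleR_conv_of_real)

definition phase :: "int ^ 'd \<Rightarrow> real ^ 'd \<Rightarrow> real" where
  "phase z k = (\<Sum>j\<in>UNIV. real_of_int (z $ j) * k $ j)"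

lemma phase_add: "phase (y + z) k = phase y k + phase z k"
  and phase_diff: "phase (y - z) k = phase y k - phase z k"
  and phase_uminus: "phase (- z) k = - phase z k"
  unfolding phase_def by (simp_all add: algebra_simps sum.distrib sum_subtractf sum_negf)

lemma phase_axis: "phase (axis j 1) k = k $ j"
proof -
  have "phase (axis j 1) k = (\<Sum>i\<in>UNIV. if i = j then k $ i else 0)"
    unfolding phase_def by (intro sum.cong) (auto simp: axis_def)
  then show ?thesis by simp
qed

lemma phase_cont: "continuous_on S (phase z)"
  unfolding phase_def by (intro continuous_intros)

lemma compact_torus: "compact torus"
  unfolding torus_def by (rule compact_cbox)

lemma torus_integrable:
  fixes g :: "real ^ 'd \<Rightarrow> 'b::{banach, second_countable_topology}"
  assumes "continuous_on torus g"
  shows "integrable lborel (\<lambda>k. indicator torus k *\<^sub>R g k)"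
  by (rule borel_integrable_compact[OF compact_torus assms])

lemma torus_sets [measurable]: "torus \<in> sets borel"
  unfolding torus_def by simp

lemma torus_indicator_prod:
  fixes k :: "real ^ 'd"
  shows "indicator torus k = (\<Prod>b\<in>Basis. indicator {0..2 * pi} (k \<bullet> b) :: 'b::{comm_semiring_1})"
proof -
  have iff: "k \<in> torus \<longleftrightarrow> (\<forall>b\<in>Basis. k \<bullet> b \<in> {0..2 * pi})"
    unfolding torus_def cbox_def by (auto simp: Basis_vec_def inner_axis)
  show ?thesis
  proof (cases "k \<in> torus")
    case True
    then show ?thesis using iff by (simp add: indicator_def)
  next
    case False
    then obtain b where "b \<in> Basis" "k \<bullet> b \<notin> {0..2 * pi}" using iff by blast
    then have "(\<Prod>b\<in>Basis. indicator {0..2 * pi} (k \<bullet> b) :: 'b) = 0"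
      by (intro prod_zero) (auto intro!: bexI[of _ b])
    then show ?thesis using False by simp
  qed
qed

text \<open>The integral is \<open>(2\<pi>)\<^sup>d\<close> or \<open>0\<close>; it factorises into one-dimensional integrals once the cosine is written as a real part.\<close>

lemma torus_cos_phase_nonneg:
  fixes z :: "int ^ 'd"
  shows "0 \<le> (LINT k|lborel. indicator torus k *\<^sub>R cos (phase z k))"
proof -
  define zr :: "real ^ 'd" where "zr = (\<chi> j. real_of_int (z $ j))"
  define e where "e b t = indicator {0..2 * pi} t *\<^sub>R exp (\<i> * of_real ((zr \<bullet> b) * t))" for b t
  have ph: "phase z k = (\<Sum>b\<in>Basis. (zr \<bullet> b) * (k \<bullet> b))" for k
  proof -
    have "phase z k = zr \<bullet> k" unfolding phase_def zr_def inner_vec_def by simp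
    then show ?thesis using euclidean_inner[of zr k] by simp
  qed
  have int: "integrable lborel (e b)" for b
    unfolding e_def by (rule borel_integrable_compact) (auto intro!: continuous_intros)
  have val: "\<exists>c\<ge>0. (LINT t|lborel. e b t) = complex_of_real c" if "b \<in> Basis" for b
  proof -
    obtain j where b: "b = axis j 1" using \<open>b \<in> Basis\<close> by (auto simp: Basis_vec_def)
    have "zr \<bullet> b = of_int (z $ j)" unfolding zr_def b by (simp add: inner_axis)
    then have "(LINT t|lborel. e b t) = (if z $ j = 0 then 2 * pi else 0)"
      unfolding e_def by (simp only: integral_exp_int_period)
    then show ?thesis by (intro exI[of _ "if z $ j = 0 then 2 * pi else 0"]) simp
  qed
  then obtain c where c: "\<And>b. b \<in> Basis \<Longrightarrow> 0 \<le> c b" "\<And>b. b \<in> Basis \<Longrightarrow> (LINT t|lborel. e b t) = complex_of_real (c b)"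
    by metis
  have prod_e: "(\<Prod>b\<in>Basis. e b (k \<bullet> b)) = indicator torus k *\<^sub>R exp (\<i> * of_real (phase z k))" for k
  proof -
    have "(\<Prod>b\<in>Basis. e b (k \<bullet> b)) = (\<Prod>b\<in>Basis. of_real (indicator {0..2 * pi} (k \<bullet> b)) * exp (\<i> * of_real ((zr \<bullet> b) * (k \<bullet> b))))"
      unfolding e_def by (simp add: scaleR_conv_of_real)
    also have "\<dots> = of_real (\<Prod>b\<in>Basis. indicator {0..2 * pi} (k \<bullet> b)) * exp (\<Sum>b\<in>Basis. \<i> * of_real ((zr \<bullet> b) * (k \<bullet> b)))"
      by (simp add: prod.distrib exp_sum)
    also have "(\<Sum>b\<in>Basis. \<i> * of_real ((zr \<bullet> b) * (k \<bullet> b))) = \<i> * of_real (phase z k)"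
      unfolding ph by (simp add: sum_distrib_left)
    finally show ?thesis by (simp add: torus_indicator_prod scaleR_conv_of_real)
  qed
  have ic: "integrable lborel (\<lambda>k. indicator torus k *\<^sub>R exp (\<i> * of_real (phase z k)))"
    by (intro torus_integrable continuous_intros phase_cont)
  have "(LINT k|lborel. indicator torus k *\<^sub>R exp (\<i> * of_real (phase z k))) = (\<Prod>b\<in>Basis. LINT t|lborel. e b t)"
    unfolding prod_e[symmetric] by (rule integral_lborel_prod[OF int])
  also have "\<dots> = of_real (\<Prod>b\<in>Basis. c b)" using c(2) by simp
  finally have "Re (LINT k|lborel. indicator torus k *\<^sub>R exp (\<i> * of_real (phase z k))) = (\<Prod>b\<in>Basis. c b)"
    by (simp only: Re_complex_of_real)
  also have "Re (LINT k|lborel. indicator torus k *\<^sub>R exp (\<i> * of_real (phase z k)))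
      = (LINT k|lborel. indicator torus k *\<^sub>R cos (phase z k))"
    using integral_Re[OF ic] by (simp add: Re_exp)
  finally show ?thesis using c(1) by (simp add: prod_nonneg)
qed

definition mean_cos :: "real ^ 'd \<Rightarrow> real" where
  "mean_cos k = (\<Sum>j\<in>UNIV. cos (k $ j)) / real CARD('d)"

lemma mean_cos_cont: "continuous_on S mean_cos"
  unfolding mean_cos_def by (intro continuous_intros) auto

lemma laplace_symbol_mean_cos: "laplace_symbol (k :: real ^ 'd) = 2 * real CARD('d) * (1 - mean_cos k)"
  unfolding laplace_symbol_def mean_cos_def by (simp add: field_simps)

lemma abs_mean_cos_le: "\<bar>mean_cos (k :: real ^ 'd)\<bar> \<le> 1"
proof -
  have "\<bar>\<Sum>j\<in>UNIV. cos (k $ j)\<bar> \<le> (\<Sum>j\<in>(UNIV::'d set). 1)"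
    by (rule order_trans[OF sum_abs sum_mono]) simp
  then show ?thesis unfolding mean_cos_def by simp
qed

text \<open>The \<open>n\<close>-th power of the mean cosine is the characteristic function of \<open>n\<close> steps of simple random walk, so
its Fourier coefficients are, up to the factor \<open>(2\<pi>)\<^sup>d\<close>, transition probabilities.  The induction is the product formula
\<open>2 cos a cos b = cos (a + b) + cos (a - b)\<close>.\<close>

lemma torus_cos_mean_cos_nonneg:
  fixes z :: "int ^ 'd"
  shows "0 \<le> (LINT k|lborel. indicator torus k *\<^sub>R (cos (phase z k) * mean_cos k ^ n))"
proof (induction n arbitrary: z)
  case 0
  then show ?case using torus_cos_phase_nonneg[of z] by simp
next
  case (Suc n)
  let ?I = "\<lambda>z k. indicator torus k *\<^sub>R (cos (phase z k) * mean_cos k ^ n)"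
  have int: "integrable lborel (?I z)" for z :: "int ^ 'd"
    by (intro torus_integrable continuous_intros phase_cont mean_cos_cont)
  have e: "indicator torus k *\<^sub>R (cos (phase z k) * mean_cos k ^ Suc n)
     = (\<Sum>j\<in>(UNIV::'d set). 1 / (2 * real CARD('d)) * (?I (z + axis j 1) k + ?I (z - axis j 1) k))" for k
  proof -
    have e0: "cos (phase z k) * cos (k $ j) = (cos (phase (z + axis j 1) k) + cos (phase (z - axis j 1) k)) / 2" for j
      unfolding phase_add phase_diff phase_axis by (simp add: cos_add cos_diff)
    have "cos (phase z k) * (\<Sum>j\<in>UNIV. cos (k $ j))
       = (\<Sum>j\<in>UNIV. (cos (phase (z + axis j 1) k) + cos (phase (z - axis j 1) k)) / 2)"
      unfolding sum_distrib_left by (intro sum.cong refl e0)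
    then have "cos (phase z k) * mean_cos k
       = (\<Sum>j\<in>UNIV. (cos (phase (z + axis j 1) k) + cos (phase (z - axis j 1) k)) / 2) / real CARD('d)"
      unfolding mean_cos_def by simp
    then have "cos (phase z k) * mean_cos k
       = (\<Sum>j\<in>UNIV. 1 / (2 * real CARD('d)) * (cos (phase (z + axis j 1) k) + cos (phase (z - axis j 1) k)))"
      unfolding sum_divide_distrib by simp
    then have "cos (phase z k) * mean_cos k ^ Suc n
       = (\<Sum>j\<in>UNIV. 1 / (2 * real CARD('d)) * (cos (phase (z + axis j 1) k) + cos (phase (z - axis j 1) k))) * mean_cos k ^ n"
      by (simp add: mult.assoc[symmetric])
    then show ?thesis
      by (simp add: sum_distrib_right sum_distrib_left distrib_left distrib_right mult.assoc mult.left_commute)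
  qed
  have "(LINT k|lborel. indicator torus k *\<^sub>R (cos (phase z k) * mean_cos k ^ Suc n))
     = (\<Sum>j\<in>(UNIV::'d set). 1 / (2 * real CARD('d)) * ((LINT k|lborel. ?I (z + axis j 1) k) + (LINT k|lborel. ?I (z - axis j 1) k)))"
    unfolding e using int by (subst Bochner_Integration.integral_sum) (auto simp: Bochner_Integration.integral_add)
  also have "0 \<le> \<dots>" using Suc.IH by (intro sum_nonneg mult_nonneg_nonneg add_nonneg_nonneg) auto
  finally show ?case .
qed

text \<open>For \<open>r < 1\<close> the binomial series of \<open>(1 - r P)\<^sup>-\<^sup>a\<close> converges uniformly, and its coefficients
\<open>pochhammer a n / n!\<close> are nonnegative.\<close>

lemma torus_cos_resolvent_nonneg:
  fixes z :: "int ^ 'd"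
  assumes r: "0 \<le> r" "r < 1" and a: "0 < a"
  shows "0 \<le> (LINT k|lborel. indicator torus k *\<^sub>R (cos (phase z k) * (1 - r * mean_cos k) powr (- a)))"
proof -
  define b where "b n = pochhammer a n / fact n" for n
  have b0: "0 \<le> b n" for n unfolding b_def using a by (simp add: pochhammer_nonneg)
  have gb: "((- a) gchoose n) * (- x) ^ n = b n * x ^ n" for n and x :: real
  proof -
    have "(- 1) ^ n * (- 1 :: real) ^ n = 1" by (simp add: power_mult_distrib[symmetric])
    moreover have "(- x) ^ n = (- 1) ^ n * x ^ n" by (rule power_minus)
    ultimately show ?thesis unfolding b_def gbinomial_pochhammer by simp
  qed
  have ser: "(\<lambda>n. b n * x ^ n) sums (1 - x) powr (- a)" if "\<bar>x\<bar> < 1" for x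
    using gen_binomial_real[of "- x" "- a"] that by (simp add: gb)
  let ?f = "\<lambda>n k. indicator torus k *\<^sub>R (cos (phase z k) * (b n * (r * mean_cos k) ^ n))"
  have small: "\<bar>r * mean_cos k\<bar> < 1" for k :: "real ^ 'd"
    using mult_left_mono[OF abs_mean_cos_le[of k] r(1)] r by (simp add: abs_mult)
  have int: "integrable lborel (?f n)" for n
    by (intro torus_integrable continuous_intros phase_cont mean_cos_cont)
  have sr: "summable (\<lambda>n. b n * r ^ n)" using ser[of r] r by (simp add: sums_iff)
  have nle: "norm (?f n k) \<le> b n * r ^ n * indicator torus k" for n k
  proof -
    have m: "\<bar>mean_cos k\<bar> ^ n \<le> 1" using abs_mean_cos_le[of k] by (simp add: power_le_one)
    have "\<bar>cos (phase z k)\<bar> * (b n * (r ^ n * \<bar>mean_cos k\<bar> ^ n)) \<le> 1 * (b n * (r ^ n * 1))"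
      using b0 r m by (intro mult_mono) auto
    then show ?thesis using b0[of n] r by (simp add: abs_mult power_mult_distrib power_abs indicator_def)
  qed
  have sn: "summable (\<lambda>n. norm (?f n k))" for k
    by (rule summable_comparison_test'[OF summable_mult2[OF sr, of "indicator torus k"]]) (use nle in auto)
  have It: "integrable lborel (\<lambda>k :: real ^ 'd. indicator torus k :: real)"
    using torus_integrable[of "\<lambda>_. 1 :: real"] by simp
  have si: "summable (\<lambda>n. LINT k|lborel. norm (?f n k))"
  proof (rule summable_comparison_test'[where N = 0])
    show "summable (\<lambda>n. b n * r ^ n * (LINT k|lborel. (indicator torus (k :: real ^ 'd) :: real)))"
      by (rule summable_mult2[OF sr])
    show "norm (LINT k|lborel. norm (?f n k)) \<le> b n * r ^ n * (LINT k|lborel. (indicator torus (k :: real ^ 'd) :: real))" for n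
    proof -
      have "(LINT k|lborel. norm (?f n k)) \<le> (LINT k|lborel. b n * r ^ n * indicator torus (k :: real ^ 'd))"
        using int It nle by (intro integral_mono) auto
      then show ?thesis by (simp add: integral_nonneg_AE)
    qed
  qed
  have "(\<Sum>n. ?f n k) = indicator torus k *\<^sub>R (cos (phase z k) * (1 - r * mean_cos k) powr (- a))" for k
  proof -
    have "(\<lambda>n. ?f n k) sums (indicator torus k *\<^sub>R (cos (phase z k) * (1 - r * mean_cos k) powr (- a)))"
      by (intro sums_scaleR_right sums_mult ser small)
    then show ?thesis by (rule sums_unique[symmetric])
  qed
  then have "(LINT k|lborel. indicator torus k *\<^sub>R (cos (phase z k) * (1 - r * mean_cos k) powr (- a)))
     = (LINT k|lborel. (\<Sum>n. ?f n k))" by simp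
  also have "\<dots> = (\<Sum>n. LINT k|lborel. ?f n k)"
    by (rule integral_suminf[OF int _ si]) (use sn in auto)
  also have "0 \<le> \<dots>"
  proof (rule suminf_nonneg)
    show "summable (\<lambda>n. LINT k|lborel. ?f n k)" by (rule summable_integral[OF int _ si]) (use sn in auto)
    show "0 \<le> (LINT k|lborel. ?f n k)" for n
    proof -
      have "(LINT k|lborel. ?f n k) = (LINT k|lborel. (b n * r ^ n) * (indicator torus k *\<^sub>R (cos (phase z k) * mean_cos k ^ n)))"
        by (intro Bochner_Integration.integral_cong) (auto simp: power_mult_distrib)
      also have "\<dots> = (b n * r ^ n) * (LINT k|lborel. indicator torus k *\<^sub>R (cos (phase z k) * mean_cos k ^ n))"
        by simp
      finally show ?thesis using torus_cos_mean_cos_nonneg[of z n] b0 r by simp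
    qed
  qed
  finally show ?thesis .
qed

lemma two_minus_two_cos_ge:
  fixes t :: real
  assumes "0 < t" "t \<le> pi"
  shows "(t / 3)\<^sup>2 \<le> 2 - 2 * cos t"
proof -
  define x where "x = t / 2"
  have x: "0 < x" "x \<le> 2" unfolding x_def using assms pi_less_4 by auto
  have "\<bar>sin x - x\<bar> \<le> x ^ 3 / 6"
    using Maclaurin_sin_bound[of x 3] x by (simp add: sin_coeff_def eval_nat_numeral fact_numeral)
  moreover have "x ^ 3 \<le> 4 * x"
  proof -
    have "x * x \<le> 2 * 2" using x by (intro mult_mono) auto
    then have "x * x * x \<le> 4 * x" using x by (intro mult_right_mono) auto
    then show ?thesis by (simp add: eval_nat_numeral)
  qed
  ultimately have s: "x / 3 \<le> sin x" by linarith
  have "2 - 2 * cos t = 4 * (sin x)\<^sup>2" unfolding x_def using cos_double_sin[of "t / 2"] by simp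
  also have "\<dots> \<ge> 4 * (x / 3)\<^sup>2" using s x by (intro mult_left_mono power_mono) auto
  also have "4 * (x / 3)\<^sup>2 = (t / 3)\<^sup>2" unfolding x_def by (simp add: power2_eq_square)
  finally show ?thesis by simp
qed

lemma AE_lborel_hyperplane:
  fixes c :: real
  shows "AE k in lborel. (k :: real ^ 'd) $ j \<noteq> c"
proof -
  have "negligible {k :: real ^ 'd. k \<bullet> axis j 1 = c}"
    by (rule negligible_standard_hyperplane) (simp add: axis_in_Basis_iff)
  moreover have "{k :: real ^ 'd. k \<bullet> axis j 1 = c} = {k. k $ j = c}" by (simp add: inner_axis)
  moreover have "closed {k :: real ^ 'd. k $ j = c}" by (intro closed_Collect_eq continuous_intros)
  ultimately have "{k :: real ^ 'd. k $ j = c} \<in> null_sets lborel"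
    by (simp add: negligible_iff_null_sets null_sets_completion_iff borel_closed)
  then show ?thesis by (rule AE_I') auto
qed

lemma AE_torus_interior:
  "AE k in lborel. (k :: real ^ 'd) \<in> torus \<longrightarrow> (\<forall>j. 0 < k $ j \<and> k $ j < 2 * pi)"
proof -
  have "AE k in lborel. \<forall>j. (k :: real ^ 'd) $ j \<noteq> 0 \<and> k $ j \<noteq> 2 * pi"
    by (subst AE_all_countable) (use AE_lborel_hyperplane in auto)
  then show ?thesis
  proof eventually_elim
    case (elim k)
    show ?case
    proof (intro impI allI)
      fix j assume "k \<in> torus"
      then have "0 \<le> k $ j" "k $ j \<le> 2 * pi" unfolding torus_def by (auto simp: mem_box_cart)
      then show "0 < k $ j \<and> k $ j < 2 * pi" using elim[rule_format, of j] by auto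
    qed
  qed
qed

text \<open>An integrable majorant of \<open>(2 - 2 cos t) powr (-\<beta> / 2)\<close> on \<open>[0, 2\<pi>]\<close>, with one singular term for each end point.\<close>

definition cusp :: "real \<Rightarrow> real \<Rightarrow> real" where
  "cusp \<beta> t = (t / 3) powr (- \<beta>) + ((2 * pi - t) / 3) powr (- \<beta>)"

lemma cos_powr_le_cusp:
  fixes t \<beta> :: real
  assumes t: "0 < t" "t < 2 * pi" and \<beta>: "0 \<le> \<beta>"
  shows "0 < 2 - 2 * cos t" and "(2 - 2 * cos t) powr (- \<beta> / 2) \<le> cusp \<beta> t"
proof -
  have main: "0 < 2 - 2 * cos x \<and> (2 - 2 * cos x) powr (- \<beta> / 2) \<le> (x / 3) powr (- \<beta>)" if x: "0 < x" "x \<le> pi" for x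
  proof
    have "0 < (x / 3)\<^sup>2" using x by simp
    with two_minus_two_cos_ge[OF x] show "0 < 2 - 2 * cos x" by linarith
    have "(2 - 2 * cos x) powr (- \<beta> / 2) \<le> ((x / 3)\<^sup>2) powr (- \<beta> / 2)"
      using two_minus_two_cos_ge[OF x] x \<beta> by (intro powr_mono2') auto
    also have "(x / 3)\<^sup>2 = (x / 3) powr 2" using x by simp
    finally show "(2 - 2 * cos x) powr (- \<beta> / 2) \<le> (x / 3) powr (- \<beta>)" by (simp only: powr_powr) simp
  qed
  have c: "cos (2 * pi - t) = cos t" by (simp add: cos_diff)
  have "0 < 2 - 2 * cos t \<and> (2 - 2 * cos t) powr (- \<beta> / 2) \<le> cusp \<beta> t"
  proof (cases "t \<le> pi")
    case True
    then show ?thesis using main[of t] t unfolding cusp_def by (auto intro: order_trans)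
  next
    case False
    then show ?thesis using main[of "2 * pi - t"] t unfolding cusp_def c by (auto intro: order_trans)
  qed
  then show "0 < 2 - 2 * cos t" and "(2 - 2 * cos t) powr (- \<beta> / 2) \<le> cusp \<beta> t" by auto
qed

lemma nn_integral_cusp_finite:
  assumes \<beta>: "0 \<le> \<beta>" "\<beta> < 1"
  shows "(\<integral>\<^sup>+t. ennreal (indicator {0..2 * pi} t * cusp \<beta> t) \<partial>lborel) < \<infinity>"
proof -
  have 1: "(\<integral>\<^sup>+t. ennreal (indicator {0..2 * pi} t * (t / 3) powr (- \<beta>)) \<partial>lborel) < \<infinity>"
  proof -
    have "((\<lambda>x. x powr (- \<beta>)) has_integral ((2 * pi) powr (- \<beta> + 1) / (- \<beta> + 1))) {0..2 * pi}"
      by (rule has_integral_powr_from_0) (use \<beta> in auto)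
    then have "((\<lambda>x. x powr (- \<beta>) * (1 / 3) powr (- \<beta>)) has_integral ((2 * pi) powr (- \<beta> + 1) / (- \<beta> + 1) * (1 / 3) powr (- \<beta>))) {0..2 * pi}"
      by (rule has_integral_mult_left)
    moreover have "(\<lambda>t::real. (t / 3) powr (- \<beta>)) = (\<lambda>t. t powr (- \<beta>) * (1 / 3) powr (- \<beta>))"
    proof
      fix t :: real
      have "(t * (1 / 3)) powr (- \<beta>) = t powr (- \<beta>) * (1 / 3) powr (- \<beta>)" by (rule powr_mult)
      then show "(t / 3) powr (- \<beta>) = t powr (- \<beta>) * (1 / 3) powr (- \<beta>)" by simp
    qed
    ultimately have "((\<lambda>t. (t / 3) powr (- \<beta>)) has_integral ((2 * pi) powr (- \<beta> + 1) / (- \<beta> + 1) * (1 / 3) powr (- \<beta>))) {0..2 * pi}"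
      by (simp only:)
    from nn_integral_has_integral_lebesgue[OF _ this] show ?thesis by simp
  qed
  have m: "(\<lambda>t. ennreal (indicator {0..2 * pi} t * (t / 3) powr (- \<beta>))) \<in> borel_measurable borel" by measurable
  have "(\<integral>\<^sup>+t. ennreal (indicator {0..2 * pi} t * (t / 3) powr (- \<beta>)) \<partial>lborel)
     = (\<integral>\<^sup>+t. ennreal (indicator {0..2 * pi} (2 * pi + (-1) * t) * ((2 * pi + (-1) * t) / 3) powr (- \<beta>)) \<partial>lborel)"
    by (subst nn_integral_real_affine[OF m, of "-1" "2 * pi"]) auto
  also have "\<dots> = (\<integral>\<^sup>+t. ennreal (indicator {0..2 * pi} t * ((2 * pi - t) / 3) powr (- \<beta>)) \<partial>lborel)"
    by (intro nn_integral_cong) (auto simp: indicator_def)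
  finally have 2: "(\<integral>\<^sup>+t. ennreal (indicator {0..2 * pi} t * ((2 * pi - t) / 3) powr (- \<beta>)) \<partial>lborel) < \<infinity>" using 1 by simp
  have "(\<integral>\<^sup>+t. ennreal (indicator {0..2 * pi} t * cusp \<beta> t) \<partial>lborel)
     = (\<integral>\<^sup>+t. ennreal (indicator {0..2 * pi} t * (t / 3) powr (- \<beta>)) + ennreal (indicator {0..2 * pi} t * ((2 * pi - t) / 3) powr (- \<beta>)) \<partial>lborel)"
    unfolding cusp_def by (intro nn_integral_cong) (subst ennreal_plus[symmetric], auto simp: distrib_left)
  also have "\<dots> = (\<integral>\<^sup>+t. ennreal (indicator {0..2 * pi} t * (t / 3) powr (- \<beta>)) \<partial>lborel)
     + (\<integral>\<^sup>+t. ennreal (indicator {0..2 * pi} t * ((2 * pi - t) / 3) powr (- \<beta>)) \<partial>lborel)"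
    by (rule nn_integral_add) measurable
  finally show ?thesis using 1 2 by (simp add: ennreal_add_less_top)
qed

lemma laplace_symbol_cont: "continuous_on S laplace_symbol"
  unfolding laplace_symbol_def by (intro continuous_intros)

lemma laplace_symbol_measurable [measurable]: "laplace_symbol \<in> borel_measurable borel"
  by (rule borel_measurable_continuous_onI[OF laplace_symbol_cont])

lemma laplace_symbol_eq: "laplace_symbol (k :: real ^ 'd) = (\<Sum>j\<in>UNIV. 2 - 2 * cos (k $ j))"
  unfolding laplace_symbol_def by (simp add: sum_subtractf sum_distrib_left)

lemma laplace_symbol_ge: "2 - 2 * cos (k $ j) \<le> laplace_symbol k"
  unfolding laplace_symbol_eq
  by (rule member_le_sum[where f = "\<lambda>j. 2 - 2 * cos (k $ j)"]) auto

lemma AE_laplace_symbol_pos: "AE k in lborel. (k :: real ^ 'd) \<in> torus \<longrightarrow> 0 < laplace_symbol k"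
  using AE_torus_interior
proof eventually_elim
  case (elim k)
  show ?case
  proof
    assume "k \<in> torus"
    then have "0 < k $ undefined" "k $ undefined < 2 * pi" using elim by auto
    then show "0 < laplace_symbol k"
      using cos_powr_le_cusp(1)[of "k $ undefined" 0] laplace_symbol_ge[of k undefined] by linarith
  qed
qed

text \<open>Every coordinate satisfies \<open>2 - 2 cos k\<^sub>j \<le> \<mu>(k)\<close>.  Splitting \<open>\<mu>\<^sup>-\<^sup>\<alpha>\<^sup>/\<^sup>2\<close> into \<open>d\<close> equal factors and bounding
the \<open>j\<close>-th one through \<open>k\<^sub>j\<close> gives a product of functions with singularities of order
\<open>\<alpha> / d < 1\<close>.\<close>

lemma green_density_integrable:
  assumes \<alpha>: "0 < \<alpha>" "\<alpha> < real CARD('d)"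
  shows "integrable lborel (\<lambda>k :: real ^ 'd. indicator torus k *\<^sub>R laplace_symbol k powr (- \<alpha> / 2))"
proof (rule integrableI_bounded)
  show "(\<lambda>k :: real ^ 'd. indicator torus k *\<^sub>R laplace_symbol k powr (- \<alpha> / 2)) \<in> borel_measurable lborel"
    by measurable
  define \<beta> where "\<beta> = \<alpha> / real CARD('d)"
  have \<beta>: "0 \<le> \<beta>" "\<beta> < 1" unfolding \<beta>_def using \<alpha> by auto
  let ?g = "\<lambda>t. ennreal (indicator {0..2 * pi} t * cusp \<beta> t)"
  have cusp0: "0 \<le> cusp \<beta> t" for t unfolding cusp_def by simp
  have "(\<integral>\<^sup>+k. ennreal (norm (indicator torus (k :: real ^ 'd) *\<^sub>R laplace_symbol k powr (- \<alpha> / 2))) \<partial>lborel)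
      \<le> (\<integral>\<^sup>+k. (\<Prod>b\<in>(Basis :: (real ^ 'd) set). ?g (k \<bullet> b)) \<partial>lborel)"
  proof (rule nn_integral_mono_AE)
    show "AE k in lborel. ennreal (norm (indicator torus (k :: real ^ 'd) *\<^sub>R laplace_symbol k powr (- \<alpha> / 2)))
        \<le> (\<Prod>b\<in>Basis. ?g (k \<bullet> b))"
      using AE_torus_interior
    proof eventually_elim
      case (elim k)
      show ?case
      proof (cases "k \<in> torus")
        case True
        have "laplace_symbol k powr (- \<alpha> / 2) = (laplace_symbol k powr (- \<beta> / 2)) powr real CARD('d)"
          unfolding \<beta>_def by (simp add: powr_powr)
        also have "\<dots> = (laplace_symbol k powr (- \<beta> / 2)) ^ CARD('d)"
        proof (rule powr_realpow)
          have "0 < k $ undefined" "k $ undefined < 2 * pi" using elim True by auto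
          then have "0 < laplace_symbol k"
            using cos_powr_le_cusp(1)[of "k $ undefined" 0] laplace_symbol_ge[of k undefined] by linarith
          then show "0 < laplace_symbol k powr (- \<beta> / 2)" by simp
        qed
        also have "\<dots> = (\<Prod>b\<in>(Basis :: (real ^ 'd) set). laplace_symbol k powr (- \<beta> / 2))" by simp
        also have "\<dots> \<le> (\<Prod>b\<in>Basis. indicator {0..2 * pi} (k \<bullet> b) * cusp \<beta> (k \<bullet> b))"
        proof (intro prod_mono conjI)
          fix b :: "real ^ 'd" assume "b \<in> Basis"
          then obtain j where b: "b = axis j 1" by (auto simp: Basis_vec_def)
          have kj: "k \<bullet> b = k $ j" unfolding b by (simp add: inner_axis)
          have j: "0 < k $ j" "k $ j < 2 * pi" using elim True by auto
          have "laplace_symbol k powr (- \<beta> / 2) \<le> (2 - 2 * cos (k $ j)) powr (- \<beta> / 2)"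
            using laplace_symbol_ge[of k j] cos_powr_le_cusp(1)[OF j \<beta>(1)] \<beta> by (intro powr_mono2') auto
          also have "\<dots> \<le> cusp \<beta> (k $ j)" by (rule cos_powr_le_cusp(2)[OF j \<beta>(1)])
          finally show "laplace_symbol k powr (- \<beta> / 2) \<le> indicator {0..2 * pi} (k \<bullet> b) * cusp \<beta> (k \<bullet> b)"
            unfolding kj using j by simp
        qed simp
        finally show ?thesis using True cusp0 by (simp add: prod_ennreal ennreal_leI)
      qed simp
    qed
  qed
  also have "\<dots> = (\<Prod>b\<in>(Basis :: (real ^ 'd) set). (\<integral>\<^sup>+t. ?g t \<partial>lborel))"
    by (rule nn_integral_lborel_prod) (auto simp: cusp_def)
  also have "\<dots> < \<infinity>"
    using nn_integral_cusp_finite[OF \<beta>] by (simp add: power_eq_top_ennreal less_top[symmetric])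
  finally show "(\<integral>\<^sup>+k. ennreal (norm (indicator torus (k :: real ^ 'd) *\<^sub>R laplace_symbol k powr (- \<alpha> / 2))) \<partial>lborel) < \<infinity>" .
qed

definition green_integral :: "real \<Rightarrow> int ^ 'd \<Rightarrow> real" where
  "green_integral \<alpha> z = (LINT k|lborel. indicator torus k *\<^sub>R (cos (phase z k) * laplace_symbol k powr (- \<alpha> / 2)))"

lemma cos_green_density_integrable:
  fixes z :: "int ^ 'd"
  assumes \<alpha>: "0 < \<alpha>" "\<alpha> < real CARD('d)"
  shows "integrable lborel (\<lambda>k. indicator torus k *\<^sub>R (cos (phase z k) * laplace_symbol k powr (- \<alpha> / 2)))"
proof (rule Bochner_Integration.integrable_bound[OF green_density_integrable[OF \<alpha>]])
  have [measurable]: "phase z \<in> borel_measurable borel" by (rule borel_measurable_continuous_onI[OF phase_cont])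
  show "(\<lambda>k. indicator torus k *\<^sub>R (cos (phase z k) * laplace_symbol k powr (- \<alpha> / 2))) \<in> borel_measurable lborel"
    by measurable
qed (auto intro!: AE_I2 simp: abs_mult indicator_def mult_left_le_one_le)

text \<open>The limit \<open>r \<rightarrow> 1\<close> of \<open>torus_cos_resolvent_nonneg\<close>; the integrands are dominated by
\<open>1 + (1 - P)\<^sup>-\<^sup>a\<close>, where the \<open>1\<close> covers the region \<open>P < 0\<close>.\<close>

lemma green_integral_nonneg:
  fixes z :: "int ^ 'd"
  assumes \<alpha>: "0 < \<alpha>" "\<alpha> < real CARD('d)"
  shows "0 \<le> green_integral \<alpha> z"
proof -
  define a where "a = \<alpha> / 2"
  define r where "r n = 1 - 1 / real (Suc n)" for n
  have a: "0 < a" unfolding a_def using \<alpha> by simp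
  have r: "0 \<le> r n" "r n < 1" for n unfolding r_def by auto
  have rlim: "r \<longlonglongrightarrow> 1"
    unfolding r_def using tendsto_diff[OF tendsto_const[of 1] LIMSEQ_inverse_real_of_nat] by (simp add: inverse_eq_divide)
  define D where "D = 2 * real CARD('d)"
  have D: "0 < D" unfolding D_def by simp
  have mc: "1 - mean_cos k = laplace_symbol k / D" for k :: "real ^ 'd"
    unfolding laplace_symbol_mean_cos D_def by simp
  have mc1: "0 \<le> 1 - mean_cos k" for k :: "real ^ 'd" using abs_mean_cos_le[of k] by simp
  have dens: "(1 - mean_cos k) powr (- a) = D powr a * laplace_symbol k powr (- \<alpha> / 2)" for k :: "real ^ 'd"
    using D mc1[of k] unfolding mc a_def by (simp add: powr_divide powr_minus field_simps)
  have [measurable]: "phase z \<in> borel_measurable borel" "(mean_cos :: real ^ 'd \<Rightarrow> real) \<in> borel_measurable borel"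
    by (auto intro!: borel_measurable_continuous_onI phase_cont mean_cos_cont)
  let ?w = "\<lambda>k :: real ^ 'd. indicator torus k *\<^sub>R (1 :: real) + D powr a * (indicator torus k *\<^sub>R laplace_symbol k powr (- \<alpha> / 2))"
  have intw: "integrable lborel ?w"
    by (intro Bochner_Integration.integrable_add integrable_mult_right torus_integrable green_density_integrable \<alpha>) simp
  have limI: "(\<lambda>n. LINT k|lborel. indicator torus k *\<^sub>R (cos (phase z k) * (1 - r n * mean_cos k) powr (- a)))
    \<longlonglongrightarrow> (LINT k|lborel. indicator torus k *\<^sub>R (cos (phase z k) * (1 - mean_cos k) powr (- a)))"
  proof (rule integral_dominated_convergence[OF _ _ intw])
    show "AE k in lborel. (\<lambda>n. indicator torus k *\<^sub>R (cos (phase z k) * (1 - r n * mean_cos k) powr (- a)))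
        \<longlonglongrightarrow> indicator torus k *\<^sub>R (cos (phase z k) * (1 - mean_cos k) powr (- a))"
      using AE_laplace_symbol_pos
    proof eventually_elim
      case (elim k)
      show ?case
      proof (cases "k \<in> torus")
        case True
        then have "1 - mean_cos k \<noteq> 0" using elim D mc[of k] by simp
        moreover have "(\<lambda>n. 1 - r n * mean_cos k) \<longlonglongrightarrow> 1 - mean_cos k"
          using tendsto_diff[OF tendsto_const tendsto_mult[OF rlim tendsto_const], of 1 "mean_cos k"] by simp
        ultimately show ?thesis by (intro tendsto_scaleR tendsto_mult tendsto_const tendsto_powr)
      qed simp
    qed
    show "AE k in lborel. norm (indicator torus k *\<^sub>R (cos (phase z k) * (1 - r n * mean_cos k) powr (- a))) \<le> ?w k" for n
      using AE_laplace_symbol_pos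
    proof eventually_elim
      case (elim k)
      show ?case
      proof (cases "k \<in> torus")
        case True
        then have pos: "0 < 1 - mean_cos k" using elim D mc[of k] by simp
        have "(1 - r n * mean_cos k) powr (- a) \<le> 1 + (1 - mean_cos k) powr (- a)"
        proof (cases "0 \<le> mean_cos k")
          case True
          then have "r n * mean_cos k \<le> 1 * mean_cos k" using r(2)[of n] by (intro mult_right_mono) auto
          then have "(1 - r n * mean_cos k) powr (- a) \<le> (1 - mean_cos k) powr (- a)"
            using pos a by (intro powr_mono2') auto
          then show ?thesis by simp
        next
          case False
          then have "r n * mean_cos k \<le> 0" using r(1)[of n] by (simp add: mult_nonneg_nonpos)
          then have "(1 - r n * mean_cos k) powr (- a) \<le> 1 powr (- a)" using a by (intro powr_mono2') auto
          then show ?thesis by (simp add: add_increasing2)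
        qed
        moreover have "\<bar>cos (phase z k)\<bar> * (1 - r n * mean_cos k) powr (- a) \<le> 1 * (1 - r n * mean_cos k) powr (- a)"
          by (intro mult_right_mono) auto
        ultimately show ?thesis using True unfolding dens[of k] by (simp add: abs_mult)
      qed simp
    qed
  qed measurable
  have posI: "0 \<le> (LINT k|lborel. indicator torus k *\<^sub>R (cos (phase z k) * (1 - r n * mean_cos k) powr (- a)))" for n
    by (rule torus_cos_resolvent_nonneg[OF r a])
  have "0 \<le> (LINT k|lborel. indicator torus k *\<^sub>R (cos (phase z k) * (1 - mean_cos k) powr (- a)))"
    by (rule LIMSEQ_le_const[OF limI]) (use posI in blast)
  also have "\<dots> = (LINT k|lborel. D powr a * (indicator torus k *\<^sub>R (cos (phase z k) * laplace_symbol k powr (- \<alpha> / 2))))"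
    unfolding dens by (intro Bochner_Integration.integral_cong) auto
  also have "\<dots> = D powr a * green_integral \<alpha> z" unfolding green_integral_def by simp
  finally show ?thesis using D by (simp add: zero_le_mult_iff)
qed

lemma green_integral_le: 
  fixes z :: "int ^ 'd"
  assumes \<alpha>: "0 < \<alpha>" "\<alpha> < real CARD('d)"
  shows "green_integral \<alpha> z \<le> green_integral \<alpha> (0 :: int ^ 'd)"
proof -
  have "phase (0 :: int ^ 'd) k = 0" for k unfolding phase_def by simp
  then have "green_integral \<alpha> (0 :: int ^ 'd) = (LINT k|lborel. indicator torus (k :: real ^ 'd) *\<^sub>R laplace_symbol k powr (- \<alpha> / 2))"
    unfolding green_integral_def by simp
  moreover have "green_integral \<alpha> z \<le> (LINT k|lborel. indicator torus (k :: real ^ 'd) *\<^sub>R laplace_symbol k powr (- \<alpha> / 2))"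
    unfolding green_integral_def
  proof (rule integral_mono[OF cos_green_density_integrable[OF \<alpha>] green_density_integrable[OF \<alpha>]])
    fix k :: "real ^ 'd"
    have "cos (phase z k) * laplace_symbol k powr (- \<alpha> / 2) \<le> 1 * laplace_symbol k powr (- \<alpha> / 2)"
      by (intro mult_right_mono) auto
    then show "indicator torus k *\<^sub>R (cos (phase z k) * laplace_symbol k powr (- \<alpha> / 2)) \<le> indicator torus k *\<^sub>R laplace_symbol k powr (- \<alpha> / 2)"
      by (simp add: indicator_def)
  qed
  ultimately show ?thesis by simp
qed

lemma green_integral_uminus: "green_integral \<alpha> (- z) = green_integral \<alpha> z"
  unfolding green_integral_def phase_uminus by simp

lemma torus_integral_pos:
  fixes g :: "real ^ 'd \<Rightarrow> real"
  assumes int: "integrable lborel (\<lambda>k. indicator torus k *\<^sub>R g k)" and nn: "\<And>k. 0 \<le> g k"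
    and pos: "AE k in lborel. k \<in> torus \<longrightarrow> 0 < g k"
  shows "0 < (LINT k|lborel. indicator torus k *\<^sub>R g k)"
proof -
  have ge: "0 \<le> (LINT k|lborel. indicator torus k *\<^sub>R g k)" using nn by (intro integral_nonneg_AE) simp
  have "(LINT k|lborel. indicator torus k *\<^sub>R g k) \<noteq> 0"
  proof
    assume "(LINT k|lborel. indicator torus k *\<^sub>R g k) = 0"
    then have "AE k in lborel. indicator torus k *\<^sub>R g k = 0"
      using integral_nonneg_eq_0_iff_AE[OF int] nn by simp
    with pos have "AE k :: real ^ 'd in lborel. k \<notin> torus"
      by eventually_elim auto
    then have e: "emeasure lborel (torus :: (real ^ 'd) set) = 0"
      by (subst (asm) AE_iff_measurable[OF _ refl]) (auto simp: torus_def)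
    have v: "emeasure lborel (torus :: (real ^ 'd) set) = ennreal (\<Prod>b\<in>(Basis :: (real ^ 'd) set). ((\<chi> i. 2 * pi) - 0) \<bullet> b)"
      unfolding torus_def by (rule emeasure_lborel_cbox) (auto simp: Basis_vec_def inner_axis)
    have "(\<Prod>b\<in>(Basis :: (real ^ 'd) set). ((\<chi> i. 2 * pi) - 0) \<bullet> b) \<le> 0"
      using e unfolding v by (simp only: ennreal_eq_0_iff)
    moreover have "0 < (\<Prod>b\<in>(Basis :: (real ^ 'd) set). ((\<chi> i. 2 * pi) - 0) \<bullet> b)"
      by (rule prod_pos) (auto simp: Basis_vec_def inner_axis)
    ultimately show False by linarith
  qed
  then show ?thesis using ge by simp
qed

proposition green_properties:
  fixes x y :: "int ^ 'd"
  assumes \<alpha>: "0 < \<alpha>" "\<alpha> < real CARD('d)"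
  shows "green \<alpha> x y = green \<alpha> y x" "0 \<le> green \<alpha> x y" "green \<alpha> x y \<le> green \<alpha> (0 :: int ^ 'd) 0"
    "green \<alpha> x x = green \<alpha> (0 :: int ^ 'd) 0" "0 < green \<alpha> (0 :: int ^ 'd) 0"
proof -
  define c where "c = green_const TYPE('d) \<alpha> / (2 * pi) ^ CARD('d)"
  have gc: "0 < (LINT k|lborel. indicator torus (k :: real ^ 'd) *\<^sub>R laplace_symbol k powr (\<alpha> / 2))"
  proof (rule torus_integral_pos)
    show "integrable lborel (\<lambda>k. indicator torus (k :: real ^ 'd) *\<^sub>R laplace_symbol k powr (\<alpha> / 2))"
      using \<alpha> by (intro torus_integrable continuous_on_powr' laplace_symbol_cont continuous_on_const)
         (auto simp: laplace_symbol_eq intro!: sum_nonneg)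
    show "AE k in lborel. (k :: real ^ 'd) \<in> torus \<longrightarrow> 0 < laplace_symbol k powr (\<alpha> / 2)"
      using AE_laplace_symbol_pos by eventually_elim auto
  qed simp
  then have c: "0 < c" unfolding c_def green_const_def set_lebesgue_integral_def by simp
  have g: "green \<alpha> x y = c * green_integral \<alpha> (x - y)" for x y :: "int ^ 'd"
  proof -
    let ?e = "\<lambda>k. exp (\<i> * complex_of_real (\<Sum>j\<in>UNIV. real_of_int (x $ j - y $ j) * k $ j)) *
           complex_of_real (laplace_symbol k powr (- \<alpha> / 2))"
    have ph: "(\<Sum>j\<in>UNIV. real_of_int (x $ j - y $ j) * k $ j) = phase (x - y) k" for k
      unfolding phase_def by simp
    have [measurable]: "phase (x - y) \<in> borel_measurable borel" by (rule borel_measurable_continuous_onI[OF phase_cont])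
    have int: "integrable lborel (\<lambda>k. indicator torus k *\<^sub>R ?e k)"
      unfolding ph
    proof (rule Bochner_Integration.integrable_bound[OF green_density_integrable[OF \<alpha>]])
      show "(\<lambda>k. indicator torus k *\<^sub>R (exp (\<i> * complex_of_real (phase (x - y) k)) * complex_of_real (laplace_symbol k powr (- \<alpha> / 2))))
          \<in> borel_measurable lborel" by measurable
    qed (auto intro!: AE_I2 simp: norm_mult)
    have "Re (LINT k : torus | lborel. ?e k) = (LINT k|lborel. Re (indicator torus k *\<^sub>R ?e k))"
      unfolding set_lebesgue_integral_def using integral_Re[OF int] by simp
    also have "\<dots> = green_integral \<alpha> (x - y)"
      unfolding green_integral_def ph by (intro Bochner_Integration.integral_cong) (auto simp: Re_exp)
    finally show ?thesis unfolding green_def c_def by simp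
  qed
  show "green \<alpha> x y = green \<alpha> y x" unfolding g using green_integral_uminus[of \<alpha> "x - y"] by simp
  show "0 \<le> green \<alpha> x y" unfolding g using c green_integral_nonneg[OF \<alpha>] by simp
  show "green \<alpha> x y \<le> green \<alpha> (0 :: int ^ 'd) 0" unfolding g using c green_integral_le[OF \<alpha>] by simp
  show "green \<alpha> x x = green \<alpha> (0 :: int ^ 'd) 0" unfolding g by simp
  have "phase (0 :: int ^ 'd) k = 0" for k unfolding phase_def by simp
  then have "green_integral \<alpha> (0 :: int ^ 'd) = (LINT k|lborel. indicator torus (k :: real ^ 'd) *\<^sub>R laplace_symbol k powr (- \<alpha> / 2))"
    unfolding green_integral_def by simp
  also have "\<dots> > 0"
  proof (rule torus_integral_pos[OF green_density_integrable[OF \<alpha>]])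
    show "AE k in lborel. (k :: real ^ 'd) \<in> torus \<longrightarrow> 0 < laplace_symbol k powr (- \<alpha> / 2)"
      using AE_laplace_symbol_pos by eventually_elim auto
  qed simp
  finally show "0 < green \<alpha> (0 :: int ^ 'd) 0" unfolding g using c by simp
qed

section \<open>Row sums of the fractional kernel\<close>

lemma summable_int_weight:
  fixes b :: real
  assumes "1 < b"
  shows "(\<lambda>m::int. (1 + \<bar>real_of_int m\<bar>) powr (- b)) summable_on UNIV"
proof -
  have "summable (\<lambda>n. real n powr (- b))" using assms by (simp add: summable_real_powr_iff)
  then have "summable (\<lambda>n. real (Suc n) powr (- b))" using summable_Suc_iff[of "\<lambda>n. real n powr (- b)"] by simp
  then have s: "(\<lambda>n. (1 + real n) powr (- b)) summable_on UNIV"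
    by (intro summable_nonneg_imp_summable_on) (auto simp: add.commute)
  have "(\<lambda>m::int. (1 + \<bar>real_of_int m\<bar>) powr (- b)) summable_on range int"
    by (subst summable_on_reindex) (use s in \<open>auto simp: o_def\<close>)
  moreover have "(\<lambda>m::int. (1 + \<bar>real_of_int m\<bar>) powr (- b)) summable_on range (\<lambda>n. - int n)"
    by (subst summable_on_reindex) (use s in \<open>auto simp: o_def inj_on_def\<close>)
  moreover have "(UNIV :: int set) = range int \<union> range (\<lambda>n. - int n)"
    by (auto simp: image_iff) (metis int_cases2)
  ultimately show ?thesis by (metis summable_on_union)
qed

lemma sum_prod_box:
  fixes g :: "int \<Rightarrow> real" and M :: "int set"
  assumes M: "finite M"
  shows "(\<Sum>z\<in>{z :: int ^ 'd. \<forall>i. z $ i \<in> M}. \<Prod>i\<in>UNIV. g (z $ i)) = (sum g M) ^ CARD('d)"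
proof -
  have "(sum g M) ^ CARD('d) = (\<Prod>i\<in>(UNIV::'d set). sum g M)" by simp
  also have "\<dots> = (\<Sum>\<zeta>\<in>PiE (UNIV :: 'd set) (\<lambda>_. M). \<Prod>i\<in>UNIV. g (\<zeta> i))"
    by (rule prod_sum_PiE) (use M in auto)
  also have "\<dots> = (\<Sum>z\<in>{z :: int ^ 'd. \<forall>i. z $ i \<in> M}. \<Prod>i\<in>UNIV. g (z $ i))"
    by (rule sum.reindex_bij_witness[of _ "\<lambda>z. ($) z" "\<lambda>\<zeta>. \<chi> i. \<zeta> i"]) (auto simp: PiE_UNIV_domain)
  finally show ?thesis by simp
qed

lemma finite_vec_box:
  fixes M :: "int set"
  assumes "finite M" shows "finite {z :: int ^ 'd. \<forall>i. z $ i \<in> M}"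
proof (rule finite_subset)
  show "{z :: int ^ 'd. \<forall>i. z $ i \<in> M} \<subseteq> (\<lambda>\<zeta>. \<chi> i. \<zeta> i) ` PiE UNIV (\<lambda>_. M)"
  proof
    fix z :: "int ^ 'd" assume "z \<in> {z. \<forall>i. z $ i \<in> M}"
    then show "z \<in> (\<lambda>\<zeta>. \<chi> i. \<zeta> i) ` PiE UNIV (\<lambda>_. M)"
      by (intro image_eqI[of _ _ "($) z"]) (auto simp: PiE_UNIV_domain)
  qed
qed (use assms in \<open>auto intro!: finite_PiE\<close>)

lemma lattice_prod_summable:
  fixes g :: "int \<Rightarrow> real"
  assumes g: "\<And>m. 0 \<le> g m" "g summable_on UNIV"
  shows "(\<lambda>z :: int ^ 'd. \<Prod>i\<in>UNIV. g (z $ i)) summable_on UNIV"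
proof (rule nonneg_bdd_above_summable_on)
  show "bdd_above (sum (\<lambda>z :: int ^ 'd. \<Prod>i\<in>UNIV. g (z $ i)) ` {F. F \<subseteq> UNIV \<and> finite F})"
  proof (rule bdd_aboveI2)
    fix T :: "(int ^ 'd) set" assume "T \<in> {F. F \<subseteq> UNIV \<and> finite F}"
    then have T: "finite T" by simp
    define M where "M = (\<Union>z\<in>T. range (($) z))"
    have M: "finite M" unfolding M_def using T by auto
    let ?X = "{z :: int ^ 'd. \<forall>i. z $ i \<in> M}"
    have X: "finite ?X" by (rule finite_vec_box[OF M])
    have "T \<subseteq> ?X" unfolding M_def by auto
    then have "sum (\<lambda>z. \<Prod>i\<in>UNIV. g (z $ i)) T \<le> sum (\<lambda>z. \<Prod>i\<in>UNIV. g (z $ i)) ?X"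
      using X g by (intro sum_mono2) (auto intro: prod_nonneg)
    also have "\<dots> = (sum g M) ^ CARD('d)" by (rule sum_prod_box[OF M])
    also have "\<dots> \<le> (infsum g UNIV) ^ CARD('d)"
      using M g by (intro power_mono finite_sum_le_infsum) (auto intro: sum_nonneg)
    finally show "sum (\<lambda>z. \<Prod>i\<in>UNIV. g (z $ i)) T \<le> (infsum g UNIV) ^ CARD('d)" .
  qed
qed (use g in \<open>auto intro: prod_nonneg\<close>)

lemma lattice_dist_translate: "lattice_dist (x - z) (y - z) = lattice_dist x y"
  unfolding lattice_dist_def by simp

lemma lattice_dist_ge_one:
  fixes x y :: "int ^ 'd"
  assumes "x \<noteq> y" shows "1 \<le> lattice_dist x y"
proof -
  obtain i where i: "x $ i \<noteq> y $ i" using assms by (auto simp: vec_eq_iff)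
  then have "1 \<le> \<bar>x $ i - y $ i\<bar>" by simp
  then have "1 \<le> \<bar>real_of_int (x $ i) - real_of_int (y $ i)\<bar>" by (metis of_int_1_le_iff of_int_abs of_int_diff)
  also have "\<dots> \<le> lattice_dist x y"
    unfolding lattice_dist_def by (rule member_le_sum[where f = "\<lambda>i. \<bar>real_of_int (x $ i) - real_of_int (y $ i)\<bar>"]) auto
  finally show ?thesis .
qed

text \<open>As for the Green function, a product bound replaces polar coordinates: for \<open>z \<noteq> 0\<close> every coordinate satisfies
\<open>1 + |z\<^sub>i| \<le> 2 |z|\<close>, so \<open>|z| powr (-d b)\<close> is at most a constant times the product of the
\<open>(1 + |z\<^sub>i|) powr (-b)\<close>, and \<open>b = 1 + 2s/d > 1\<close>.\<close>

lemma lattice_dist_powr_summable: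
  assumes s: "0 < s"
  shows "(\<lambda>z :: int ^ 'd. if z = 0 then 0 else lattice_dist z 0 powr (- real CARD('d) - 2 * s)) summable_on UNIV"
proof -
  define b where "b = 1 + 2 * s / real CARD('d)"
  have b: "1 < b" unfolding b_def using s by simp
  have bd: "- real CARD('d) - 2 * s = - b * real CARD('d)" unfolding b_def by (simp add: field_simps)
  have "(\<lambda>z :: int ^ 'd. 2 powr (b * real CARD('d)) * (\<Prod>i\<in>UNIV. (1 + \<bar>real_of_int (z $ i)\<bar>) powr (- b))) summable_on UNIV"
    by (intro summable_on_cmult_right lattice_prod_summable summable_int_weight b) auto
  then show ?thesis
  proof (rule summable_on_comparison_test)
    fix z :: "int ^ 'd"
    show "(if z = 0 then 0 else lattice_dist z 0 powr (- real CARD('d) - 2 * s))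
      \<le> 2 powr (b * real CARD('d)) * (\<Prod>i\<in>UNIV. (1 + \<bar>real_of_int (z $ i)\<bar>) powr (- b))"
    proof (cases "z = 0")
      case True
      then show ?thesis by (auto intro!: mult_nonneg_nonneg prod_nonneg)
    next
      case False
      define N where "N = lattice_dist z 0"
      have N1: "1 \<le> N" unfolding N_def by (rule lattice_dist_ge_one[OF False])
      have le: "1 + \<bar>real_of_int (z $ i)\<bar> \<le> 2 * N" for i
      proof -
        have "\<bar>real_of_int (z $ i)\<bar> \<le> N"
          unfolding N_def lattice_dist_def
          using member_le_sum[of i UNIV "\<lambda>i. \<bar>real_of_int (z $ i) - real_of_int ((0 :: int ^ 'd) $ i)\<bar>"] by simp
        then show ?thesis using N1 by simp
      qed
      have "N powr (- b * real CARD('d)) = 2 powr (b * real CARD('d)) * (2 * N) powr (- b * real CARD('d))"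
        using N1 by (simp add: powr_mult powr_minus field_simps)
      also have "(2 * N) powr (- b * real CARD('d)) = ((2 * N) powr (- b)) powr real CARD('d)"
        by (simp only: powr_powr)
      also have "\<dots> = ((2 * N) powr (- b)) ^ CARD('d)"
        using N1 by (intro powr_realpow) simp
      also have "\<dots> = (\<Prod>i\<in>(UNIV :: 'd set). (2 * N) powr (- b))" by simp
      also have "\<dots> \<le> (\<Prod>i\<in>UNIV. (1 + \<bar>real_of_int (z $ i)\<bar>) powr (- b))"
        using le b by (intro prod_mono conjI powr_mono2') auto
      finally have "N powr (- b * real CARD('d)) \<le> 2 powr (b * real CARD('d)) * (\<Prod>i\<in>UNIV. (1 + \<bar>real_of_int (z $ i)\<bar>) powr (- b))"
        by (simp add: mult_left_mono)
      then show ?thesis using False unfolding N_def bd by simp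
    qed
  qed auto
qed

proposition fractional_kernel_row_sums:
  fixes W :: "int ^ 'd \<Rightarrow> int ^ 'd \<Rightarrow> real"
  assumes s: "0 < s" and W: "fractional_kernel s W"
  obtains wt where "\<And>x. (\<lambda>y. if x = y then 0 else W x y) summable_on UNIV"
    "\<And>x. (\<Sum>\<^sub>\<infinity>y. if x = y then 0 else W x y) \<le> wt"
proof -
  have "\<exists>c>0. \<exists>C>0. \<forall>x y. x \<noteq> y \<longrightarrow>
        c * lattice_dist x y powr (- real CARD('d) - 2 * s) \<le> W x y \<and>
        W x y \<le> C * lattice_dist x y powr (- real CARD('d) - 2 * s)"
    using W unfolding fractional_kernel_def by (rule conjunct2)
  then obtain c C where C0: "\<forall>x y. x \<noteq> y \<longrightarrow>
        c * lattice_dist x y powr (- real CARD('d) - 2 * s) \<le> W x y \<and>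
        W x y \<le> C * lattice_dist x y powr (- real CARD('d) - 2 * s)"
    by (elim exE conjE) (rule that)
  have C: "W x y \<le> C * lattice_dist x y powr (- real CARD('d) - 2 * s)" if "x \<noteq> y" for x y
    using C0[rule_format, OF that] by (rule conjunct2)
  have "\<forall>x y. x \<noteq> y \<longrightarrow> W x y = W y x \<and> 0 < W x y"
    using W unfolding fractional_kernel_def by (rule conjunct1)
  then have W0: "x \<noteq> y \<Longrightarrow> 0 < W x y" for x y by simp
  define g where "g z = C * (if z = 0 then 0 else lattice_dist z 0 powr (- real CARD('d) - 2 * s))" for z :: "int ^ 'd"
  have gs: "g summable_on UNIV" unfolding g_def by (intro summable_on_cmult_right lattice_dist_powr_summable s)
  have bij: "bij_betw (\<lambda>y. y - x) UNIV UNIV" for x :: "int ^ 'd"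
    by (rule bij_betwI[of _ _ _ "\<lambda>y. y + x"]) auto
  have sym: "lattice_dist x y = lattice_dist y x" for x y :: "int ^ 'd"
    unfolding lattice_dist_def by (simp add: abs_minus_commute)
  have gx: "(\<lambda>y. g (y - x)) summable_on UNIV" "(\<Sum>\<^sub>\<infinity>y. g (y - x)) = infsum g UNIV" for x
    using summable_on_reindex_bij_betw[OF bij, of g x] infsum_reindex_bij_betw[OF bij, of g x] gs by auto
  have le: "(if x = y then 0 else W x y) \<le> g (y - x)" for x y
  proof (cases "x = y")
    case False
    have "lattice_dist (y - x) 0 = lattice_dist x y"
      using lattice_dist_translate[of y x x] sym[of x y] by simp
    then show ?thesis using C[OF False] False unfolding g_def by simp
  qed (simp add: g_def)
  have ws: "(\<lambda>y. if x = y then 0 else W x y) summable_on UNIV" for x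
    by (rule summable_on_comparison_test[OF gx(1)[of x]]) (use le W0 in \<open>auto intro: less_imp_le\<close>)
  have "(\<Sum>\<^sub>\<infinity>y. if x = y then 0 else W x y) \<le> infsum g UNIV" for x
    using infsum_mono[OF ws[of x] gx(1)[of x] le] gx(2)[of x] by simp
  then show ?thesis by (rule that[OF ws])
qed

section \<open>The solution\<close>

lemma antideriv_deriv:
  assumes f: "continuous_on UNIV f"
  shows "(antideriv f has_real_derivative f t) (at t)" "antideriv f 0 = 0"
proof -
  have "\<exists>G. \<forall>x::real. - \<infinity> < ereal x \<longrightarrow> ereal x < \<infinity> \<longrightarrow> (G has_vector_derivative f x) (at x)"
    by (rule einterval_antiderivative) (use f in \<open>auto simp: continuous_on_eq_continuous_at\<close>)
  then obtain G where G: "\<And>x. (G has_vector_derivative f x) (at x)" by auto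
  have a: "antideriv f x = G x - G 0" for x
    unfolding antideriv_def zero_ereal_def
    by (rule interval_integral_FTC_finite)
       (auto intro: continuous_on_subset[OF f] has_vector_derivative_at_within[OF G])
  show "antideriv f 0 = 0" unfolding a by simp
  have "((\<lambda>x. G x - G 0) has_real_derivative f t) (at t)"
    using G[of t] by (auto intro!: derivative_eq_intros simp: has_real_derivative_iff_has_vector_derivative)
  then show "(antideriv f has_real_derivative f t) (at t)" unfolding a[abs_def] .
qed

lemma finite_lattice_ball: "finite {x :: int ^ 'd. lattice_dist x z \<le> r}"
proof -
  define M where "M = (\<Union>i. {z $ i - \<lceil>r\<rceil> .. z $ i + \<lceil>r\<rceil>})"
  have "x $ i \<in> M" if "lattice_dist x z \<le> r" for x i
  proof -
    have "\<bar>real_of_int (x $ i) - real_of_int (z $ i)\<bar> \<le> lattice_dist x z"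
      unfolding lattice_dist_def by (rule member_le_sum[where f = "\<lambda>i. \<bar>real_of_int (x $ i) - real_of_int (z $ i)\<bar>"]) auto
    then have "\<bar>real_of_int (x $ i) - real_of_int (z $ i)\<bar> \<le> of_int \<lceil>r\<rceil>" using that by linarith
    then have "\<bar>x $ i - z $ i\<bar> \<le> \<lceil>r\<rceil>" by linarith
    then show ?thesis unfolding M_def by (auto intro!: exI[of _ i])
  qed
  then have "{x :: int ^ 'd. lattice_dist x z \<le> r} \<subseteq> {x. \<forall>i. x $ i \<in> M}" by auto
  moreover have "finite M" unfolding M_def by auto
  ultimately show ?thesis using finite_subset finite_vec_box by blast
qed

lemma finite_sublevel_if_coercive:
  fixes h :: "int ^ 'd \<Rightarrow> real"
  assumes "filterlim h at_top (filtercomap (\<lambda>x. lattice_dist x x0) at_top)"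
  shows "finite {x. h x \<le> L}"
proof -
  have "eventually (\<lambda>x. L + 1 \<le> h x) (filtercomap (\<lambda>x. lattice_dist x x0) at_top)"
    using assms by (simp add: filterlim_at_top)
  then obtain r where r: "\<And>x. r \<le> lattice_dist x x0 \<Longrightarrow> L + 1 \<le> h x"
    unfolding eventually_filtercomap_at_top_linorder by blast
  have "{x. h x \<le> L} \<subseteq> {x. lattice_dist x x0 \<le> r}"
  proof
    fix x assume "x \<in> {x. h x \<le> L}"
    then show "x \<in> {x. lattice_dist x x0 \<le> r}" using r[of x] by force
  qed
  then show ?thesis using finite_lattice_ball finite_subset by blast
qed

theorem theorem1p1:
  fixes W :: "int ^ 'd \<Rightarrow> int ^ 'd \<Rightarrow> real"
    and h :: "int ^ 'd \<Rightarrow> real"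
    and f :: "real \<Rightarrow> real"
    and s p \<alpha> :: real
  assumes s: "0 < s" "s < 1"
    and p: "2 \<le> p"
    and \<alpha>: "0 < \<alpha>" "\<alpha> < real CARD('d)"
    and W: "fractional_kernel s W"
    and h_lower: "\<exists>h0>0. \<forall>x. h0 \<le> h x"
    and h_coercive: "\<exists>x0. filterlim h at_top (filtercomap (\<lambda>x. lattice_dist x x0) at_top)"
    and f_cont: "continuous_on UNIV f"
    and f_zero: "f 0 = 0"
    and f_small: "f \<in> o[at_right 0](\<lambda>t. t powr (p - 1))"
    and f_growth: "\<exists>C>0. \<exists>\<tau>. \<tau> > (real CARD('d) + \<alpha>) * p / (2 * real CARD('d)) \<and>
          (\<forall>t>0. f t \<le> C * (1 + t powr (\<tau> - 1)))"
    and f_AR: "\<exists>\<theta>>p. \<forall>t>0. 0 \<le> \<theta> * antideriv f t \<and> \<theta> * antideriv f t \<le> 2 * f t * t"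
    and f_nonzero: "\<exists>t>0. f t \<noteq> 0"
  shows "\<exists>u. nontrivial_weak_solution W p \<alpha> h f u \<and> (\<forall>x. 0 < u x)"
proof -
  obtain wt where wt: "\<And>x. off_diagonal W x summable_on UNIV" "\<And>x. infsum (off_diagonal W x) UNIV \<le> wt"
    using fractional_kernel_row_sums[OF s(1) W] unfolding off_diagonal_def by blast
  have "\<forall>x y. x \<noteq> y \<longrightarrow> W x y = W y x \<and> 0 < W x y"
    using W unfolding fractional_kernel_def by (rule conjunct1)
  then have Wp: "W x y = W y x" "0 < W x y" if "x \<noteq> y" for x y using that by simp_all
  obtain h0 where h0: "0 < h0" "\<And>x. h0 \<le> h x" using h_lower by blast
  obtain x0 where x0: "filterlim h at_top (filtercomap (\<lambda>x. lattice_dist x x0) at_top)" using h_coercive by blast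
  obtain \<theta> where \<theta>: "p < \<theta>" "\<And>t. 0 < t \<Longrightarrow> 0 \<le> \<theta> * antideriv f t \<and> \<theta> * antideriv f t \<le> 2 * f t * t"
    using f_AR by blast
  have small: "\<exists>d>0. \<forall>t. 0 < t \<and> t < d \<longrightarrow> f t \<le> e * t powr (p - 1)" if e: "0 < e" for e
  proof -
    have "eventually (\<lambda>t. norm (f t) \<le> e * norm (t powr (p - 1))) (at_right 0)"
      by (rule landau_o.smallD[OF f_small e])
    then obtain d where d: "0 < d" "\<And>t. 0 < t \<Longrightarrow> t < d \<Longrightarrow> norm (f t) \<le> e * norm (t powr (p - 1))"
      by (auto simp: eventually_at_right_field)
    have "f t \<le> e * t powr (p - 1)" if "0 < t" "t < d" for t using d(2)[OF that] by simp
    then show ?thesis using d(1) by blast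
  qed
  interpret lattice_energy W wt h p h0
    by unfold_locales (use wt Wp h0 p in \<open>auto simp: off_diagonal_def intro: less_imp_le\<close>)
  let ?r = "green \<alpha> (0 :: int ^ 'd) 0"
  interpret choquard "off_diagonal W" wt "green \<alpha>" h f "antideriv f" p h0 ?r ?r \<theta>
  proof unfold_locales
    show "green \<alpha> x y = green \<alpha> y x" "0 \<le> green \<alpha> x y" "green \<alpha> x y \<le> ?r" "?r \<le> green \<alpha> x x" "0 < ?r" for x y :: "int ^ 'd"
      using green_properties(1)[OF \<alpha>, of x y] green_properties(2)[OF \<alpha>, of x y]
        green_properties(3)[OF \<alpha>, of x y] green_properties(4)[OF \<alpha>, of x] green_properties(5)[OF \<alpha>]
      by simp_all
    show "off_diagonal W x y > 0" if "x \<noteq> y" for x y using Wp that by (simp add: off_diagonal_def)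
    show "h0 \<le> h x" for x by (rule h_ge)
    show "finite {x. h x \<le> L}" for L by (rule finite_sublevel_if_coercive[OF x0])
    show "(antideriv f has_real_derivative f t) (at t)" "antideriv f 0 = 0" for t
      using antideriv_deriv[OF f_cont] by auto
    show "0 \<le> \<theta> * antideriv f t \<and> \<theta> * antideriv f t \<le> 2 * f t * t" if "0 < t" for t using \<theta>(2)[OF that] .
  qed (use p \<theta> h0 f_cont f_zero small f_nonzero in auto)
  obtain u where u: "\<And>x. 0 < u x" "(\<lambda>x. h x * \<bar>u x\<bar> powr p) summable_on UNIV"
    "\<And>z. (\<lambda>y. green \<alpha> z y * antideriv f (u y)) summable_on UNIV"
    and weak: "\<And>\<phi>. (\<lambda>x. h x * \<bar>\<phi> x\<bar> powr p) summable_on UNIV \<Longrightarrow>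
      \<exists>I. ((\<lambda>x. grad_weight p u x * (1 / 2 * (\<Sum>\<^sub>\<infinity>y. off_diagonal W x y * (u x - u y) * (\<phi> x - \<phi> y)))
             + h x * \<bar>u x\<bar> powr (p - 2) * u x * \<phi> x) has_sum I) UNIV \<and>
          ((\<lambda>x. (\<Sum>\<^sub>\<infinity>y. green \<alpha> x y * antideriv f (u y)) * f (u x) * \<phi> x) has_sum I) UNIV"
    by (rule positive_solution, rule that)
  have "nontrivial_weak_solution W p \<alpha> h f u"
    unfolding nontrivial_weak_solution_def
  proof (intro conjI allI ballI)
    show "u \<in> H_space W p h" by (rule H_spaceI[OF u(2)])
    show "u \<noteq> (\<lambda>x. 0)" using u(1)[of 0] by auto
    show "(\<lambda>y. green \<alpha> x y * antideriv f (u y)) summable_on UNIV" for x by (rule u(3))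
    fix \<phi> assume "\<phi> \<in> H_space W p h"
    from weak[OF H_spaceD[OF this]]
    show "\<exists>I. ((\<lambda>x. grad_norm W u x powr (p - 2) * grad_prod W u \<phi> x
              + h x * \<bar>u x\<bar> powr (p - 2) * u x * \<phi> x) has_sum I) UNIV \<and>
        ((\<lambda>x. green_conv \<alpha> (\<lambda>y. antideriv f (u y)) x * f (u x) * \<phi> x) has_sum I) UNIV"
      unfolding grad_prod_off_diagonal grad_norm_eq grad_weight_def green_conv_def .
  qed
  then show ?thesis using u(1) by blast
qed

end
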